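(* The semi-discrete EMAC-Reg system is well-posed. Here the system is: given $w_h^0,u_h^0\in V_h$, find $(u_h,P_h,w_h,\lambda_h)\in (X_h,Q_h,X_h,Q_h)\times(0,T]$ such that for all $(v_h,q_h,\chi_h,r_h)\in (X_h,Q_h,X_h,Q_h)$, $$((u_h)_t,v_h)+c(w_h,w_h,v_h)-(P_h,\nabla\cdot v_h)+\nu(\nabla u_h,\nabla v_h)=(f,v_h),$$ $$(\nabla\cdot u_h,q_h)=0,$$ $$(\lambda_h,\nabla\cdot\chi_h)+\alpha^2(\nabla w_h,\nabla\chi_h)+(w_h,\chi_h)=(u_h,\chi_h),$$ $$(\nabla\cdot w_h,r_h)=0.$$
   Context: $\Omega\subset\mathbb{R}^d$, $d=2,3$, is a convex polygonal domain; $(\cdot,\cdot)$ is the $L^2(\Omega)$ inner product. $\nu>0$ is the kinematic viscosity, $\alpha>0$ the filtering radius, $T>0$ the end time and $f$ the external force. $X=\{v\in H^1(\Omega)^d: v|_{\partial\Omega}=0\}$ and $Q=\{q\in L^2(\Omega):\int_\Omega q\,dx=0\}$. $X_h=X\cap P_k(\mathcal{T}_h)$ and $Q_h=Q\cap P_{k-1}(\mathcal{T}_h)$ are finite element velocity and pressure spaces (piecewise polynomials of degree $k$ and $k-1$) on a conforming triangulation $\mathcal{T}_h$ of $\Omega$, assumed to satisfy the inf-sup (LBB) condition. $V_h=\{v_h\in X_h:(\nabla\cdot v_h,q_h)=0\ \forall q_h\in Q_h\}$. The data $u_h^0$, $w_h^0$ are the initial values of $u_h$, $w_h$. For $u,v,w\in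 X$, $c(u,v,w)=2(D(u)v,w)+((\nabla\cdot u)v,w)$ with $D(u)=\tfrac12(\nabla u+(\nabla u)^T)$.
   Formalization: The initial values u_h^0, w_h^0 in V_h must satisfy the discrete filter equation, since otherwise (e.g. u_h^0=0, w_h^0≠0) no solution attains both continuously; f(t) is taken in L^2 with (f(t),v_h) continuous in time. *)

theory Defs
  imports "HOL-Analysis.Analysis"
begin

section \<open>The domain and its triangulation\<close>

definition convex_polygonal_domain :: "(real^'n) set \<Rightarrow> bool" where
  "convex_polygonal_domain \<Omega> \<longleftrightarrow>
     \<Omega> \<noteq> {} \<and> open \<Omega> \<and> convex \<Omega> \<and> polytope (closure \<Omega>)"

text \<open>The library predicate \<open>triangulation\<close> is a finite family of simplices (of any
  dimension), any two of which meet in a common, possibly empty, face.\<close>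

definition conforming_triangulation :: "(real^'n) set \<Rightarrow> (real^'n) set set \<Rightarrow> bool" where
  "conforming_triangulation \<Omega> \<T> \<longleftrightarrow>
     triangulation \<T> \<and> (\<forall>K\<in>\<T>. int CARD('n) simplex K) \<and> \<Union>\<T> = closure \<Omega>"


section \<open>Lebesgue and Sobolev spaces\<close>

text \<open>Elements of function spaces are represented by functions on the whole Euclidean space, of
  which only the restriction to \<open>\<Omega>\<close> matters; functions that agree almost everywhere on \<open>\<Omega>\<close>
  represent the same element. On matrices the inner product is the Frobenius one.\<close>

definition L2_space :: "(real^'n) set \<Rightarrow> (real^'n \<Rightarrow> 'b::euclidean_space) set" where
  "L2_space \<Omega> = {v. v \<in> borel_measurable (lebesgue_on \<Omega>) \<and>
                    integrable (lebesgue_on \<Omega>) (\<lambda>x. (norm (v x))\<^sup>2)}"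

definition L2_inner ::
    "(real^'n) set \<Rightarrow> (real^'n \<Rightarrow> 'b::euclidean_space) \<Rightarrow> (real^'n \<Rightarrow> 'b) \<Rightarrow> real" where
  "L2_inner \<Omega> v w = (\<integral>x. v x \<bullet> w x \<partial>lebesgue_on \<Omega>)"

definition L2_norm :: "(real^'n) set \<Rightarrow> (real^'n \<Rightarrow> 'b::euclidean_space) \<Rightarrow> real" where
  "L2_norm \<Omega> v = sqrt (L2_inner \<Omega> v v)"

text \<open>Test functions are the continuously differentiable functions with compact support in
  \<open>\<Omega>\<close>, the convention of Gilbarg and Trudinger for first-order weak derivatives.\<close>

definition C1_compact_support ::
    "(real^'n) set \<Rightarrow> (real^'n \<Rightarrow> 'b::real_normed_vector) set" where
  "C1_compact_support \<Omega> = {\<phi>.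
     (\<forall>x. \<phi> differentiable (at x)) \<and>
     (\<forall>h. continuous_on UNIV (\<lambda>x. frechet_derivative \<phi> (at x) h)) \<and>
     (\<exists>K. compact K \<and> K \<subseteq> \<Omega> \<and> (\<forall>x. x \<notin> K \<longrightarrow> \<phi> x = 0))}"

text \<open>Here \<open>G x $ i $ j\<close> is the weak derivative of the \<open>i\<close>-th component of \<open>v\<close> in the
  \<open>j\<close>-th coordinate direction.\<close>

definition has_weak_gradient ::
    "(real^'n) set \<Rightarrow> (real^'n \<Rightarrow> real^'n) \<Rightarrow> (real^'n \<Rightarrow> real^'n^'n) \<Rightarrow> bool" where
  "has_weak_gradient \<Omega> v G \<longleftrightarrow>
     (\<forall>\<phi>\<in>C1_compact_support \<Omega>. \<forall>i j.
        (\<integral>x. v x $ i * frechet_derivative \<phi> (at x) (axis j 1) \<partial>lebesgue_on \<Omega>)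
          = - (\<integral>x. G x $ i $ j * \<phi> x \<partial>lebesgue_on \<Omega>))"

definition H1_space :: "(real^'n) set \<Rightarrow> (real^'n \<Rightarrow> real^'n) set" where
  "H1_space \<Omega> = {v \<in> L2_space \<Omega>. \<exists>G\<in>L2_space \<Omega>. has_weak_gradient \<Omega> v G}"

definition grad :: "(real^'n) set \<Rightarrow> (real^'n \<Rightarrow> real^'n) \<Rightarrow> real^'n \<Rightarrow> real^'n^'n" where
  "grad \<Omega> v = (SOME G. G \<in> L2_space \<Omega> \<and> has_weak_gradient \<Omega> v G)"

definition div_field :: "(real^'n) set \<Rightarrow> (real^'n \<Rightarrow> real^'n) \<Rightarrow> real^'n \<Rightarrow> real" where
  "div_field \<Omega> v x = trace (grad \<Omega> v x)"

definition sym_grad :: "(real^'n) set \<Rightarrow> (real^'n \<Rightarrow> real^'n) \<Rightarrow> real^'n \<Rightarrow> real^'n^'n" where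
  "sym_grad \<Omega> v x = (1/2) *\<^sub>R (grad \<Omega> v x + transpose (grad \<Omega> v x))"

definition H1_norm :: "(real^'n) set \<Rightarrow> (real^'n \<Rightarrow> real^'n) \<Rightarrow> real" where
  "H1_norm \<Omega> v = sqrt ((L2_norm \<Omega> v)\<^sup>2 + (L2_norm \<Omega> (grad \<Omega> v))\<^sup>2)"

text \<open>For \<open>v\<close> in \<open>H1_space \<Omega>\<close>, the boundary condition \<open>v = 0\<close> on the boundary of \<open>\<Omega>\<close> is
  understood in the usual Sobolev sense: \<open>v\<close> is a limit in the \<open>H1\<close> norm of test functions.\<close>

definition velocity_space :: "(real^'n) set \<Rightarrow> (real^'n \<Rightarrow> real^'n) set" where
  "velocity_space \<Omega> = {v \<in> H1_space \<Omega>.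
     \<exists>\<phi>. (\<forall>m::nat. \<phi> m \<in> C1_compact_support \<Omega>) \<and>
         (\<lambda>m. H1_norm \<Omega> (\<lambda>x. \<phi> m x - v x)) \<longlonglongrightarrow> 0}"

definition pressure_space :: "(real^'n) set \<Rightarrow> (real^'n \<Rightarrow> real) set" where
  "pressure_space \<Omega> = {q \<in> L2_space \<Omega>. (\<integral>x. q x \<partial>lebesgue_on \<Omega>) = 0}"


section \<open>Finite element spaces\<close>

definition poly_space :: "nat \<Rightarrow> (real^'n \<Rightarrow> real) set" where
  "poly_space k = {p. \<exists>c :: ('n \<Rightarrow> nat) \<Rightarrow> real.
     \<forall>x. p x = (\<Sum>e | (\<Sum>i\<in>UNIV. e i) \<le> k. c e * (\<Prod>i\<in>UNIV. (x $ i) ^ e i))}"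

definition piecewise_poly :: "(real^'n) set set \<Rightarrow> nat \<Rightarrow> (real^'n \<Rightarrow> real) set" where
  "piecewise_poly \<T> k =
     {q. \<forall>K\<in>\<T>. \<exists>p\<in>poly_space k. AE x in lebesgue_on K. q x = p x}"

definition fe_velocity ::
    "(real^'n) set \<Rightarrow> (real^'n) set set \<Rightarrow> nat \<Rightarrow> (real^'n \<Rightarrow> real^'n) set" where
  "fe_velocity \<Omega> \<T> k = {v \<in> velocity_space \<Omega>. \<forall>i. (\<lambda>x. v x $ i) \<in> piecewise_poly \<T> k}"

definition fe_pressure ::
    "(real^'n) set \<Rightarrow> (real^'n) set set \<Rightarrow> nat \<Rightarrow> (real^'n \<Rightarrow> real) set" where
  "fe_pressure \<Omega> \<T> k = pressure_space \<Omega> \<inter> piecewise_poly \<T> (k - 1)"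

definition fe_div_free ::
    "(real^'n) set \<Rightarrow> (real^'n) set set \<Rightarrow> nat \<Rightarrow> (real^'n \<Rightarrow> real^'n) set" where
  "fe_div_free \<Omega> \<T> k =
     {v \<in> fe_velocity \<Omega> \<T> k. \<forall>q\<in>fe_pressure \<Omega> \<T> k. L2_inner \<Omega> (div_field \<Omega> v) q = 0}"

text \<open>The supremum is usually taken over \<open>v \<noteq> 0\<close>; since \<open>x / 0 = 0\<close>, including \<open>v = 0\<close> adds
  only the value \<open>0\<close>, and it keeps the set nonempty.\<close>

definition inf_sup_condition :: "(real^'n) set \<Rightarrow> (real^'n) set set \<Rightarrow> nat \<Rightarrow> bool" where
  "inf_sup_condition \<Omega> \<T> k \<longleftrightarrow>
     (\<exists>\<beta>>0. \<forall>q\<in>fe_pressure \<Omega> \<T> k.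
        \<beta> * L2_norm \<Omega> q
          \<le> (SUP v\<in>fe_velocity \<Omega> \<T> k. L2_inner \<Omega> q (div_field \<Omega> v) / L2_norm \<Omega> (grad \<Omega> v)))"


section \<open>The semi-discrete system\<close>

definition emac_form :: "(real^'n) set \<Rightarrow> (real^'n \<Rightarrow> real^'n) \<Rightarrow> (real^'n \<Rightarrow> real^'n)
    \<Rightarrow> (real^'n \<Rightarrow> real^'n) \<Rightarrow> real" where
  "emac_form \<Omega> u v w =
     2 * L2_inner \<Omega> (\<lambda>x. sym_grad \<Omega> u x *v v x) w
       + L2_inner \<Omega> (\<lambda>x. div_field \<Omega> u x *\<^sub>R v x) w"

definition momentum_eq where
  "momentum_eq \<Omega> \<T> k \<nu> f u u' P w \<longleftrightarrow>
     (\<forall>v\<in>fe_velocity \<Omega> \<T> k.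
        L2_inner \<Omega> u' v + emac_form \<Omega> w w v - L2_inner \<Omega> P (div_field \<Omega> v)
          + \<nu> * L2_inner \<Omega> (grad \<Omega> u) (grad \<Omega> v) = L2_inner \<Omega> f v)"

definition filter_eq where
  "filter_eq \<Omega> \<T> k \<alpha> u w lam \<longleftrightarrow>
     (\<forall>v\<in>fe_velocity \<Omega> \<T> k.
        L2_inner \<Omega> lam (div_field \<Omega> v) + \<alpha>\<^sup>2 * L2_inner \<Omega> (grad \<Omega> w) (grad \<Omega> v)
          + L2_inner \<Omega> w v = L2_inner \<Omega> u v)"

definition incompressible_eq where
  "incompressible_eq \<Omega> \<T> k u \<longleftrightarrow>
     (\<forall>q\<in>fe_pressure \<Omega> \<T> k. L2_inner \<Omega> (div_field \<Omega> u) q = 0)"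

definition L2_continuous_on ::
    "(real^'n) set \<Rightarrow> real set \<Rightarrow> (real \<Rightarrow> real^'n \<Rightarrow> real^'n) \<Rightarrow> bool" where
  "L2_continuous_on \<Omega> S u \<longleftrightarrow>
     (\<forall>t\<in>S. ((\<lambda>s. L2_norm \<Omega> (\<lambda>x. u s x - u t x)) \<longlongrightarrow> 0) (at t within S))"

definition has_L2_derivative :: "(real^'n) set \<Rightarrow> (real \<Rightarrow> real^'n \<Rightarrow> real^'n)
    \<Rightarrow> (real^'n \<Rightarrow> real^'n) \<Rightarrow> real \<Rightarrow> real set \<Rightarrow> bool" where
  "has_L2_derivative \<Omega> u u' t S \<longleftrightarrow>
     ((\<lambda>s. L2_norm \<Omega> (\<lambda>x. (u s x - u t x) /\<^sub>R (s - t) - u' x)) \<longlongrightarrow> 0) (at t within S)"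

text \<open>The system has no evolution equation for \<open>w\<close>: letting \<open>t\<close> tend to \<open>0\<close> in the filter
  equation shows that the initial values of a solution satisfy that equation themselves. The
  initial data \<open>u0\<close> and \<open>w0\<close> are therefore required to be related by it. The external force is
  continuous in time as far as the system sees it, that is, tested against discrete velocities;
  this covers every continuous function from \<open>{0..T}\<close> to \<open>L2_space \<Omega>\<close>.\<close>

definition emac_reg_data :: "(real^'n) set \<Rightarrow> (real^'n) set set \<Rightarrow> nat \<Rightarrow> real \<Rightarrow> real
    \<Rightarrow> (real \<Rightarrow> real^'n \<Rightarrow> real^'n) \<Rightarrow> (real^'n \<Rightarrow> real^'n) \<Rightarrow> (real^'n \<Rightarrow> real^'n) \<Rightarrow> bool" where
  "emac_reg_data \<Omega> \<T> k \<alpha> T f u0 w0 \<longleftrightarrow>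
     u0 \<in> fe_div_free \<Omega> \<T> k \<and> w0 \<in> fe_div_free \<Omega> \<T> k \<and>
     (\<exists>lam0\<in>fe_pressure \<Omega> \<T> k. filter_eq \<Omega> \<T> k \<alpha> u0 w0 lam0) \<and>
     (\<forall>t\<in>{0..T}. f t \<in> L2_space \<Omega>) \<and>
     (\<forall>v\<in>fe_velocity \<Omega> \<T> k. continuous_on {0..T} (\<lambda>t. L2_inner \<Omega> (f t) v))"

definition emac_reg_solution :: "(real^'n) set \<Rightarrow> (real^'n) set set \<Rightarrow> nat \<Rightarrow> real \<Rightarrow> real \<Rightarrow> real
    \<Rightarrow> (real \<Rightarrow> real^'n \<Rightarrow> real^'n) \<Rightarrow> (real^'n \<Rightarrow> real^'n) \<Rightarrow> (real^'n \<Rightarrow> real^'n)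
    \<Rightarrow> (real \<Rightarrow> real^'n \<Rightarrow> real^'n) \<Rightarrow> (real \<Rightarrow> real^'n \<Rightarrow> real)
    \<Rightarrow> (real \<Rightarrow> real^'n \<Rightarrow> real^'n) \<Rightarrow> (real \<Rightarrow> real^'n \<Rightarrow> real) \<Rightarrow> bool" where
  "emac_reg_solution \<Omega> \<T> k \<nu> \<alpha> T f u0 w0 u P w lam \<longleftrightarrow>
     (\<forall>t\<in>{0..T}. u t \<in> fe_velocity \<Omega> \<T> k \<and> w t \<in> fe_velocity \<Omega> \<T> k) \<and>
     (\<forall>t\<in>{0<..T}. P t \<in> fe_pressure \<Omega> \<T> k \<and> lam t \<in> fe_pressure \<Omega> \<T> k) \<and>
     L2_continuous_on \<Omega> {0..T} u \<and> L2_continuous_on \<Omega> {0..T} w \<and>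
     (AE x in lebesgue_on \<Omega>. u 0 x = u0 x) \<and> (AE x in lebesgue_on \<Omega>. w 0 x = w0 x) \<and>
     (\<forall>t\<in>{0<..T}.
        (\<exists>u'\<in>fe_velocity \<Omega> \<T> k. has_L2_derivative \<Omega> u u' t {0..T} \<and>
           momentum_eq \<Omega> \<T> k \<nu> (f t) (u t) u' (P t) (w t)) \<and>
        incompressible_eq \<Omega> \<T> k (u t) \<and>
        filter_eq \<Omega> \<T> k \<alpha> (u t) (w t) (lam t) \<and>
        incompressible_eq \<Omega> \<T> k (w t))"

end

theory Submission
  imports Defs "HOL-Library.Function_Algebras"
begin

text \<open>Modulo almost everywhere equality the finite element spaces are finite-dimensional, so the
  system is an ordinary differential equation with a quadratic nonlinearity. Choose a basis of the
  discretely divergence-free velocities that is orthonormal for the filter form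
  \<open>m(w, v) = \<alpha>\<^sup>2 (\<nabla>w, \<nabla>v) + (w, v)\<close>. The filter equation says
  \<open>(u, v) = m(w, v)\<close>, so the coordinates of \<open>w\<close> determine \<open>u\<close>, and testing the momentum equation with
  the basis gives an explicit equation for them. Testing with \<open>w\<close> itself gives the energy identity
  for \<open>m(w, w)\<close>: the convective term vanishes because \<open>2 (D(w) w, w) + ((\<nabla>\<cdot>w) w, w) = 0\<close>, and
  the viscous term \<open>\<nu> (\<nabla>u, \<nabla>w)\<close> is nonnegative. This rules out blow-up. The difference \<open>e\<close> of two
  filtered velocities satisfies the same kind of identity, in which the cubic term \<open>c(e, e, e)\<close>
  vanishes again, so Gronwall's lemma yields stability and hence uniqueness. The multipliers
  exist because a functional that vanishes on the discretely divergence-free velocities is a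
  combination of the divergence constraints, and the inf-sup condition bounds them.\<close>

section \<open>Linear algebra up to null vectors\<close>

text \<open>Functions that agree almost everywhere are not identified, and values outside \<Omega>
  are arbitrary. The finite element spaces are thus infinite-dimensional as vector spaces, and the
  forms that serve as inner products are only semidefinite. Bases are bases modulo null vectors, and
  a functional may be expanded in one only after it is shown to ignore these. Bounds come from norm
  equivalence in finite dimension, so the constants depend on the mesh.

  The cancellation available for \<open>c\<close> has all three arguments equal. This forces
  \<open>w\<close>, not \<open>u\<close>, as test function and \<open>m(w, w)\<close> as energy:
  \<open>(u_t, w)\<close> is half its time derivative. A solution, however, has a time derivative
  for \<open>u\<close> only. For two given solutions the energy of the difference of the filtered
  velocities is therefore written as the sum of the squares of its coordinates, which the filter
  equation turns into L2 products of the difference of the \<open>u\<close> with the basis; these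
  can be differentiated. That equation holds at positive times, so the estimate is joined to time 0
  by continuity.\<close>

instantiation "fun" :: (type, real_vector) real_vector
begin

definition "c *\<^sub>R f = (\<lambda>x. c *\<^sub>R f x)"

instance
  by standard (simp_all add: scaleR_fun_def fun_eq_iff algebra_simps)

end

lemma scaleR_fun_apply [simp]: "(c *\<^sub>R f) x = c *\<^sub>R f x"
  by (simp add: scaleR_fun_def)

lemma sum_fun_apply [simp]: "(\<Sum>i\<in>I. f i) x = (\<Sum>i\<in>I. f i x)"
  by (induction I rule: infinite_finite_induct) auto

text \<open>Linearity is relative to a set because the integral defaults to 0 on functions that are
  not integrable: the L2 product is additive only among square integrable functions.\<close>

definition lin_on :: "'v::real_vector set \<Rightarrow> ('v \<Rightarrow> real) \<Rightarrow> bool" where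
  "lin_on S l \<longleftrightarrow> (\<forall>u\<in>S. \<forall>v\<in>S. l (u + v) = l u + l v) \<and> (\<forall>c. \<forall>u\<in>S. l (c *\<^sub>R u) = c * l u)"

lemma lin_onI:
  assumes "\<And>u v. u \<in> S \<Longrightarrow> v \<in> S \<Longrightarrow> l (u + v) = l u + l v"
    and "\<And>c u. u \<in> S \<Longrightarrow> l (c *\<^sub>R u) = c * l u"
  shows "lin_on S l"
  using assms by (auto simp: lin_on_def)

lemma lin_on_add: "lin_on S l \<Longrightarrow> u \<in> S \<Longrightarrow> v \<in> S \<Longrightarrow> l (u + v) = l u + l v"
  and lin_on_scaleR: "lin_on S l \<Longrightarrow> u \<in> S \<Longrightarrow> l (c *\<^sub>R u) = c * l u"
  by (auto simp: lin_on_def)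

lemma lin_on_diff:
  assumes "lin_on S l" "subspace S" "u \<in> S" "v \<in> S"
  shows "l (u - v) = l u - l v"
proof -
  have "l (u + (-1) *\<^sub>R v) = l u + (-1) * l v"
    using assms by (simp only: lin_on_add lin_on_scaleR subspace_scale)
  then show ?thesis by simp
qed

lemma lin_on_0:
  assumes "lin_on S l" "subspace S"
  shows "l 0 = 0"
  using lin_on_scaleR[OF assms(1) subspace_0[OF assms(2)], of 0] by simp

lemma lin_on_sum:
  assumes "lin_on S l" "subspace S" "\<And>i. i \<in> I \<Longrightarrow> f i \<in> S"
  shows "l (\<Sum>i\<in>I. f i) = (\<Sum>i\<in>I. l (f i))"
  using assms(3)
  by (induction I rule: infinite_finite_induct)
     (auto simp: lin_on_0[OF assms(1,2)] lin_on_add[OF assms(1)] subspace_sum[OF assms(2)])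

lemma lin_on_sum_scaleR:
  assumes "lin_on S l" "subspace S" "\<And>i. i \<in> I \<Longrightarrow> f i \<in> S"
  shows "l (\<Sum>i\<in>I. a i *\<^sub>R f i) = (\<Sum>i\<in>I. a i * l (f i))"
proof -
  have "l (\<Sum>i\<in>I. a i *\<^sub>R f i) = (\<Sum>i\<in>I. l (a i *\<^sub>R f i))"
    using assms by (intro lin_on_sum) (auto intro: subspace_scale)
  also have "\<dots> = (\<Sum>i\<in>I. a i * l (f i))"
    using assms by (intro sum.cong) (auto simp: lin_on_scaleR)
  finally show ?thesis .
qed

lemma lin_on_subset: "lin_on S l \<Longrightarrow> S' \<subseteq> S \<Longrightarrow> lin_on S' l"
  unfolding lin_on_def by (meson subsetD)

lemma lin_on_compose_add: "lin_on S l \<Longrightarrow> lin_on S k \<Longrightarrow> lin_on S (\<lambda>v. l v + k v)"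
  and lin_on_compose_diff: "lin_on S l \<Longrightarrow> lin_on S k \<Longrightarrow> lin_on S (\<lambda>v. l v - k v)"
  and lin_on_compose_mult: "lin_on S l \<Longrightarrow> lin_on S (\<lambda>v. c * l v)"
  by (auto simp: lin_on_def algebra_simps)

text \<open>Induction on the number of constraints: on the kernel of the last one, \<open>l\<close>
  is a combination of the others, and the missing coefficient is read off at a vector where
  \<open>d n\<close> equals 1. \<open>S\<close> may be infinite-dimensional. This is the algebra
  behind the multipliers \<open>P\<close> and \<open>lam\<close>.\<close>

lemma functional_in_span:
  fixes l :: "'v::real_vector \<Rightarrow> real" and d :: "nat \<Rightarrow> 'v \<Rightarrow> real"
  assumes "subspace S" "lin_on S l" "\<And>i. i < n \<Longrightarrow> lin_on S (d i)"
    and "\<And>v. v \<in> S \<Longrightarrow> (\<forall>i<n. d i v = 0) \<Longrightarrow> l v = 0"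
  shows "\<exists>c. \<forall>v\<in>S. l v = (\<Sum>i<n. c i * d i v)"
  using assms
proof (induction n arbitrary: S)
  case 0
  then show ?case by auto
next
  case (Suc n)
  let ?S' = "{v \<in> S. d n v = 0}"
  have dn: "lin_on S (d n)" using Suc.prems by auto
  have S': "subspace ?S'"
    using Suc.prems(1) dn lin_on_0[OF dn Suc.prems(1)]
    by (auto simp: subspace_def lin_on_def)
  have "\<exists>c. \<forall>v\<in>?S'. l v = (\<Sum>i<n. c i * d i v)"
  proof (rule Suc.IH[OF S'])
    show "lin_on ?S' l" by (rule lin_on_subset[OF Suc.prems(2)]) auto
    show "lin_on ?S' (d i)" if "i < n" for i
      by (rule lin_on_subset[OF Suc.prems(3)]) (use that in auto)
    show "l v = 0" if "v \<in> ?S'" "\<forall>i<n. d i v = 0" for v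
      using that Suc.prems(4)[of v] less_Suc_eq by auto
  qed
  then obtain c where c: "\<And>v. v \<in> ?S' \<Longrightarrow> l v = (\<Sum>i<n. c i * d i v)" by auto
  show ?case
  proof (cases "?S' = S")
    case True
    then have "\<forall>v\<in>S. l v = (\<Sum>i<Suc n. (c(n := 0)) i * d i v)"
      using c by simp
    then show ?thesis by blast
  next
    case False
    then obtain v0 where v0: "v0 \<in> S" "d n v0 \<noteq> 0" by auto
    define v1 where "v1 = (1 / d n v0) *\<^sub>R v0"
    have v1: "v1 \<in> S" "d n v1 = 1"
      using v0 Suc.prems(1) dn by (auto simp: v1_def subspace_scale lin_on_scaleR)
    define c' where "c' = c(n := l v1 - (\<Sum>i<n. c i * d i v1))"
    have "l v = (\<Sum>i<Suc n. c' i * d i v)" if v: "v \<in> S" for v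
    proof -
      define s where "s = v - d n v *\<^sub>R v1"
      have sv: "d n v *\<^sub>R v1 \<in> S" using v1 Suc.prems(1) by (simp add: subspace_scale)
      have s: "s \<in> S" unfolding s_def using sv v Suc.prems(1) by (simp add: subspace_diff)
      have ev: "f s = f v - d n v * f v1" if "lin_on S f" for f
        unfolding s_def using that v v1 sv Suc.prems(1) by (simp add: lin_on_diff lin_on_scaleR)
      have "d n s = 0" using ev[OF dn] v1 by simp
      then have "l s = (\<Sum>i<n. c i * d i s)" using c s by auto
      also have "\<dots> = (\<Sum>i<n. c i * (d i v - d n v * d i v1))"
        using ev Suc.prems(3) by (intro sum.cong) auto
      finally have "l v = (\<Sum>i<n. c i * (d i v - d n v * d i v1)) + d n v * l v1"
        using ev[OF Suc.prems(2)] by simp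
      also have "\<dots> = (\<Sum>i<Suc n. c' i * d i v)"
        by (simp add: c'_def algebra_simps sum_subtractf sum_distrib_left)
      finally show ?thesis .
    qed
    then show ?thesis by blast
  qed
qed

section \<open>Positive semidefinite forms\<close>

text \<open>Definiteness cannot be asked for: a function that vanishes almost everywhere is a null
  vector of the L2 product without being 0.\<close>

definition psd_on :: "'v::real_vector set \<Rightarrow> ('v \<Rightarrow> 'v \<Rightarrow> real) \<Rightarrow> bool" where
  "psd_on S B \<longleftrightarrow> (\<forall>u\<in>S. lin_on S (B u)) \<and> (\<forall>u\<in>S. \<forall>v\<in>S. B u v = B v u) \<and> (\<forall>u\<in>S. 0 \<le> B u u)"

lemma psd_on_lin: "psd_on S B \<Longrightarrow> u \<in> S \<Longrightarrow> lin_on S (B u)"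
  and psd_on_sym: "psd_on S B \<Longrightarrow> u \<in> S \<Longrightarrow> v \<in> S \<Longrightarrow> B u v = B v u"
  and psd_on_nonneg: "psd_on S B \<Longrightarrow> u \<in> S \<Longrightarrow> 0 \<le> B u u"
  by (auto simp: psd_on_def)

lemma psd_on_lin_left: "psd_on S B \<Longrightarrow> subspace S \<Longrightarrow> v \<in> S \<Longrightarrow> lin_on S (\<lambda>u. B u v)"
  unfolding psd_on_def lin_on_def by (metis subspace_add subspace_scale)

lemma psd_on_expand:
  assumes "psd_on S B" "subspace S" "u \<in> S" "v \<in> S"
  shows "B (u + c *\<^sub>R v) (u + c *\<^sub>R v) = B u u + 2 * c * B u v + c\<^sup>2 * B v v"
proof -
  have cv: "c *\<^sub>R v \<in> S" "u + c *\<^sub>R v \<in> S" using assms by (auto simp: subspace_add subspace_scale)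
  note r = psd_on_lin[OF assms(1)]
  have "B (u + c *\<^sub>R v) (u + c *\<^sub>R v) = B (u + c *\<^sub>R v) u + c * B (u + c *\<^sub>R v) v"
    using r[OF cv(2)] assms cv by (simp add: lin_on_add lin_on_scaleR)
  also have "B (u + c *\<^sub>R v) u = B u u + c * B u v"
    using psd_on_lin_left[OF assms(1,2,3)] assms cv psd_on_sym[OF assms(1,3,4)]
    by (simp add: lin_on_add[where l="\<lambda>w. B w u"] lin_on_scaleR[where l="\<lambda>w. B w u"])
  also have "B (u + c *\<^sub>R v) v = B u v + c * B v v"
    using psd_on_lin_left[OF assms(1,2,4)] assms cv
    by (simp add: lin_on_add[where l="\<lambda>w. B w v"] lin_on_scaleR[where l="\<lambda>w. B w v"])
  finally show ?thesis by (simp add: algebra_simps power2_eq_square)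
qed

lemma psd_on_cauchy_schwarz:
  assumes "psd_on S B" "subspace S" "u \<in> S" "v \<in> S"
  shows "\<bar>B u v\<bar> \<le> sqrt (B u u) * sqrt (B v v)"
proof -
  have nn: "0 \<le> B u u + 2 * c * B u v + c\<^sup>2 * B v v" for c
    using psd_on_expand[OF assms, of c, symmetric] psd_on_nonneg[OF assms(1)] assms
    by (simp add: subspace_add subspace_scale)
  have "(B u v)\<^sup>2 \<le> B u u * B v v"
  proof (cases "B v v = 0")
    case True
    have "B u v = 0"
    proof (rule ccontr)
      assume "B u v \<noteq> 0"
      \<comment> \<open>For a null vector \<open>v\<close> the quadratic in \<open>c\<close> is
        affine; this \<open>c\<close> gives it the value -1.\<close>
      define c where "c = - (B u u + 1) / (2 * B u v)"
      have "2 * c * B u v = - (B u u + 1)"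
        using \<open>B u v \<noteq> 0\<close> by (simp add: c_def)
      then show False
        using nn[of c] unfolding True by linarith
    qed
    then show ?thesis using True by simp
  next
    case False
    then have p: "B v v > 0" using psd_on_nonneg[OF assms(1,4)] by simp
    \<comment> \<open>The quadratic is taken at its minimiser
      \<open>c = - B u v / B v v\<close>.\<close>
    have "0 \<le> B v v * (B u u + 2 * (- B u v / B v v) * B u v + (- B u v / B v v)\<^sup>2 * B v v)"
      by (rule mult_nonneg_nonneg[OF less_imp_le[OF p] nn])
    also have "\<dots> = B u u * B v v - (B u v)\<^sup>2"
      using p by (simp add: field_simps power2_eq_square)
    finally show ?thesis by simp
  qed
  then have "sqrt ((B u v)\<^sup>2) \<le> sqrt (B u u * B v v)" by (rule real_sqrt_le_mono)
  then show ?thesis by (simp add: real_sqrt_mult)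
qed

lemma psd_on_null:
  assumes "psd_on S B" "subspace S" "u \<in> S" "v \<in> S" "B v v = 0"
  shows "B u v = 0" "B v u = 0"
  using psd_on_cauchy_schwarz[OF assms(1-4)] psd_on_sym[OF assms(1,3,4)] assms(5) by auto

section \<open>Orthonormal bases modulo null vectors\<close>

text \<open>An orthonormal basis of the quotient of \<open>S\<close> by the null vectors of
  \<open>B\<close>: the remainder of an expansion has energy 0 but need not be the zero
  function.\<close>

definition onb_on :: "'v::real_vector set \<Rightarrow> ('v \<Rightarrow> 'v \<Rightarrow> real) \<Rightarrow> nat \<Rightarrow> (nat \<Rightarrow> 'v) \<Rightarrow> bool" where
  "onb_on S B n e \<longleftrightarrow> (\<forall>i<n. e i \<in> S) \<and> (\<forall>i<n. \<forall>j<n. B (e i) (e j) = (if i = j then 1 else 0)) \<and>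
     (\<forall>v\<in>S. let r = v - (\<Sum>i<n. B v (e i) *\<^sub>R e i) in B r r = 0)"

lemma onb_on_mem: "onb_on S B n e \<Longrightarrow> i < n \<Longrightarrow> e i \<in> S"
  and onb_on_orth: "onb_on S B n e \<Longrightarrow> i < n \<Longrightarrow> j < n \<Longrightarrow> B (e i) (e j) = (if i = j then 1 else 0)"
  by (auto simp: onb_on_def)

text \<open>The functionals \<open>d i\<close> certify that the quotient by null vectors has
  dimension at most \<open>n\<close>. Gram-Schmidt by induction over them: a basis of the kernel of
  the last functional is extended by a vector \<open>v1\<close> that is orthogonal to it and
  satisfies \<open>d n v1 = 1\<close>.\<close>

lemma ex_onb_on:
  fixes B :: "'v::real_vector \<Rightarrow> 'v \<Rightarrow> real" and n :: nat
  assumes "subspace S" "psd_on S B" "\<And>i. i < n \<Longrightarrow> lin_on S (d i)"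
    and "\<And>v. v \<in> S \<Longrightarrow> (\<forall>i<n. d i v = 0) \<Longrightarrow> B v v = 0"
  shows "\<exists>m e. onb_on S B m e"
  using assms
proof (induction n arbitrary: S)
  case 0
  then have "onb_on S B 0 undefined" by (auto simp: onb_on_def)
  then show ?case by blast
next
  case (Suc n)
  let ?S' = "{v \<in> S. d n v = 0}"
  have dn: "lin_on S (d n)" using Suc.prems by auto
  have S': "subspace ?S'"
    using Suc.prems(1) dn lin_on_0[OF dn Suc.prems(1)]
    by (auto simp: subspace_def lin_on_def)
  have psd': "psd_on ?S' B" using Suc.prems(2) by (auto simp: psd_on_def intro: lin_on_subset)
  have "\<exists>m e. onb_on ?S' B m e"
  proof (rule Suc.IH[OF S' psd'])
    show "lin_on ?S' (d i)" if "i < n" for i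
      by (rule lin_on_subset[OF Suc.prems(3)]) (use that in auto)
    show "B v v = 0" if "v \<in> ?S'" "\<forall>i<n. d i v = 0" for v
      using that Suc.prems(4)[of v] less_Suc_eq by auto
  qed
  then obtain m e where onb: "onb_on ?S' B m e" by blast
  have eS': "e i \<in> ?S'" if "i < m" for i using onb_on_mem[OF onb that] by simp
  have eS: "e i \<in> S" if "i < m" for i using eS'[OF that] by simp
  show ?case
  proof (cases "?S' = S")
    case True
    then show ?thesis using onb by metis
  next
    case False
    then obtain v0 where v0: "v0 \<in> S" "d n v0 \<noteq> 0" by auto
    define p where "p v = (\<Sum>i<m. B v (e i) *\<^sub>R e i)" for v
    have pS': "p v \<in> ?S'" for v
      unfolding p_def using S' eS' by (intro subspace_sum subspace_scale) auto
    have pS: "p v \<in> S" for v using pS'[of v] by simp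
    have dpn: "d n (p v) = 0" for v using pS'[of v] by simp
    define v1 where "v1 = (1 / d n v0) *\<^sub>R (v0 - p v0)"
    have v1: "v1 \<in> S" "d n v1 = 1"
      using v0 Suc.prems(1) dn pS dpn
      by (auto simp: v1_def subspace_scale lin_on_scaleR subspace_diff lin_on_diff)
    have Bp: "B (p v) (e j) = B v (e j)" if "v \<in> S" "j < m" for v j
    proof -
      have "B (p v) (e j) = (\<Sum>i<m. B v (e i) * B (e i) (e j))"
        unfolding p_def
        by (rule lin_on_sum_scaleR[OF psd_on_lin_left[OF Suc.prems(2,1) eS[OF that(2)]] Suc.prems(1)])
           (use eS in auto)
      also have "\<dots> = (\<Sum>i<m. if i = j then B v (e i) else 0)"
        using onb_on_orth[OF onb] that by (intro sum.cong) auto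
      finally show ?thesis using that by simp
    qed
    have v1e: "B v1 (e j) = 0" if "j < m" for j
    proof -
      have l: "lin_on S (\<lambda>w. B w (e j))" using psd_on_lin_left[OF Suc.prems(2,1) eS[OF that]] .
      show ?thesis
        unfolding v1_def
        using lin_on_scaleR[OF l, of "v0 - p v0" "1 / d n v0"] lin_on_diff[OF l Suc.prems(1) v0(1) pS, of v0]
          Bp[OF v0(1) that] subspace_diff[OF Suc.prems(1) v0(1) pS, of v0] by simp
    qed
    have null: "B (s - p s) (s - p s) = 0" if "s \<in> ?S'" for s
      using onb that unfolding onb_on_def p_def Let_def by blast
    \<comment> \<open>\<open>s\<close> and its projection \<open>p s\<close> differ by a null
      vector, to which everything in \<open>S\<close> is orthogonal.\<close>
    have v1S': "B v1 s = 0" if s: "s \<in> ?S'" for s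
    proof -
      have "s - p s \<in> S" using s pS Suc.prems(1) by (simp add: subspace_diff)
      then have "B v1 (s - p s) = 0" using psd_on_null(1)[OF Suc.prems(2,1) v1(1)] null[OF s] by simp
      then have "B v1 s = B v1 (p s)"
        using lin_on_diff[OF psd_on_lin[OF Suc.prems(2) v1(1)] Suc.prems(1), of s "p s"] s pS by simp
      also have "\<dots> = (\<Sum>i<m. B s (e i) * B v1 (e i))"
        unfolding p_def
        by (rule lin_on_sum_scaleR[OF psd_on_lin[OF Suc.prems(2) v1(1)] Suc.prems(1)]) (use eS in auto)
      finally show ?thesis using v1e by simp
    qed
    show ?thesis
    proof (cases "B v1 v1 = 0")
      \<comment> \<open>A null \<open>v1\<close> adds no direction to the quotient, so
        \<open>e\<close> already serves for \<open>S\<close>.\<close>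
      case True
      have "B (v - p v) (v - p v) = 0" if v: "v \<in> S" for v
      proof -
        define s where "s = v - d n v *\<^sub>R v1"
        have sv: "d n v *\<^sub>R v1 \<in> S" using v1 Suc.prems(1) by (simp add: subspace_scale)
        have s: "s \<in> ?S'"
          unfolding s_def using sv v Suc.prems(1) v1 dn
          by (simp add: subspace_diff lin_on_diff lin_on_scaleR)
        have Bse: "B s (e i) = B v (e i)" if "i < m" for i
          unfolding s_def
          using lin_on_diff[OF psd_on_lin_left[OF Suc.prems(2,1) eS[OF that]] Suc.prems(1) v sv]
            lin_on_scaleR[OF psd_on_lin_left[OF Suc.prems(2,1) eS[OF that]] v1(1)] v1e[OF that] by simp
        have ps: "p s = p v" unfolding p_def using Bse by (intro sum.cong) auto
        have dec: "v - p v = (s - p s) + d n v *\<^sub>R v1" unfolding ps by (simp add: s_def)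
        have sps: "s - p s \<in> S" using s pS Suc.prems(1) by (simp add: subspace_diff)
        show ?thesis
          unfolding dec psd_on_expand[OF Suc.prems(2,1) sps v1(1)]
          using null[OF s] True psd_on_null(1)[OF Suc.prems(2,1) sps v1(1) True] by simp
      qed
      then have "onb_on S B m e"
        using onb eS unfolding onb_on_def p_def Let_def by auto
      then show ?thesis by blast
    next
      case False
      then have pos: "B v1 v1 > 0" using psd_on_nonneg[OF Suc.prems(2) v1(1)] by simp
      define c where "c = 1 / sqrt (B v1 v1)"
      define f where "f = e(m := c *\<^sub>R v1)"
      have cv: "c *\<^sub>R v1 \<in> S" using v1 Suc.prems(1) by (simp add: subspace_scale)
      have B1: "B (c *\<^sub>R v1) s = c * B v1 s" if "s \<in> S" for s
        using lin_on_scaleR[OF psd_on_lin_left[OF Suc.prems(2,1) that] v1(1)] .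
      have B2: "B s (c *\<^sub>R v1) = c * B s v1" if "s \<in> S" for s
        using lin_on_scaleR[OF psd_on_lin[OF Suc.prems(2) that] v1(1)] .
      have cc: "c * (c * B v1 v1) = 1"
        unfolding c_def using pos by (simp add: field_simps)
      have fS: "f i \<in> S" if "i < Suc m" for i
        using that eS cv less_Suc_eq unfolding f_def by auto
      have orth: "B (f i) (f j) = (if i = j then 1 else 0)" if "i < Suc m" "j < Suc m" for i j
        using that onb_on_orth[OF onb] B1 B2 cc v1e eS psd_on_sym[OF Suc.prems(2) v1(1) eS] v1(1) cv
        unfolding f_def by (auto simp: less_Suc_eq)
      have "B (v - (\<Sum>i<Suc m. B v (f i) *\<^sub>R f i)) (v - (\<Sum>i<Suc m. B v (f i) *\<^sub>R f i)) = 0"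
        if v: "v \<in> S" for v
      proof -
        define s where "s = v - d n v *\<^sub>R v1"
        have sv: "d n v *\<^sub>R v1 \<in> S" using v1 Suc.prems(1) by (simp add: subspace_scale)
        have s: "s \<in> ?S'"
          unfolding s_def using sv v Suc.prems(1) v1 dn
          by (simp add: subspace_diff lin_on_diff lin_on_scaleR)
        have Bse: "B s (e i) = B v (e i)" if "i < m" for i
          unfolding s_def
          using lin_on_diff[OF psd_on_lin_left[OF Suc.prems(2,1) eS[OF that]] Suc.prems(1) v sv]
            lin_on_scaleR[OF psd_on_lin_left[OF Suc.prems(2,1) eS[OF that]] v1(1)] v1e[OF that] by simp
        have ps: "p s = p v" unfolding p_def using Bse by (intro sum.cong) auto
        have "v = s + d n v *\<^sub>R v1" by (simp add: s_def)
        have "B v v1 = B s v1 + d n v * B v1 v1"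
          using lin_on_diff[OF psd_on_lin_left[OF Suc.prems(2,1) v1(1)] Suc.prems(1) v sv]
            lin_on_scaleR[OF psd_on_lin_left[OF Suc.prems(2,1) v1(1)] v1(1)] unfolding s_def by simp
        also have "B s v1 = 0" using v1S'[OF s] psd_on_sym[OF Suc.prems(2) v1(1)] s by auto
        finally have "B v (c *\<^sub>R v1) *\<^sub>R (c *\<^sub>R v1) = (d n v * (c * (c * B v1 v1))) *\<^sub>R v1"
          using B2[OF v] by (simp add: algebra_simps)
        then have "(\<Sum>i<Suc m. B v (f i) *\<^sub>R f i) = p v + d n v *\<^sub>R v1"
          unfolding cc by (simp add: f_def p_def)
        then have "v - (\<Sum>i<Suc m. B v (f i) *\<^sub>R f i) = s - p s"
          unfolding ps by (simp add: s_def algebra_simps)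
        then show ?thesis using null[OF s] by simp
      qed
      then have "onb_on S B (Suc m) f"
        using fS orth unfolding onb_on_def Let_def by blast
      then show ?thesis by blast
    qed
  qed
qed

text \<open>Ignoring null vectors, \<open>l\<close> takes the same value at \<open>v\<close> and at
  the projection of \<open>v\<close> to the span of the basis.\<close>

lemma onb_on_expand:
  assumes "onb_on S B n e" "subspace S" "lin_on S l" "v \<in> S"
    and "\<And>v. v \<in> S \<Longrightarrow> B v v = 0 \<Longrightarrow> l v = 0"
  shows "l v = (\<Sum>i<n. B v (e i) * l (e i))"
proof -
  let ?p = "\<Sum>i<n. B v (e i) *\<^sub>R e i"
  have p: "?p \<in> S" using onb_on_mem[OF assms(1)] assms(2) by (intro subspace_sum subspace_scale) auto
  have "l (v - ?p) = 0"
    using assms(1,4) subspace_diff[OF assms(2,4) p] by (intro assms(5)) (auto simp: onb_on_def Let_def)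
  then have "l v = l ?p" using lin_on_diff[OF assms(3,2,4) p] by simp
  also have "\<dots> = (\<Sum>i<n. B v (e i) * l (e i))"
    using onb_on_mem[OF assms(1)] by (intro lin_on_sum_scaleR[OF assms(3,2)]) auto
  finally show ?thesis .
qed

section \<open>Boundedness of multilinear forms in finite dimension\<close>

lemma onb_on_coeff_le:
  assumes "onb_on S B n e" "subspace S" "psd_on S B" "v \<in> S" "i < n"
  shows "\<bar>B v (e i)\<bar> \<le> sqrt (B v v)"
  using psd_on_cauchy_schwarz[OF assms(3,2,4) onb_on_mem[OF assms(1,5)]] onb_on_orth[OF assms(1,5,5)]
  by simp

text \<open>The bounds \<open>c i\<close> are left free, rather than fixed as
  \<open>\<bar>l (e i)\<bar>\<close>, so that bounds depending on the other arguments of a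
  multilinear form can be inserted when the estimate is iterated.\<close>

lemma onb_on_bounded:
  assumes onb: "onb_on S B n e" "subspace S" "psd_on S B" and "lin_on S l"
    and "\<And>v. v \<in> S \<Longrightarrow> B v v = 0 \<Longrightarrow> l v = 0" and "\<And>i. i < n \<Longrightarrow> \<bar>l (e i)\<bar> \<le> c i"
    and v: "v \<in> S"
  shows "\<bar>l v\<bar> \<le> (\<Sum>i<n. c i) * sqrt (B v v)"
proof -
  have "\<bar>l v\<bar> = \<bar>\<Sum>i<n. B v (e i) * l (e i)\<bar>"
    using onb_on_expand[OF onb(1,2) assms(4) v assms(5)] by simp
  also have "\<dots> \<le> (\<Sum>i<n. \<bar>B v (e i) * l (e i)\<bar>)" by (rule sum_abs)
  also have "\<dots> \<le> (\<Sum>i<n. sqrt (B v v) * c i)"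
    using onb_on_coeff_le[OF onb v] assms(6)
    by (intro sum_mono) (auto simp: abs_mult intro!: mult_mono psd_on_nonneg[OF onb(3) v])
  also have "\<dots> = (\<Sum>i<n. c i) * sqrt (B v v)" by (simp add: sum_distrib_right mult.commute)
  finally show ?thesis .
qed

lemma onb_on_bounded2:
  assumes onb: "onb_on S B n e" "subspace S" "psd_on S B"
    and 1: "\<And>v. v \<in> S \<Longrightarrow> lin_on S (\<lambda>u. D u v)" "\<And>u v. u \<in> S \<Longrightarrow> v \<in> S \<Longrightarrow> B u u = 0 \<Longrightarrow> D u v = 0"
    and 2: "\<And>u. u \<in> S \<Longrightarrow> lin_on S (D u)" "\<And>u v. u \<in> S \<Longrightarrow> v \<in> S \<Longrightarrow> B v v = 0 \<Longrightarrow> D u v = 0"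
  shows "\<exists>C\<ge>0. \<forall>u\<in>S. \<forall>v\<in>S. \<bar>D u v\<bar> \<le> C * sqrt (B u u) * sqrt (B v v)"
proof (intro exI conjI ballI)
  let ?C = "\<Sum>i<n. \<Sum>j<n. \<bar>D (e i) (e j)\<bar>"
  show "0 \<le> ?C" by (intro sum_nonneg) auto
  fix u v assume uv: "u \<in> S" "v \<in> S"
  have "\<bar>D (e i) v\<bar> \<le> (\<Sum>j<n. \<bar>D (e i) (e j)\<bar>) * sqrt (B v v)" if "i < n" for i
    using onb_on_mem[OF onb(1) that] uv by (intro onb_on_bounded[OF onb] 2) auto
  then have "\<bar>D u v\<bar> \<le> (\<Sum>i<n. (\<Sum>j<n. \<bar>D (e i) (e j)\<bar>) * sqrt (B v v)) * sqrt (B u u)"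
    using uv onb_on_mem[OF onb(1)] by (intro onb_on_bounded[OF onb, where l="\<lambda>u. D u v"] 1) auto
  then show "\<bar>D u v\<bar> \<le> ?C * sqrt (B u u) * sqrt (B v v)"
    by (simp add: sum_distrib_left sum_distrib_right mult_ac)
qed

lemma onb_on_bounded3:
  assumes onb: "onb_on S B n e" "subspace S" "psd_on S B"
    and 1: "\<And>v w. v \<in> S \<Longrightarrow> w \<in> S \<Longrightarrow> lin_on S (\<lambda>u. D u v w)"
      "\<And>u v w. u \<in> S \<Longrightarrow> v \<in> S \<Longrightarrow> w \<in> S \<Longrightarrow> B u u = 0 \<Longrightarrow> D u v w = 0"
    and 2: "\<And>u w. u \<in> S \<Longrightarrow> w \<in> S \<Longrightarrow> lin_on S (\<lambda>v. D u v w)"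
      "\<And>u v w. u \<in> S \<Longrightarrow> v \<in> S \<Longrightarrow> w \<in> S \<Longrightarrow> B v v = 0 \<Longrightarrow> D u v w = 0"
    and 3: "\<And>u v. u \<in> S \<Longrightarrow> v \<in> S \<Longrightarrow> lin_on S (D u v)"
      "\<And>u v w. u \<in> S \<Longrightarrow> v \<in> S \<Longrightarrow> w \<in> S \<Longrightarrow> B w w = 0 \<Longrightarrow> D u v w = 0"
  shows "\<exists>C\<ge>0. \<forall>u\<in>S. \<forall>v\<in>S. \<forall>w\<in>S. \<bar>D u v w\<bar> \<le> C * sqrt (B u u) * sqrt (B v v) * sqrt (B w w)"
proof -
  have "\<exists>C\<ge>0. \<forall>v\<in>S. \<forall>w\<in>S. \<bar>D (e i) v w\<bar> \<le> C * sqrt (B v v) * sqrt (B w w)" if "i < n" for i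
    using onb_on_mem[OF onb(1) that] by (intro onb_on_bounded2[OF onb]) (auto intro: 2 3)
  then have "\<forall>i. \<exists>C\<ge>0. i < n \<longrightarrow> (\<forall>v\<in>S. \<forall>w\<in>S. \<bar>D (e i) v w\<bar> \<le> C * sqrt (B v v) * sqrt (B w w))"
    using zero_le_one by blast
  then obtain C where C: "\<And>i. C i \<ge> 0"
    "\<And>i v w. i < n \<Longrightarrow> v \<in> S \<Longrightarrow> w \<in> S \<Longrightarrow> \<bar>D (e i) v w\<bar> \<le> C i * sqrt (B v v) * sqrt (B w w)"
    by metis
  show ?thesis
  proof (intro exI conjI ballI)
    show "0 \<le> (\<Sum>i<n. C i)" using C by (intro sum_nonneg) auto
    fix u v w assume "u \<in> S" "v \<in> S" "w \<in> S"
    then have "\<bar>D u v w\<bar> \<le> (\<Sum>i<n. C i * sqrt (B v v) * sqrt (B w w)) * sqrt (B u u)"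
      using C by (intro onb_on_bounded[OF onb, where l="\<lambda>u. D u v w"] 1) auto
    then show "\<bar>D u v w\<bar> \<le> (\<Sum>i<n. C i) * sqrt (B u u) * sqrt (B v v) * sqrt (B w w)"
      by (simp add: sum_distrib_left sum_distrib_right mult_ac)
  qed
qed

lemma psd_on_triangle:
  assumes "psd_on S B" "subspace S" "u \<in> S" "v \<in> S"
  shows "sqrt (B (u + v) (u + v)) \<le> sqrt (B u u) + sqrt (B v v)"
proof -
  have "B (u + v) (u + v) = B u u + 2 * B u v + B v v"
    using psd_on_expand[OF assms, of 1] by simp
  also have "\<dots> \<le> B u u + 2 * (sqrt (B u u) * sqrt (B v v)) + B v v"
    using psd_on_cauchy_schwarz[OF assms] by simp
  also have "\<dots> = (sqrt (B u u) + sqrt (B v v))\<^sup>2"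
    using psd_on_nonneg[OF assms(1,3)] psd_on_nonneg[OF assms(1,4)] by (simp add: power2_sum)
  finally have "sqrt (B (u + v) (u + v)) \<le> sqrt ((sqrt (B u u) + sqrt (B v v))\<^sup>2)"
    by (rule real_sqrt_le_mono)
  then show ?thesis
    using psd_on_nonneg[OF assms(1,3)] psd_on_nonneg[OF assms(1,4)] by simp
qed

lemma psd_on_scaleR:
  assumes "psd_on S B" "subspace S" "u \<in> S"
  shows "sqrt (B (c *\<^sub>R u) (c *\<^sub>R u)) = \<bar>c\<bar> * sqrt (B u u)"
proof -
  have cu: "c *\<^sub>R u \<in> S" using assms by (simp add: subspace_scale)
  have "B (c *\<^sub>R u) (c *\<^sub>R u) = c * B (c *\<^sub>R u) u"
    by (rule lin_on_scaleR[OF psd_on_lin[OF assms(1) cu] assms(3)])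
  also have "B (c *\<^sub>R u) u = c * B u u"
    by (rule lin_on_scaleR[OF psd_on_lin_left[OF assms] assms(3)])
  finally show ?thesis by (simp add: real_sqrt_mult mult.assoc[symmetric])
qed

lemma psd_on_add:
  assumes "psd_on S B" "psd_on S D"
  shows "psd_on S (\<lambda>u v. B u v + D u v)"
  using assms unfolding psd_on_def by (auto intro!: lin_on_compose_add add_nonneg_nonneg)

lemma psd_on_mult:
  assumes "psd_on S B" "0 \<le> c"
  shows "psd_on S (\<lambda>u v. c * B u v)"
  using assms unfolding psd_on_def by (auto intro!: lin_on_compose_mult mult_nonneg_nonneg)

lemma psd_on_subset: "psd_on S B \<Longrightarrow> S' \<subseteq> S \<Longrightarrow> psd_on S' B"
  unfolding psd_on_def by (meson lin_on_subset subsetD)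

text \<open>Allows index sets such as triples of a component, a cell and a multi-index.\<close>

lemma ex_onb_on_finite:
  fixes B :: "'v::real_vector \<Rightarrow> 'v \<Rightarrow> real" and d :: "'i \<Rightarrow> 'v \<Rightarrow> real"
  assumes "subspace S" "psd_on S B" "finite I" "\<And>i. i \<in> I \<Longrightarrow> lin_on S (d i)"
    and "\<And>v. v \<in> S \<Longrightarrow> (\<forall>i\<in>I. d i v = 0) \<Longrightarrow> B v v = 0"
  shows "\<exists>m e. onb_on S B m e"
proof -
  obtain h :: "nat \<Rightarrow> 'i" and n where h: "bij_betw h {..<n} I"
    using ex_bij_betw_nat_finite[OF assms(3)] by (auto simp: atLeast0LessThan)
  show ?thesis
  proof (rule ex_onb_on[OF assms(1,2), of n "\<lambda>i. d (h i)"])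
    show "lin_on S (d (h i))" if "i < n" for i
      using h that by (intro assms(4)) (auto simp: bij_betw_def)
    show "B v v = 0" if "v \<in> S" "\<forall>i<n. d (h i) v = 0" for v
      using h that by (intro assms(5)) (auto simp: bij_betw_def)
  qed
qed

lemma onb_on_riesz:
  assumes "onb_on S B n e" "subspace S" "psd_on S B" "lin_on S l"
    and "\<And>v. v \<in> S \<Longrightarrow> B v v = 0 \<Longrightarrow> l v = 0"
  shows "\<exists>r\<in>S. \<forall>v\<in>S. B r v = l v"
proof (intro bexI ballI)
  let ?r = "\<Sum>i<n. l (e i) *\<^sub>R e i"
  note e = onb_on_mem[OF assms(1)]
  show "?r \<in> S" using e by (intro subspace_sum[OF assms(2)] subspace_scale[OF assms(2)]) auto
  fix v assume v: "v \<in> S"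
  have "B ?r v = (\<Sum>i<n. l (e i) * B (e i) v)"
    using e by (intro lin_on_sum_scaleR[OF psd_on_lin_left[OF assms(3,2) v] assms(2)]) auto
  also have "\<dots> = (\<Sum>i<n. B v (e i) * l (e i))"
    using e psd_on_sym[OF assms(3) v] by (intro sum.cong) (auto simp: mult.commute)
  also have "\<dots> = l v" by (rule onb_on_expand[OF assms(1,2,4) v assms(5), symmetric])
  finally show "B ?r v = l v" .
qed

section \<open>Ordinary differential equations\<close>

text \<open>The function \<open>exp (- C * s) * E s - D * s\<close> is nonincreasing. The derivative
  is asked for at positive times, where the equations of the system hold; continuity takes care of
  time 0.\<close>

lemma gronwall:
  fixes E E' :: "real \<Rightarrow> real"
  assumes cont: "continuous_on {0..T} E"
    and deriv: "\<And>t. 0 < t \<Longrightarrow> t \<le> T \<Longrightarrow> (E has_real_derivative E' t) (at t within {0..T})"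
    and le: "\<And>t. 0 < t \<Longrightarrow> t \<le> T \<Longrightarrow> E' t \<le> C * E t + D"
    and C: "0 \<le> C" and D: "0 \<le> D" and t: "t \<in> {0..T}"
  shows "E t \<le> (E 0 + D * t) * exp (C * t)"
proof (cases "t = 0")
  case False
  then have t0: "0 < t" using t by simp
  define G where "G s = exp (- C * s) * E s - D * s" for s
  have "G 0 \<ge> G t"
  proof (rule DERIV_nonpos_imp_decreasing_open[OF less_imp_le[OF t0]])
    show "continuous_on {0..t} G"
      unfolding G_def using t by (intro continuous_intros continuous_on_subset[OF cont]) auto
    fix s assume s: "0 < s" "s < t"
    have "at s within {0..T} = at s"
      using s t by (intro at_within_interior) auto
    then have dE: "(E has_real_derivative E' s) (at s)" using deriv[of s] s t by simp
    have "(G has_real_derivative (exp (- C * s) * (E' s - C * E s) - D)) (at s)"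
      unfolding G_def by (rule derivative_eq_intros dE refl | simp add: algebra_simps)+
    moreover have "exp (- C * s) * (E' s - C * E s) - D \<le> 0"
    proof -
      have "exp (- C * s) * (E' s - C * E s) \<le> exp (- C * s) * D"
        using le[of s] s t by (intro mult_left_mono) auto
      also have "\<dots> \<le> 1 * D" using C D s by (intro mult_right_mono) auto
      finally show ?thesis by simp
    qed
    ultimately show "\<exists>y. (G has_real_derivative y) (at s) \<and> y \<le> 0" by blast
  qed
  then have "exp (- C * t) * E t \<le> E 0 + D * t" by (simp add: G_def)
  then have "exp (C * t) * (exp (- C * t) * E t) \<le> exp (C * t) * (E 0 + D * t)"
    by (intro mult_left_mono) auto
  moreover have "exp (C * t) * (exp (- C * t) * E t) = E t"
    using exp_minus_inverse[of "C * t"] by (simp add: mult.assoc[symmetric])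
  ultimately show ?thesis by (metis mult.commute)
qed auto

text \<open>Makes the integrand of the Picard operator continuous, hence integrable, along a
  continuous curve.\<close>

lemma continuous_on_lipschitz_superposition:
  fixes F :: "real \<Rightarrow> 'a::real_normed_vector \<Rightarrow> 'b::real_normed_vector"
  assumes "\<And>x. continuous_on S (\<lambda>t. F t x)" "continuous_on S y"
    and "\<And>t x z. t \<in> S \<Longrightarrow> norm (F t x - F t z) \<le> L * norm (x - z)"
  shows "continuous_on S (\<lambda>t. F t (y t))"
  unfolding continuous_on_def
proof
  fix t assume t: "t \<in> S"
  have "((\<lambda>s. F s (y s) - F s (y t)) \<longlongrightarrow> 0) (at t within S)"
  proof (rule Lim_null_comparison)
    show "\<forall>\<^sub>F s in at t within S. norm (F s (y s) - F s (y t)) \<le> L * norm (y s - y t)"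
      using assms(3) by (auto simp: eventually_at_filter)
    have "((\<lambda>s. L * norm (y s - y t)) \<longlongrightarrow> L * norm (y t - y t)) (at t within S)"
      using assms(2) t by (intro tendsto_intros) (auto simp: continuous_on_def)
    then show "((\<lambda>s. L * norm (y s - y t)) \<longlongrightarrow> 0) (at t within S)" by simp
  qed
  moreover have "((\<lambda>s. F s (y t)) \<longlongrightarrow> F t (y t)) (at t within S)"
    using assms(1) t by (auto simp: continuous_on_def)
  ultimately have "((\<lambda>s. (F s (y s) - F s (y t)) + F s (y t)) \<longlongrightarrow> 0 + F t (y t)) (at t within S)"
    by (rule tendsto_add)
  then show "((\<lambda>s. F s (y s)) \<longlongrightarrow> F t (y t)) (at t within S)" by simp
qed

text \<open>The weight \<open>exp (- K t)\<close> makes the Picard operator a contraction on the whole interval.\<close>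

lemma picard_lindeloef_global:
  fixes F :: "real \<Rightarrow> 'a::banach \<Rightarrow> 'a"
  assumes T: "0 \<le> T" and L: "0 \<le> L"
    and cont: "\<And>x. continuous_on {0..T} (\<lambda>t. F t x)"
    and lip: "\<And>t x z. t \<in> {0..T} \<Longrightarrow> norm (F t x - F t z) \<le> L * norm (x - z)"
  shows "\<exists>y. y 0 = x0 \<and>
    (\<forall>t\<in>{0..T}. (y has_vector_derivative F t (y t)) (at t within {0..T}))"
proof -
  \<comment> \<open>Integrating \<open>L * exp (K * s)\<close> costs a factor \<open>L / K\<close>,
    which is below 1/2; the summand 1 keeps \<open>K\<close> positive when
    \<open>L = 0\<close>.\<close>
  define K where "K = 2 * L + 1"
  have K: "0 < K" using L by (simp add: K_def)
  \<comment> \<open>Clamping to \<open>{0..T}\<close> extends a continuous function on the interval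
    to a bounded continuous one on the real line, so that the Picard operator acts on a complete
    type.\<close>
  define c where "c t = max 0 (min T t)" for t
  have c: "c t \<in> {0..T}" for t using T by (auto simp: c_def)
  have c_id: "c t = t" if "t \<in> {0..T}" for t using that by (auto simp: c_def)
  have contc: "continuous_on UNIV c" unfolding c_def by (intro continuous_intros)
  \<comment> \<open>The unknown \<open>z\<close> is the solution multiplied by
    \<open>exp (- K * t)\<close>, so that its sup norm is the weighted norm of the solution.\<close>
  define g where "g z s = F s (exp (K * s) *\<^sub>R apply_bcontfun z s)" for z :: "real \<Rightarrow>\<^sub>C 'a" and s
  have contg: "continuous_on {0..T} (g z)" for z
    unfolding g_def
    by (rule continuous_on_lipschitz_superposition[OF cont _ lip]) (auto intro!: continuous_intros)
  have intg: "g z integrable_on {0..t}" if "t \<in> {0..T}" for z t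
    using that by (intro integrable_continuous_real continuous_on_subset[OF contg]) auto
  define \<psi> where "\<psi> z t = exp (- K * t) *\<^sub>R (x0 + integral {0..t} (g z))" for z t
  have cont\<psi>: "continuous_on {0..T} (\<psi> z)" for z
    unfolding \<psi>_def
    using T by (intro continuous_intros indefinite_integral_continuous_1 intg) auto
  have bc: "(\<lambda>t. \<psi> z (c t)) \<in> bcontfun" for z
  proof -
    have "continuous_on UNIV (\<lambda>t. \<psi> z (c t))"
      using continuous_on_compose2[OF cont\<psi> contc, of z] c by (simp add: image_subset_iff)
    moreover have "bounded (range (\<lambda>t. \<psi> z (c t)))"
      by (rule bounded_subset[OF compact_imp_bounded[OF compact_continuous_image[OF cont\<psi> compact_Icc]]])
         (use c in auto)
    ultimately show ?thesis by (simp add: bcontfun_def)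
  qed
  define \<Phi> where "\<Phi> z = Bcontfun (\<lambda>t. \<psi> z (c t))" for z
  have \<Phi>: "apply_bcontfun (\<Phi> z) t = \<psi> z (c t)" for z t
    unfolding \<Phi>_def using bc by (simp add: Bcontfun_inverse)
  have contr: "dist (\<Phi> z) (\<Phi> z') \<le> (L / K) * dist z z'" for z z'
  proof (rule dist_bound)
    fix t
    let ?d = "dist z z'"
    let ?t = "c t"
    have t: "?t \<in> {0..T}" by (rule c)
    have e: "((\<lambda>s. L * ?d * exp (K * s)) has_integral
        (L * ?d * exp (K * ?t) / K - L * ?d * exp (K * 0) / K)) {0..?t}"
      using t K
      by (intro fundamental_theorem_of_calculus)
         (auto intro!: derivative_eq_intros simp: has_real_derivative_iff_has_vector_derivative[symmetric])
    have "norm (integral {0..?t} (\<lambda>s. g z s - g z' s)) \<le> integral {0..?t} (\<lambda>s. L * ?d * exp (K * s))"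
    proof (rule Henstock_Kurzweil_Integration.integral_norm_bound_integral)
      show "(\<lambda>s. g z s - g z' s) integrable_on {0..?t}" using intg[OF t] by (intro integrable_diff)
      show "(\<lambda>s. L * ?d * exp (K * s)) integrable_on {0..?t}" using e by blast
      fix s assume "s \<in> {0..?t}"
      then have s: "s \<in> {0..T}" using t by auto
      have "norm (g z s - g z' s) \<le> L * norm (exp (K * s) *\<^sub>R apply_bcontfun z s - exp (K * s) *\<^sub>R apply_bcontfun z' s)"
        unfolding g_def by (rule lip[OF s])
      also have "\<dots> = L * (exp (K * s) * dist (apply_bcontfun z s) (apply_bcontfun z' s))"
        by (simp add: scaleR_diff_right[symmetric] dist_norm)
      also have "\<dots> \<le> L * (exp (K * s) * ?d)"
        using L dist_bounded[of z s z'] by (intro mult_left_mono) auto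
      finally show "norm (g z s - g z' s) \<le> L * ?d * exp (K * s)" by (simp add: mult_ac)
    qed
    also have "\<dots> = L * ?d * exp (K * ?t) / K - L * ?d * exp (K * 0) / K"
      using e by (rule integral_unique)
    also have "\<dots> \<le> L * ?d * exp (K * ?t) / K" using L K by simp
    finally have *: "norm (integral {0..?t} (\<lambda>s. g z s - g z' s)) \<le> L * ?d * exp (K * ?t) / K" .
    have "dist (apply_bcontfun (\<Phi> z) t) (apply_bcontfun (\<Phi> z') t)
        = exp (- K * ?t) * norm (integral {0..?t} (\<lambda>s. g z s - g z' s))"
      unfolding \<Phi> \<psi>_def dist_norm scaleR_diff_right[symmetric]
      using intg[OF t] by (simp add: integral_diff)
    also have "\<dots> \<le> exp (- K * ?t) * (L * ?d * exp (K * ?t) / K)"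
      using * by (intro mult_left_mono) auto
    also have "\<dots> = (L / K) * ?d * (exp (- K * ?t) * exp (K * ?t))" by simp
    also have "exp (- K * ?t) * exp (K * ?t) = 1" by (simp add: exp_add[symmetric])
    finally show "dist (apply_bcontfun (\<Phi> z) t) (apply_bcontfun (\<Phi> z') t) \<le> (L / K) * ?d" by simp
  qed
  have "L / K < 1" "0 \<le> L / K" using L K by (auto simp: K_def)
  then have "\<exists>!z. \<Phi> z = z" using contr by (intro banach_fix_type) auto
  then obtain z where z: "\<Phi> z = z" by blast
  define y where "y t = exp (K * t) *\<^sub>R apply_bcontfun z t" for t
  have y_eq: "y t = x0 + integral {0..t} (g z)" if "t \<in> {0..T}" for t
  proof -
    have "apply_bcontfun z t = \<psi> z t" using \<Phi>[of z t] c_id[OF that] by (simp add: z)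
    then show ?thesis by (simp add: y_def \<psi>_def exp_add[symmetric])
  qed
  show ?thesis
  proof (intro exI[of _ y] conjI ballI)
    show "y 0 = x0" using y_eq[of 0] T by simp
    fix t assume t: "t \<in> {0..T}"
    have "((\<lambda>t. x0 + integral {0..t} (g z)) has_vector_derivative (0 + g z t)) (at t within {0..T})"
      by (intro has_vector_derivative_add integral_has_vector_derivative[OF contg t] has_vector_derivative_const)
    then have "((\<lambda>t. x0 + integral {0..t} (g z)) has_vector_derivative F t (y t)) (at t within {0..T})"
      by (simp add: g_def y_def)
    then show "(y has_vector_derivative F t (y t)) (at t within {0..T})"
      by (rule has_vector_derivative_transform[OF t, rotated]) (simp add: y_eq)
  qed
qed

section \<open>The cut-off Galerkin equation\<close>

text \<open>In the application \<open>s\<close> and \<open>t\<close> are the l1 norms of two states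
  and \<open>m\<close> is the number of coordinates. The difference splits into a change of
  \<open>a\<close> at a fixed factor, bounded by \<open>d\<close>, and a change of the factor,
  bounded by \<open>m * d\<close> because \<open>\<bar>b\<bar> / max R t \<le> 1\<close>; hence the
  constant \<open>1 + m\<close>.\<close>

lemma radial_cutoff_lipschitz:
  fixes a b s t R d m :: real
  assumes "0 < R" "0 \<le> m" "\<bar>a\<bar> \<le> s" "\<bar>b\<bar> \<le> t" "\<bar>a - b\<bar> \<le> d" "\<bar>s - t\<bar> \<le> m * d"
  shows "\<bar>R / max R s * a - R / max R t * b\<bar> \<le> (1 + m) * d" "\<bar>R / max R s * a\<bar> \<le> R"
proof -
  have p: "0 < max R s" "0 < max R t" using assms(1) by auto
  have eq: "R / max R s * a - R / max R t * b =
      R / max R s * (a - b) + R * (max R t - max R s) / (max R s * max R t) * b"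
    using p by (simp add: field_simps)
  have "\<bar>R / max R s * a - R / max R t * b\<bar> \<le> \<bar>R / max R s\<bar> * \<bar>a - b\<bar> + R / max R s * (\<bar>max R t - max R s\<bar>) * (\<bar>b\<bar> / max R t)"
    unfolding eq using p assms(1)
    by (intro order_trans[OF abs_triangle_ineq] add_mono) (simp_all add: abs_mult abs_divide)
  also have "\<dots> \<le> 1 * d + 1 * (m * d) * 1"
  proof (intro add_mono mult_mono)
    show "\<bar>max R t - max R s\<bar> \<le> m * d" using assms(6) by (auto simp: max_def abs_if split: if_splits)
    show "\<bar>b\<bar> / max R t \<le> 1" using p assms(4) by (simp add: divide_simps)
  qed (use p assms in \<open>auto simp: divide_simps intro!: mult_nonneg_nonneg\<close>)
  finally show "\<bar>R / max R s * a - R / max R t * b\<bar> \<le> (1 + m) * d" by (simp add: algebra_simps)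
  have "\<bar>R / max R s * a\<bar> = R * (\<bar>a\<bar> / max R s)" using p assms(1) by (simp add: abs_mult abs_divide)
  also have "\<dots> \<le> R * 1" using p assms(1,3) by (intro mult_left_mono) (auto simp: divide_simps)
  finally show "\<bar>R / max R s * a\<bar> \<le> R" by simp
qed

instance bcontfun :: (metric_space, banach) banach ..

text \<open>Tents of half-width 1 centred at the natural numbers: dual to the evaluations there,
  they play the role of unit vectors.\<close>

definition hat :: "nat \<Rightarrow> real \<Rightarrow>\<^sub>C real" where
  "hat i = Bcontfun (\<lambda>s. max 0 (1 - \<bar>s - real i\<bar>))"

lemma apply_hat: "apply_bcontfun (hat i) s = max 0 (1 - \<bar>s - real i\<bar>)"
proof -
  have "(\<lambda>s. max 0 (1 - \<bar>s - real i\<bar>)) \<in> bcontfun"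
    by (rule bcontfun_normI[of _ 1]) (auto intro!: continuous_intros)
  then show ?thesis by (simp add: hat_def Bcontfun_inverse)
qed

lemma hat_delta: "apply_bcontfun (hat i) (real j) = (if i = j then 1 else 0)"
  by (auto simp: apply_hat)

lemma norm_hat: "norm (hat i) \<le> 1"
  by (rule norm_bound) (auto simp: apply_hat)

lemma bounded_linear_apply_bcontfun: "bounded_linear (\<lambda>z :: real \<Rightarrow>\<^sub>C real. apply_bcontfun z s)"
  by (rule bounded_linear_intro[of _ 1]) (use norm_bounded in \<open>auto simp flip: real_norm_def\<close>)

text \<open>There is no type of \<open>N\<close>-tuples for a variable \<open>N\<close>, so the vector of unknowns is carried
  by an element of the Banach space of bounded continuous functions, through its values at
  \<open>0, \<dots>, N - 1\<close>. The quadratic term is cut off radially, which preserves the energy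
  identity; hence the a priori bound shows that the cut-off is never active.\<close>

lemma galerkin_ode:
  fixes N :: nat and h :: "nat \<Rightarrow> real \<Rightarrow> real" and q :: "nat \<Rightarrow> nat \<Rightarrow> nat \<Rightarrow> real"
    and A :: "nat \<Rightarrow> nat \<Rightarrow> real" and y0 :: "nat \<Rightarrow> real"
  assumes T: "0 \<le> T" and h: "\<And>i. i < N \<Longrightarrow> continuous_on {0..T} (h i)"
    and skew: "\<And>y :: nat \<Rightarrow> real. (\<Sum>i<N. (\<Sum>j<N. \<Sum>k<N. q i j k * (y j * y k)) * y i) = 0"
    and coercive: "\<And>y :: nat \<Rightarrow> real. (\<Sum>i<N. (\<Sum>j<N. A i j * y j) * y i) \<ge> 0"
  shows "\<exists>y. \<forall>i<N. y i 0 = y0 i \<and> (\<forall>t\<in>{0..T}. (y i has_real_derivative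
     h i t - (\<Sum>j<N. \<Sum>k<N. q i j k * (y j t * y k t)) - (\<Sum>j<N. A i j * y j t)) (at t within {0..T}))"
proof -
  define H where "H t = (\<Sum>i<N. (h i t)\<^sup>2)" for t
  have "continuous_on {0..T} H" unfolding H_def using h by (intro continuous_intros) auto
  then have "bounded (H ` {0..T})" by (intro compact_imp_bounded compact_continuous_image) auto
  then obtain H0 where H0: "\<And>t. t \<in> {0..T} \<Longrightarrow> H t \<le> H0" "H0 > 0"
    by (force simp: bounded_pos)
  \<comment> \<open>The value at time \<open>T\<close> of the Gronwall bound with rate 1 and source
    \<open>H0\<close>.\<close>
  define M where "M = ((\<Sum>i<N. (y0 i)\<^sup>2) + H0 * T) * exp T"
  have M0: "0 \<le> M" unfolding M_def using H0 T by (intro mult_nonneg_nonneg add_nonneg_nonneg sum_nonneg) auto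
  \<comment> \<open>A state of energy at most \<open>M\<close> has l1 norm at most
    \<open>N + M\<close>, by \<open>\<bar>a\<bar> \<le> 1 + a\<^sup>2\<close>; the cut-off at
    \<open>R\<close> leaves such states unchanged.\<close>
  define R where "R = real N + M + 1"
  have R: "0 < R" using M0 by (simp add: R_def)
  define ev where "ev i z = apply_bcontfun z (real i)" for i :: nat and z :: "real \<Rightarrow>\<^sub>C real"
  have ev: "bounded_linear (ev i)" for i
    unfolding ev_def by (rule bounded_linear_apply_bcontfun)
  have ev_le: "\<bar>ev i x - ev i z\<bar> \<le> norm (x - z)" for i x z
    using norm_bounded[of "x - z" "real i"] by (simp add: ev_def)
  define s where "s z = (\<Sum>i<N. \<bar>ev i z\<bar>)" for z
  have ev_s: "\<bar>ev i z\<bar> \<le> s z" if "i < N" for i z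
    unfolding s_def using that by (intro member_le_sum) auto
  have s_lip: "\<bar>s x - s z\<bar> \<le> real N * norm (x - z)" for x z
  proof -
    have "\<bar>s x - s z\<bar> \<le> (\<Sum>i<N. \<bar>\<bar>ev i x\<bar> - \<bar>ev i z\<bar>\<bar>)"
      unfolding s_def sum_subtractf[symmetric] by (rule sum_abs)
    also have "\<dots> \<le> (\<Sum>i<N. norm (x - z))"
      using ev_le by (intro sum_mono order_trans[OF abs_triangle_ineq3])
    finally show ?thesis by simp
  qed
  \<comment> \<open>The factor is common to all coordinates, so the quadratic term is merely
    multiplied by the square of \<theta> and stays orthogonal to the state.\<close>
  define \<theta> where "\<theta> z = R / max R (s z)" for z
  define p where "p i z = \<theta> z * ev i z" for i z
  have p_lip: "\<bar>p i x - p i z\<bar> \<le> (1 + real N) * norm (x - z)" and p_le: "\<bar>p i x\<bar> \<le> R"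
    if "i < N" for i x z
    unfolding p_def \<theta>_def using radial_cutoff_lipschitz[OF R _ ev_s[OF that] ev_s[OF that] ev_le s_lip]
    by auto
  \<comment> \<open>The linear term is globally Lipschitz already and keeps the uncut coordinates
    \<open>ev\<close>.\<close>
  define G where "G i t z = h i t - (\<Sum>j<N. \<Sum>k<N. q i j k * (p j z * p k z)) - (\<Sum>j<N. A i j * ev j z)" for i t z
  define F where "F t z = (\<Sum>i<N. G i t z *\<^sub>R hat i)" for t z
  define L where "L i = (\<Sum>j<N. \<Sum>k<N. \<bar>q i j k\<bar> * (2 * R * (1 + real N))) + (\<Sum>j<N. \<bar>A i j\<bar>)" for i
  have L0: "0 \<le> L i" for i
    unfolding L_def using R by (intro add_nonneg_nonneg sum_nonneg mult_nonneg_nonneg) auto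
  have G_lip: "\<bar>G i t x - G i t z\<bar> \<le> L i * norm (x - z)" for i t x z
  proof -
    have pp: "\<bar>p j x * p k x - p j z * p k z\<bar> \<le> 2 * R * (1 + real N) * norm (x - z)" if "j < N" "k < N" for j k
    proof -
      have eq: "p j x * p k x - p j z * p k z = p j x * (p k x - p k z) + (p j x - p j z) * p k z"
        by (simp add: algebra_simps)
      have "\<bar>p j x * p k x - p j z * p k z\<bar> \<le> \<bar>p j x\<bar> * \<bar>p k x - p k z\<bar> + \<bar>p j x - p j z\<bar> * \<bar>p k z\<bar>"
        unfolding eq abs_mult[symmetric] by (rule abs_triangle_ineq)
      also have "\<dots> \<le> R * ((1 + real N) * norm (x - z)) + ((1 + real N) * norm (x - z)) * R"
        using p_lip p_le that R by (intro add_mono mult_mono) auto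
      finally show ?thesis by (simp add: algebra_simps)
    qed
    have eq: "G i t x - G i t z = (\<Sum>j<N. \<Sum>k<N. q i j k * (p j z * p k z - p j x * p k x)) + (\<Sum>j<N. A i j * (ev j z - ev j x))"
      unfolding G_def right_diff_distrib sum_subtractf by simp
    have "\<bar>G i t x - G i t z\<bar> \<le> (\<Sum>j<N. \<Sum>k<N. \<bar>q i j k * (p j z * p k z - p j x * p k x)\<bar>) + (\<Sum>j<N. \<bar>A i j * (ev j z - ev j x)\<bar>)"
      unfolding eq
      by (intro order_trans[OF abs_triangle_ineq] add_mono order_trans[OF sum_abs] sum_mono) auto
    also have "\<dots> \<le> (\<Sum>j<N. \<Sum>k<N. \<bar>q i j k\<bar> * (2 * R * (1 + real N) * norm (x - z))) + (\<Sum>j<N. \<bar>A i j\<bar> * norm (x - z))"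
      unfolding abs_mult using pp ev_le
      by (intro add_mono sum_mono mult_left_mono) (auto simp: abs_minus_commute)
    also have "\<dots> = L i * norm (x - z)"
      unfolding L_def distrib_right sum_distrib_right by (simp add: mult.assoc)
    finally show ?thesis .
  qed
  have F_lip: "norm (F t x - F t z) \<le> (\<Sum>i<N. L i) * norm (x - z)" for t x z
  proof -
    have "norm (F t x - F t z) \<le> (\<Sum>i<N. norm ((G i t x - G i t z) *\<^sub>R hat i))"
      unfolding F_def sum_subtractf[symmetric] scaleR_diff_left[symmetric] by (rule norm_sum)
    also have "\<dots> \<le> (\<Sum>i<N. (L i * norm (x - z)) * 1)"
      unfolding norm_scaleR real_norm_def using G_lip norm_hat L0
      by (intro sum_mono mult_mono) auto
    finally show ?thesis by (simp add: sum_distrib_right)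
  qed
  have F_cont: "continuous_on {0..T} (\<lambda>t. F t z)" for z
    unfolding F_def G_def using h by (intro continuous_intros) auto
  have evF: "ev i (F t z) = G i t z" if "i < N" for i t z
  proof -
    have "ev i (F t z) = (\<Sum>j<N. G j t z * ev i (hat j))"
      unfolding F_def using ev[of i] by (simp add: linear_sum bounded_linear.linear linear_cmul o_def)
    also have "\<dots> = (\<Sum>j<N. if j = i then G j t z else 0)"
      by (intro sum.cong) (auto simp: ev_def hat_delta)
    finally show ?thesis using that by simp
  qed
  define x0 where "x0 = (\<Sum>i<N. y0 i *\<^sub>R hat i)"
  have evx0: "ev i x0 = y0 i" if "i < N" for i
  proof -
    have "ev i x0 = (\<Sum>j<N. y0 j * ev i (hat j))"
      unfolding x0_def using ev[of i] by (simp add: linear_sum bounded_linear.linear linear_cmul o_def)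
    also have "\<dots> = (\<Sum>j<N. if j = i then y0 j else 0)"
      by (intro sum.cong) (auto simp: ev_def hat_delta)
    finally show ?thesis using that by simp
  qed
  have "0 \<le> (\<Sum>i<N. L i)" by (intro sum_nonneg L0)
  then obtain z where z0: "z 0 = x0"
    and z: "\<And>t. t \<in> {0..T} \<Longrightarrow> (z has_vector_derivative F t (z t)) (at t within {0..T})"
    using picard_lindeloef_global[OF T _ F_cont F_lip, of x0] by blast
  define y where "y i t = ev i (z t)" for i t
  have y: "(y i has_real_derivative G i t (z t)) (at t within {0..T})" if "i < N" "t \<in> {0..T}" for i t
    using bounded_linear.has_vector_derivative[OF ev z[OF that(2)], of i] evF[OF that(1)]
    by (simp add: y_def[abs_def] has_real_derivative_iff_has_vector_derivative)
  define E where "E t = (\<Sum>i<N. (y i t)\<^sup>2)" for t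
  define E' where "E' t = (\<Sum>i<N. 2 * (y i t * G i t (z t)))" for t
  have dE: "(E has_real_derivative E' t) (at t within {0..T})" if "t \<in> {0..T}" for t
    unfolding E_def E'_def
    by (rule derivative_eq_intros y that refl | simp add: mult_ac)+
  have E'_le: "E' t \<le> 1 * E t + H0" if t: "t \<in> {0..T}" for t
  proof -
    have pe: "p j (z t) = \<theta> (z t) * y j t" for j by (simp add: p_def y_def)
    have "(\<Sum>i<N. (\<Sum>j<N. \<Sum>k<N. q i j k * (p j (z t) * p k (z t))) * y i t)
        = (\<theta> (z t))\<^sup>2 * (\<Sum>i<N. (\<Sum>j<N. \<Sum>k<N. q i j k * (y j t * y k t)) * y i t)"
      unfolding pe by (simp add: sum_distrib_left sum_distrib_right power2_eq_square mult_ac)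
    then have 0: "(\<Sum>i<N. (\<Sum>j<N. \<Sum>k<N. q i j k * (p j (z t) * p k (z t))) * y i t) = 0"
      using skew[of "\<lambda>i. y i t"] by simp
    have "E' t = 2 * ((\<Sum>i<N. h i t * y i t)
        - (\<Sum>i<N. (\<Sum>j<N. \<Sum>k<N. q i j k * (p j (z t) * p k (z t))) * y i t)
        - (\<Sum>i<N. (\<Sum>j<N. A i j * y j t) * y i t))"
      unfolding E'_def G_def y_def sum_subtractf[symmetric]
      by (subst sum_distrib_left, intro sum.cong refl) (simp only: algebra_simps)
    also have "\<dots> \<le> 2 * (\<Sum>i<N. h i t * y i t)" using 0 coercive[of "\<lambda>i. y i t"] by simp
    also have "\<dots> \<le> (\<Sum>i<N. (h i t)\<^sup>2 + (y i t)\<^sup>2)"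
      unfolding sum_distrib_left
    proof (intro sum_mono)
      fix i show "2 * (h i t * y i t) \<le> (h i t)\<^sup>2 + (y i t)\<^sup>2"
        using sum_squares_bound[of "h i t" "y i t"] by (simp add: mult_ac)
    qed
    also have "\<dots> = E t + H t" by (simp add: sum.distrib E_def H_def)
    finally show ?thesis using H0(1)[OF t] by simp
  qed
  have E_le: "E t \<le> M" if t: "t \<in> {0..T}" for t
  proof -
    have "E t \<le> (E 0 + H0 * t) * exp (1 * t)"
    proof (rule gronwall[where E' = E' and C = 1 and D = H0, OF _ _ _ _ _ t])
      show "continuous_on {0..T} E"
        using dE by (meson DERIV_continuous_on)
    qed (use dE E'_le H0 in auto)
    also have "E 0 = (\<Sum>i<N. (y0 i)\<^sup>2)" unfolding E_def y_def z0 using evx0 by simp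
    also have "((\<Sum>i<N. (y0 i)\<^sup>2) + H0 * t) * exp (1 * t) \<le> M"
      unfolding M_def using t H0 by (intro mult_mono add_mono add_nonneg_nonneg sum_nonneg) auto
    finally show ?thesis .
  qed
  have cut: "p i (z t) = y i t" if t: "t \<in> {0..T}" for i t
  proof -
    have "s (z t) \<le> (\<Sum>i<N. 1 + (y i t)\<^sup>2)"
      unfolding s_def y_def
    proof (intro sum_mono)
      fix i
      have "0 \<le> (\<bar>ev i (z t)\<bar> - 1)\<^sup>2" by simp
      then have "2 * \<bar>ev i (z t)\<bar> \<le> 1 + (ev i (z t))\<^sup>2" by (simp add: power2_diff)
      then show "\<bar>ev i (z t)\<bar> \<le> 1 + (ev i (z t))\<^sup>2" by simp
    qed
    also have "\<dots> = N + E t" by (simp add: sum.distrib E_def)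
    finally have "s (z t) \<le> R" using E_le[OF t] by (simp add: R_def)
    then show ?thesis using R by (simp add: p_def y_def \<theta>_def)
  qed
  show ?thesis
  proof (intro exI[of _ y] allI impI conjI ballI)
    fix i assume i: "i < N"
    show "y i 0 = y0 i" using evx0[OF i] by (simp add: y_def z0)
    fix t assume t: "t \<in> {0..T}"
    show "(y i has_real_derivative h i t - (\<Sum>j<N. \<Sum>k<N. q i j k * (y j t * y k t)) - (\<Sum>j<N. A i j * y j t))
        (at t within {0..T})"
      using y[OF i t] unfolding G_def cut[OF t] by (simp add: y_def)
  qed
qed

section \<open>Test functions\<close>

text \<open>The smoothness part of \<open>C1_compact_support\<close>, separated so that factors
  without compact support, such as coordinate functions, can multiply test functions.\<close>

definition C1 :: "('a::real_normed_vector \<Rightarrow> 'b::real_normed_vector) \<Rightarrow> bool" where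
  "C1 \<phi> \<longleftrightarrow> (\<forall>x. \<phi> differentiable (at x)) \<and>
     (\<forall>h. continuous_on UNIV (\<lambda>x. frechet_derivative \<phi> (at x) h))"

lemma C1_compact_support_iff:
  "\<phi> \<in> C1_compact_support \<Omega> \<longleftrightarrow> C1 \<phi> \<and> (\<exists>K. compact K \<and> K \<subseteq> \<Omega> \<and> (\<forall>x. x \<notin> K \<longrightarrow> \<phi> x = 0))"
  by (auto simp: C1_compact_support_def C1_def)

lemma C1_I:
  assumes "\<And>x. (\<phi> has_derivative D x) (at x)" "\<And>h. continuous_on UNIV (\<lambda>x. D x h)"
  shows "C1 \<phi>"
proof -
  have "frechet_derivative \<phi> (at x) = D x" for x by (rule frechet_derivative_at[OF assms(1), symmetric])
  moreover have "\<phi> differentiable (at x)" for x using assms(1) by (rule differentiableI)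
  ultimately show ?thesis using assms(2) by (simp add: C1_def)
qed

lemma C1_has_derivative: "C1 \<phi> \<Longrightarrow> (\<phi> has_derivative frechet_derivative \<phi> (at x)) (at x)"
  using frechet_derivative_works by (auto simp: C1_def)

lemma C1_continuous: "C1 \<phi> \<Longrightarrow> continuous_on S \<phi>"
  by (intro continuous_at_imp_continuous_on ballI has_derivative_continuous[OF C1_has_derivative])

lemma C1_continuous_derivative: "C1 \<phi> \<Longrightarrow> continuous_on S (\<lambda>x. frechet_derivative \<phi> (at x) h)"
  unfolding C1_def by (auto intro: continuous_on_subset)

lemma frechet_derivative_mult:
  fixes \<phi> \<psi> :: "'a::real_normed_vector \<Rightarrow> real"
  assumes "C1 \<phi>" "C1 \<psi>"
  shows "frechet_derivative (\<lambda>x. \<phi> x * \<psi> x) (at x) h =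
    \<phi> x * frechet_derivative \<psi> (at x) h + frechet_derivative \<phi> (at x) h * \<psi> x"
  using frechet_derivative_at[OF has_derivative_mult[OF C1_has_derivative[OF assms(1)] C1_has_derivative[OF assms(2)]], of x]
  by (simp add: fun_eq_iff)

lemma C1_mult:
  fixes \<phi> \<psi> :: "'a::real_normed_vector \<Rightarrow> real"
  assumes "C1 \<phi>" "C1 \<psi>"
  shows "C1 (\<lambda>x. \<phi> x * \<psi> x)"
  by (rule C1_I[OF has_derivative_mult[OF C1_has_derivative[OF assms(1)] C1_has_derivative[OF assms(2)]]])
     (intro continuous_intros C1_continuous C1_continuous_derivative assms)

lemma C1_const: "C1 (\<lambda>x. c)"
  by (rule C1_I[OF has_derivative_const]) auto

lemma C1_prod:
  fixes f :: "'i \<Rightarrow> 'a::real_normed_vector \<Rightarrow> real"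
  assumes "\<And>i. i \<in> I \<Longrightarrow> C1 (f i)"
  shows "C1 (\<lambda>x. \<Prod>i\<in>I. f i x)"
  using assms by (induction I rule: infinite_finite_induct) (auto intro: C1_const C1_mult)

lemma C1_bounded_linear: "bounded_linear f \<Longrightarrow> C1 f"
  by (rule C1_I[OF bounded_linear_imp_has_derivative]) auto

lemma C1_bounded_linear_compose:
  assumes "bounded_linear T" "C1 \<phi>"
  shows "C1 (\<lambda>x. T (\<phi> x))"
    and "frechet_derivative (\<lambda>x. T (\<phi> x)) (at x) h = T (frechet_derivative \<phi> (at x) h)"
proof -
  have d: "((\<lambda>x. T (\<phi> x)) has_derivative (\<lambda>h. T (frechet_derivative \<phi> (at x) h))) (at x)" for x
    by (rule bounded_linear.has_derivative[OF assms(1) C1_has_derivative[OF assms(2)]])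
  show "C1 (\<lambda>x. T (\<phi> x))"
    by (rule C1_I[OF d]) (intro bounded_linear.continuous_on[OF assms(1)] C1_continuous_derivative assms)
  show "frechet_derivative (\<lambda>x. T (\<phi> x)) (at x) h = T (frechet_derivative \<phi> (at x) h)"
    using frechet_derivative_at[OF d, of x] by (simp add: fun_eq_iff)
qed

lemma C1_add:
  assumes "C1 \<phi>" "C1 \<psi>"
  shows "C1 (\<lambda>x. \<phi> x + \<psi> x)"
  by (rule C1_I[OF has_derivative_add[OF C1_has_derivative[OF assms(1)] C1_has_derivative[OF assms(2)]]])
     (intro continuous_intros C1_continuous_derivative assms)

section \<open>Smooth cut-offs\<close>

text \<open>Squaring the ramp removes its kink: this gives a C1 function that vanishes on a
  half-line, from which compactly supported functions are built as products.\<close>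

lemma has_real_derivative_ramp_power2:
  "((\<lambda>s. (max 0 s)\<^sup>2) has_real_derivative 2 * max 0 s) (at s)"
proof -
  consider "s > 0" | "s < 0" | "s = 0" by linarith
  then show ?thesis
  proof cases
    case 1
    have "((\<lambda>s. s\<^sup>2) has_real_derivative 2 * max 0 s) (at s)"
      using 1 by (auto intro!: derivative_eq_intros)
    then show ?thesis
      by (rule has_field_derivative_transform_within_open[where S = "{0<..}"]) (use 1 in auto)
  next
    case 2
    have "((\<lambda>s. 0) has_real_derivative 2 * max 0 s) (at s)"
      using 2 by (auto intro!: derivative_eq_intros)
    then show ?thesis
      by (rule has_field_derivative_transform_within_open[where S = "{..<0}"]) (use 2 in auto)
  next
    case 3
    have "((\<lambda>h::real. (max 0 h)\<^sup>2 / h) \<longlongrightarrow> 0) (at 0)"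
    proof (rule Lim_null_comparison)
      have "norm ((max 0 h)\<^sup>2 / h) \<le> \<bar>h\<bar>" for h :: real
        by (cases "h = 0") (auto simp: max_def power2_eq_square)
      then show "\<forall>\<^sub>F h in at 0. norm ((max 0 h)\<^sup>2 / h) \<le> \<bar>h\<bar>" by simp
      show "((\<lambda>h::real. \<bar>h\<bar>) \<longlongrightarrow> 0) (at 0)" by (auto intro!: tendsto_eq_intros)
    qed
    then show ?thesis using 3 by (simp add: DERIV_def)
  qed
qed

lemma C1_ramp_power2:
  fixes f :: "'a::real_normed_vector \<Rightarrow> real"
  assumes "bounded_linear f"
  shows "C1 (\<lambda>x. (max 0 (f x + d))\<^sup>2)"
proof (rule C1_I)
  show "((\<lambda>x. (max 0 (f x + d))\<^sup>2) has_derivative (\<lambda>h. f h * (2 * max 0 (f x + d)))) (at x)" for x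
    by (rule DERIV_compose_FDERIV[OF has_real_derivative_ramp_power2])
       (auto intro!: derivative_eq_intros bounded_linear_imp_has_derivative assms)
  show "continuous_on UNIV (\<lambda>x. f h * (2 * max 0 (f x + d)))" for h
    by (intro continuous_intros linear_continuous_on assms)
qed

text \<open>The values lie in \<open>{0..<1}\<close> and tend to 1 wherever \<phi> is positive as
  \<open>m\<close> grows, while zeros of \<phi> are kept: a smooth approach to the indicator of the
  set where \<phi> is positive.\<close>

lemma C1_saturate:
  fixes \<phi> :: "'a::real_normed_vector \<Rightarrow> real"
  assumes "C1 \<phi>" "\<And>x. 0 \<le> \<phi> x" "0 \<le> m"
  shows "C1 (\<lambda>x. m * \<phi> x / (1 + m * \<phi> x))"
proof -
  have p: "1 + m * \<phi> x > 0" for x using assms(2)[of x] assms(3) by (simp add: add_pos_nonneg)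
  have pp: "1 + m * \<phi> x \<noteq> 0" for x using p[of x] by simp
  show ?thesis
  proof (rule C1_I)
    show "((\<lambda>x. m * \<phi> x / (1 + m * \<phi> x)) has_derivative
      (\<lambda>h. m * frechet_derivative \<phi> (at x) h / (1 + m * \<phi> x)\<^sup>2)) (at x)" for x
      using pp[of x]
      by (auto intro!: derivative_eq_intros C1_has_derivative[OF assms(1)]
          simp: fun_eq_iff field_simps power2_eq_square)
    show "continuous_on UNIV (\<lambda>x. m * frechet_derivative \<phi> (at x) h / (1 + m * \<phi> x)\<^sup>2)" for h
      using pp by (intro continuous_intros C1_continuous C1_continuous_derivative assms) auto
  qed
qed

section \<open>Integrals of derivatives of compactly supported functions\<close>

lemma frechet_derivative_eq_0_outside:
  assumes "closed K" "\<And>x. x \<notin> K \<Longrightarrow> \<phi> x = 0" "x \<notin> K"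
  shows "frechet_derivative \<phi> (at x) h = 0"
proof -
  have "(\<phi> has_derivative (\<lambda>h. 0)) (at x)"
    by (rule has_derivative_transform_within_open[where s = "- K" and f = "\<lambda>x. 0"])
       (use assms in auto)
  then show ?thesis using frechet_derivative_at by metis
qed

lemma integral_lborel_translation:
  fixes \<phi> :: "'a::euclidean_space \<Rightarrow> real"
  assumes "\<phi> \<in> borel_measurable borel"
  shows "(\<integral>x. \<phi> (x + c) \<partial>lborel) = (\<integral>x. \<phi> x \<partial>lborel)"
proof -
  have "(\<integral>x. \<phi> x \<partial>lborel) = (\<integral>x. \<phi> x \<partial>(distr lborel borel ((+) c)))"
    by (simp add: lborel_distr_plus)
  also have "\<dots> = (\<integral>x. \<phi> (c + x) \<partial>lborel)"
    using assms by (intro integral_distr) auto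
  finally show ?thesis by (simp add: add.commute)
qed

lemma bounded_of_compact_support:
  fixes f :: "'a::topological_space \<Rightarrow> 'b::real_normed_vector"
  assumes "continuous_on UNIV f" "compact K" "\<And>x. x \<notin> K \<Longrightarrow> f x = 0"
  obtains C where "0 \<le> C" "\<And>x. norm (f x) \<le> C"
proof -
  have "bounded (f ` K)"
    using assms by (intro compact_imp_bounded compact_continuous_image) (auto intro: continuous_on_subset)
  then obtain C where C: "0 < C" "\<And>x. x \<in> K \<Longrightarrow> norm (f x) \<le> C" by (auto simp: bounded_pos)
  then have "norm (f x) \<le> C" for x using assms(3)[of x] by (cases "x \<in> K") auto
  then show ?thesis using that[of C] C by auto
qed

lemma integrable_lborel_of_compact_support:
  fixes f :: "'a::euclidean_space \<Rightarrow> real"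
  assumes "continuous_on UNIV f" "compact K" "\<And>x. x \<notin> K \<Longrightarrow> f x = 0"
  shows "integrable lborel f"
proof -
  have "integrable lborel (\<lambda>x. indicator K x *\<^sub>R f x)"
    using assms by (intro borel_integrable_compact) (auto intro: continuous_on_subset)
  moreover have "(\<lambda>x. indicator K x *\<^sub>R f x) = f" using assms(3) by (force simp: indicator_def)
  ultimately show ?thesis by simp
qed

text \<open>The derivative is the limit of difference quotients, whose integrals vanish by translation
  invariance.\<close>

lemma integral_frechet_derivative_eq_0:
  fixes \<phi> :: "'a::euclidean_space \<Rightarrow> real"
  assumes \<phi>: "C1 \<phi>" and K: "compact K" and 0: "\<And>x. x \<notin> K \<Longrightarrow> \<phi> x = 0"
  shows "(\<integral>x. frechet_derivative \<phi> (at x) h \<partial>lborel) = 0"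
proof -
  define D where "D x = frechet_derivative \<phi> (at x) h" for x
  have contD: "continuous_on UNIV D" unfolding D_def by (rule C1_continuous_derivative[OF \<phi>])
  have D0: "D x = 0" if "x \<notin> K" for x
    unfolding D_def by (rule frechet_derivative_eq_0_outside[OF compact_imp_closed[OF K] 0 that])
  obtain C where C: "0 \<le> C" "\<And>x. norm (D x) \<le> C"
    using bounded_of_compact_support[OF contD K D0] by metis
  obtain r where r: "\<And>x. x \<in> K \<Longrightarrow> norm x \<le> r"
    using compact_imp_bounded[OF K] by (auto simp: bounded_iff)
  define c where "c n = 1 / real (Suc n)" for n
  have c: "0 < c n" "c n \<le> 1" for n by (auto simp: c_def divide_simps)
  define q where "q n x = (\<phi> (x + c n *\<^sub>R h) - \<phi> x) / c n" for n x
  have line: "((\<lambda>s. \<phi> (x + s *\<^sub>R h)) has_real_derivative D (x + s *\<^sub>R h)) (at s)" for x s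
  proof -
    have "((\<lambda>s. x + s *\<^sub>R h) has_derivative (\<lambda>s. s *\<^sub>R h)) (at s)"
      by (auto intro!: derivative_eq_intros)
    from has_derivative_compose[OF this C1_has_derivative[OF \<phi>]]
    have "((\<lambda>s. \<phi> (x + s *\<^sub>R h)) has_derivative (\<lambda>t. frechet_derivative \<phi> (at (x + s *\<^sub>R h)) (t *\<^sub>R h))) (at s)" .
    moreover have "(\<lambda>t. frechet_derivative \<phi> (at (x + s *\<^sub>R h)) (t *\<^sub>R h)) = (*) (D (x + s *\<^sub>R h))"
      using has_derivative_linear[OF C1_has_derivative[OF \<phi>]] by (simp add: fun_eq_iff linear_cmul D_def)
    ultimately show ?thesis by (simp add: has_field_derivative_def)
  qed
  have bc: "\<phi> \<in> borel_measurable borel" "D \<in> borel_measurable borel"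
    by (auto intro!: borel_measurable_continuous_onI C1_continuous[OF \<phi>] contD)
  have bq: "q n \<in> borel_measurable borel" for n
    unfolding q_def
    by (intro borel_measurable_continuous_onI continuous_intros continuous_on_compose2[OF C1_continuous[OF \<phi>, of UNIV]])
       (use c[of n] in auto)
  \<comment> \<open>The mean value theorem bounds the quotients by \<open>C\<close>; since the steps
    \<open>c n\<close> are at most 1, all quotients vanish outside one fixed ball, whose indicator
    serves as dominating function.\<close>
  have q_le: "norm (q n x) \<le> C * indicator (cball 0 (r + norm h)) x" for n x
  proof (cases "x \<in> cball 0 (r + norm h)")
    case True
    obtain s where "\<phi> (x + c n *\<^sub>R h) - \<phi> (x + 0 *\<^sub>R h) = (c n - 0) * D (x + s *\<^sub>R h)"
      using MVT2[OF c(1)[of n] line] by metis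
    then have "q n x = D (x + s *\<^sub>R h)" using c[of n] by (simp add: q_def)
    then show ?thesis using True C by simp
  next
    case False
    have "x \<notin> K" using r[of x] False norm_ge_zero[of h] by (auto simp del: norm_ge_zero)
    moreover have "x + c n *\<^sub>R h \<notin> K"
    proof
      assume "x + c n *\<^sub>R h \<in> K"
      then have "norm (x + c n *\<^sub>R h) \<le> r" by (rule r)
      moreover have "norm x \<le> norm (x + c n *\<^sub>R h) + norm (c n *\<^sub>R h)"
        by (metis add_diff_cancel_right' norm_triangle_ineq4)
      moreover have "norm (c n *\<^sub>R h) \<le> norm h" using c[of n] by (simp add: mult_left_le_one_le)
      ultimately show False using False by simp
    qed
    ultimately show ?thesis using 0 C by (simp add: q_def)
  qed
  have int\<phi>: "integrable lborel \<phi>"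
    by (rule integrable_lborel_of_compact_support[OF C1_continuous[OF \<phi>] K 0])
  have int\<phi>': "integrable lborel (\<lambda>x. \<phi> (x + a))" for a
  proof (rule integrable_lborel_of_compact_support)
    show "continuous_on UNIV (\<lambda>x. \<phi> (x + a))"
      by (intro continuous_on_compose2[OF C1_continuous[OF \<phi>, of UNIV]] continuous_intros) auto
    show "compact ((\<lambda>x. x - a) ` K)"
      by (intro compact_continuous_image continuous_intros K)
    show "\<phi> (x + a) = 0" if "x \<notin> (\<lambda>x. x - a) ` K" for x
      using that by (intro 0) (metis add_diff_cancel_right' image_eqI)
  qed
  have "(\<lambda>n. \<integral>x. q n x \<partial>lborel) \<longlonglongrightarrow> (\<integral>x. D x \<partial>lborel)"
  proof (rule integral_dominated_convergence)
    show "D \<in> borel_measurable lborel" "\<And>n. q n \<in> borel_measurable lborel"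
      using bc bq by auto
    have "integrable lborel (indicator (cball 0 (r + norm h)) :: 'a \<Rightarrow> real)"
      by (intro integrable_real_indicator) (auto simp: emeasure_bounded_finite[unfolded infinity_ennreal_def])
    then show "integrable lborel (\<lambda>x::'a. C * indicator (cball 0 (r + norm h)) x)"
      by simp
    show "AE x in lborel. (\<lambda>n. q n x) \<longlonglongrightarrow> D x"
    proof (rule AE_I2)
      fix x
      have "((\<lambda>s. (\<phi> (x + (0 + s) *\<^sub>R h) - \<phi> (x + 0 *\<^sub>R h)) / s) \<longlongrightarrow> D (x + 0 *\<^sub>R h)) (at 0)"
        using line[of x 0] unfolding DERIV_def .
      then have "((\<lambda>s. (\<phi> (x + s *\<^sub>R h) - \<phi> x) / s) \<longlongrightarrow> D x) (at 0)" by simp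
      moreover have "filterlim c (at 0) sequentially"
      proof -
        have "c \<longlonglongrightarrow> 0" using LIMSEQ_inverse_real_of_nat by (simp add: c_def[abs_def] inverse_eq_divide)
        then show ?thesis using c by (simp add: filterlim_at less_imp_neq[symmetric])
      qed
      ultimately show "(\<lambda>n. q n x) \<longlonglongrightarrow> D x"
        unfolding q_def by (rule filterlim_compose)
    qed
    show "AE x in lborel. norm (q n x) \<le> C * indicator (cball 0 (r + norm h)) x" for n
      using q_le by simp
  qed
  moreover have "(\<integral>x. q n x \<partial>lborel) = 0" for n
    unfolding q_def using int\<phi> int\<phi>'[of "c n *\<^sub>R h"] integral_lborel_translation[OF bc(1)]
    by simp
  ultimately have "(\<lambda>n. 0) \<longlonglongrightarrow> (\<integral>x. D x \<partial>lborel)" by simp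
  then show ?thesis unfolding D_def using LIMSEQ_unique tendsto_const by blast
qed

section \<open>Null functions and integrals over boxes\<close>

text \<open>The sets over which the integral of \<open>f\<close> vanishes form a Dynkin system, and
  the boxes are a generator of the Borel sets that is closed under intersection.\<close>

lemma AE_lborel_eq_0_if_box_integrals:
  fixes f :: "'a::euclidean_space \<Rightarrow> real"
  assumes f: "integrable lborel f"
    and box: "\<And>a b. (LINT x:box a b|lborel. f x) = 0"
  shows "AE x in lborel. f x = 0"
proof (rule sigma_finite_measure.density_zero[OF sigma_finite_lborel f])
  have sub: "set_integrable lborel A f" if "A \<in> sets borel" for A
    unfolding set_integrable_def using that by (intro integrable_mult_indicator f) auto
  \<comment> \<open>Complements require that the integral over the whole space vanish; the whole
    space is an increasing union of boxes.\<close>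
  have UNIV: "(\<integral>x. f x \<partial>lborel) = 0"
  proof -
    let ?B = "\<lambda>n::nat. box (- (real n *\<^sub>R One)) (real n *\<^sub>R One) :: 'a set"
    have "(\<lambda>n. LINT x:?B n|lborel. f x) \<longlonglongrightarrow> (LINT x:(\<Union>n. ?B n)|lborel. f x)"
    proof (rule set_integral_cont_up)
      show "incseq ?B"
        by (auto simp: incseq_def mem_box inner_simps intro: less_le_trans le_less_trans)
           (smt (verit) of_nat_mono)+
      show "set_integrable lborel (\<Union>n. ?B n) f" by (rule sub) auto
    qed auto
    then have "(\<integral>x. f x \<partial>lborel) = 0"
      unfolding box UN_box_eq_UNIV by (simp add: set_lebesgue_integral_def LIMSEQ_const_iff)
    then show ?thesis .
  qed
  fix A :: "'a set" assume "A \<in> sets lborel"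
  then have A: "A \<in> sigma_sets UNIV (range (\<lambda>(a, b). box a b))"
    by (simp add: borel_eq_box)
  have "Int_stable (range (\<lambda>(a, b). box a b :: 'a set))"
    by (auto simp: Int_stable_def box_Int_box)
  moreover have "range (\<lambda>(a, b). box a b :: 'a set) \<subseteq> Pow UNIV" by simp
  ultimately show "(LINT x:A|lborel. f x) = 0" using A
  proof (induction rule: sigma_sets_induct_disjoint)
    case (basic A)
    then show ?case using box by auto
  next
    case empty
    show ?case by (simp add: set_lebesgue_integral_def)
  next
    case (compl A)
    then have A: "A \<in> sets borel" by (simp add: borel_eq_box)
    have "(LINT x:UNIV - A|lborel. f x) = (\<integral>x. f x - indicator A x *\<^sub>R f x \<partial>lborel)"
      unfolding set_lebesgue_integral_def by (intro Bochner_Integration.integral_cong) (auto simp: indicator_def)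
    also have "\<dots> = (\<integral>x. f x \<partial>lborel) - (LINT x:A|lborel. f x)"
      using f sub[OF A] unfolding set_lebesgue_integral_def set_integrable_def
      by (intro Bochner_Integration.integral_diff)
    finally show ?case using UNIV compl by simp
  next
    case (union A)
    have "range A \<subseteq> sets borel" using union(2) by (simp add: borel_eq_box)
    then have "(LINT x:(\<Union>i. A i)|lborel. f x) = (\<Sum>i. (LINT x:(A i)|lborel. f x))"
      using union(1) by (intro lebesgue_integral_countable_add sub) (auto simp: disjoint_family_on_def)
    then show ?case using union(3) by simp
  qed
qed

text \<open>A product of squared ramps vanishes outside the box shrunk by \<open>c n\<close>, which
  gives compact support inside the open box; saturation with the factor \<open>n + 1\<close> pushes
  the values inside to 1. The bound by 1 is there for dominated convergence.\<close>

lemma box_indicator_limit: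
  fixes a b :: "real^'n"
  obtains \<phi> :: "nat \<Rightarrow> real^'n \<Rightarrow> real"
  where "\<And>n. \<phi> n \<in> C1_compact_support (box a b)" "\<And>n x. 0 \<le> \<phi> n x" "\<And>n x. \<phi> n x \<le> 1"
    "\<And>x. (\<lambda>n. \<phi> n x) \<longlonglongrightarrow> indicator (box a b) x"
proof -
  define c where "c n = 1 / real (Suc n)" for n
  have c: "0 < c n" for n by (simp add: c_def)
  have c0: "c \<longlonglongrightarrow> 0"
    using LIMSEQ_inverse_real_of_nat by (simp add: c_def[abs_def] inverse_eq_divide)
  define r where "r n x = (\<Prod>i\<in>UNIV. (max 0 (x $ i + (- a $ i - c n)))\<^sup>2 * (max 0 (- x $ i + (b $ i - c n)))\<^sup>2)"
    for n and x :: "real^'n"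
  define \<phi> where "\<phi> n x = real (Suc n) * r n x / (1 + real (Suc n) * r n x)" for n x
  have C1r: "C1 (r n)" for n
    unfolding r_def
    by (intro C1_prod C1_mult C1_ramp_power2 bounded_linear_minus bounded_linear_vec_nth)
  have r0: "0 \<le> r n x" for n x unfolding r_def by (intro prod_nonneg mult_nonneg_nonneg ballI) auto
  have C1: "C1 (\<phi> n)" for n unfolding \<phi>_def by (intro C1_saturate C1r r0) auto
  let ?K = "\<lambda>n. cbox (\<chi> i. a $ i + c n) (\<chi> i. b $ i - c n)"
  have supp: "r n x = 0" if x: "x \<notin> ?K n" for n x
  proof -
    obtain i where "x $ i < a $ i + c n \<or> b $ i - c n < x $ i"
      using x by (auto simp: mem_box_cart not_le)
    then have "(max 0 (x $ i + (- a $ i - c n)))\<^sup>2 * (max 0 (- x $ i + (b $ i - c n)))\<^sup>2 = 0" by auto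
    then show ?thesis unfolding r_def by (intro prod_zero) auto
  qed
  have sub: "?K n \<subseteq> box a b" for n
  proof
    fix x assume "x \<in> ?K n"
    then have "a $ i + c n \<le> x $ i \<and> x $ i \<le> b $ i - c n" for i by (simp add: mem_box_cart)
    then show "x \<in> box a b" unfolding mem_box_cart using c[of n] by (smt (verit))
  qed
  have \<phi>01: "0 \<le> \<phi> n x" "\<phi> n x \<le> 1" for n x
  proof -
    have "0 \<le> real (Suc n) * r n x" using r0[of n x] by (intro mult_nonneg_nonneg) auto
    then show "0 \<le> \<phi> n x" "\<phi> n x \<le> 1" unfolding \<phi>_def by (auto simp: divide_simps)
  qed
  show ?thesis
  proof (rule that[OF _ \<phi>01])
    show "\<phi> n \<in> C1_compact_support (box a b)" for n
      unfolding C1_compact_support_iff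
    proof (intro conjI exI[of _ "?K n"] allI impI)
      show "\<phi> n x = 0" if "x \<notin> ?K n" for x using supp[OF that] by (simp add: \<phi>_def)
    qed (rule C1 compact_cbox sub)+
    fix x :: "real^'n"
    show "(\<lambda>n. \<phi> n x) \<longlonglongrightarrow> indicator (box a b) x"
    proof (cases "x \<in> box a b")
      case True
      \<comment> \<open>The limit of \<open>r n x\<close>. It is positive inside the box, so
        \<open>(n + 1) * r n x\<close> tends to infinity and its saturation to 1.\<close>
      let ?r = "\<Prod>i\<in>UNIV. (max 0 (x $ i + (- a $ i - 0)))\<^sup>2 * (max 0 (- x $ i + (b $ i - 0)))\<^sup>2"
      have "(\<lambda>n. r n x) \<longlonglongrightarrow> ?r" unfolding r_def by (intro tendsto_intros c0)
      moreover have "?r > 0"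
      proof (intro prod_pos)
        fix i
        have "a $ i < x $ i" "x $ i < b $ i" using True by (auto simp: mem_box_cart)
        then show "0 < (max 0 (x $ i + (- a $ i - 0)))\<^sup>2 * (max 0 (- x $ i + (b $ i - 0)))\<^sup>2"
          by simp
      qed
      ultimately have "filterlim (\<lambda>n. r n x * real (Suc n)) at_top sequentially"
        by (intro filterlim_tendsto_pos_mult_at_top
            filterlim_compose[OF filterlim_real_sequentially filterlim_Suc]) auto
      then have "filterlim (\<lambda>n. 1 + r n x * real (Suc n)) at_top sequentially"
        by (intro filterlim_tendsto_add_at_top[OF tendsto_const])
      then have "(\<lambda>n. 1 - inverse (1 + r n x * real (Suc n))) \<longlonglongrightarrow> 1 - 0"
        by (intro tendsto_intros tendsto_inverse_0_at_top)
      moreover have "1 - inverse (1 + r n x * real (Suc n)) = \<phi> n x" for n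
      proof -
        have "1 + r n x * real (Suc n) > 0" using r0[of n x] by (intro add_pos_nonneg mult_nonneg_nonneg) auto
        then show ?thesis by (simp add: \<phi>_def divide_simps mult.commute)
      qed
      ultimately show ?thesis using True by simp
    next
      case False
      then have "\<phi> n x = 0" for n using sub supp by (auto simp: \<phi>_def)
      then show ?thesis using False by simp
    qed
  qed
qed

section \<open>Linear maps on matrices\<close>

lemma bounded_linear_trace: "bounded_linear (trace :: real^'n^'n \<Rightarrow> real)"
proof -
  have "linear (trace :: real^'n^'n \<Rightarrow> real)"
    by (rule linearI) (auto simp: trace_def sum.distrib sum_distrib_left)
  then show ?thesis by (simp add: linear_conv_bounded_linear)
qed

text \<open>The pointwise content of \<open>sym_grad\<close>, stated on matrices so that facts on
  composition with a bounded linear map apply.\<close>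

definition sym_part :: "real^'n^'n \<Rightarrow> real^'n^'n" where
  "sym_part A = (1/2) *\<^sub>R (A + transpose A)"

lemma bounded_linear_sym_part: "bounded_linear (sym_part :: real^'n^'n \<Rightarrow> _)"
proof -
  have "linear (sym_part :: real^'n^'n \<Rightarrow> _)"
    by (rule linearI) (auto simp: sym_part_def vec_eq_iff transpose_def algebra_simps)
  then show ?thesis by (simp add: linear_conv_bounded_linear)
qed

lemma bounded_bilinear_matrix_vector: "bounded_bilinear ((*v) :: real^'n^'m \<Rightarrow> _)"
  unfolding bilinear_conv_bounded_bilinear[symmetric] bilinear_def
  by (auto intro!: linearI simp: matrix_vector_right_distrib matrix_vector_mult_scaleR
      matrix_vector_mult_add_rdistrib scaleR_matrix_vector_assoc)

section \<open>Integration over the domain\<close>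

locale bounded_domain =
  fixes \<Omega> :: "(real^'n) set"
  assumes open_domain: "open \<Omega>" and bounded_domain: "bounded \<Omega>"
begin

abbreviation M :: "(real^'n) measure" where "M \<equiv> lebesgue_on \<Omega>"

lemma domain_lebesgue [measurable, simp]: "\<Omega> \<in> sets lebesgue"
  using open_domain by (intro sets_completionI_sets) simp

lemma domain_Int [simp]: "\<Omega> \<inter> space lebesgue \<in> sets lebesgue"
  by simp

lemma space_M [simp]: "space M = \<Omega>"
  by (simp add: space_restrict_space)

sublocale finite_measure M
  using finite_measure_lebesgue_on bounded_set_imp_lmeasurable[OF bounded_domain] by simp

lemma AE_M_iff: "(AE x in M. P x) \<longleftrightarrow> (AE x in lebesgue. x \<in> \<Omega> \<longrightarrow> P x)"
  by (rule AE_restrict_space_iff) simp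

lemma measurable_M: "f \<in> borel_measurable borel \<Longrightarrow> f \<in> borel_measurable M"
  by (intro measurable_restrict_space1 measurable_completion) simp

text \<open>The function spaces use the completed Lebesgue measure, whereas translation invariance
  and the box criterion are stated for \<open>lborel\<close>; Borel measurability makes the two
  integrals agree.\<close>

lemma integral_M_eq_lborel:
  fixes f :: "real^'n \<Rightarrow> real"
  assumes "f \<in> borel_measurable borel" "\<And>x. x \<notin> \<Omega> \<Longrightarrow> f x = 0"
  shows "integral\<^sup>L M f = integral\<^sup>L lborel f"
proof -
  have "(\<lambda>x. indicator \<Omega> x *\<^sub>R f x) = f" using assms(2) by (force simp: indicator_def)
  then have "integral\<^sup>L M f = integral\<^sup>L lebesgue f" by (simp add: integral_restrict_space)
  also have "\<dots> = integral\<^sup>L lborel f" using assms(1) by (intro integral_completion) simp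
  finally show ?thesis .
qed

lemma integral_test_derivative_eq_0:
  fixes \<phi> :: "real^'n \<Rightarrow> real"
  assumes "\<phi> \<in> C1_compact_support \<Omega>"
  shows "(\<integral>x. frechet_derivative \<phi> (at x) h \<partial>M) = 0"
proof -
  obtain K where K: "C1 \<phi>" "compact K" "K \<subseteq> \<Omega>" "\<And>x. x \<notin> K \<Longrightarrow> \<phi> x = 0"
    using assms by (auto simp: C1_compact_support_iff)
  have "(\<integral>x. frechet_derivative \<phi> (at x) h \<partial>M) = (\<integral>x. frechet_derivative \<phi> (at x) h \<partial>lborel)"
  proof (rule integral_M_eq_lborel)
    show "(\<lambda>x. frechet_derivative \<phi> (at x) h) \<in> borel_measurable borel"
      using K(1) by (intro borel_measurable_continuous_onI C1_continuous_derivative)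
    show "frechet_derivative \<phi> (at x) h = 0" if "x \<notin> \<Omega>" for x
      using K(3) that by (intro frechet_derivative_eq_0_outside[OF compact_imp_closed[OF K(2)] K(4)]) auto
  qed
  then show ?thesis using integral_frechet_derivative_eq_0[OF K(1,2,4)] by simp
qed

text \<open>Smoothed indicators of boxes inside \<Omega> are test functions, so the integral of
  \<open>g\<close> over every such box vanishes; an open set is a countable union of such
  boxes.\<close>

lemma fundamental_lemma:
  fixes g :: "real^'n \<Rightarrow> real"
  assumes g: "integrable M g"
    and 0: "\<And>\<phi>. \<phi> \<in> C1_compact_support \<Omega> \<Longrightarrow> (\<integral>x. g x * \<phi> x \<partial>M) = 0"
  shows "AE x in M. g x = 0"
proof -
  define h where "h x = indicator \<Omega> x *\<^sub>R g x" for x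
  have h: "integrable lebesgue h" using g unfolding h_def by (simp add: integrable_restrict_space)
  \<comment> \<open>A Borel representative is needed because the box criterion lives on
    \<open>lborel\<close>, while \<open>g\<close> is only Lebesgue measurable.\<close>
  then obtain g' where g': "g' \<in> borel_measurable lborel" and ae: "AE x in lborel. h x = g' x"
    using completion_ex_borel_measurable_real[of h lborel] by (auto dest: borel_measurable_integrable)
  have ae': "AE x in lebesgue. h x = g' x" by (rule AE_completion[OF ae])
  have g'm: "g' \<in> borel_measurable lebesgue" by (rule measurable_completion[OF g'])
  have "integrable lebesgue g'"
    by (rule integrable_cong_AE_imp[OF h g'm]) (rule ae')
  then have intg': "integrable lborel g'" using integrable_completion[OF g'] by simp
  have box: "(\<integral>x. indicator (box a b) x *\<^sub>R g' x \<partial>lborel) = 0" if ab: "box a b \<subseteq> \<Omega>" for a b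
  proof -
    obtain \<phi> :: "nat \<Rightarrow> real^'n \<Rightarrow> real"
      where \<phi>: "\<And>n. \<phi> n \<in> C1_compact_support (box a b)" "\<And>n x. 0 \<le> \<phi> n x" "\<And>n x. \<phi> n x \<le> 1"
      "\<And>x. (\<lambda>n. \<phi> n x) \<longlonglongrightarrow> indicator (box a b) x"
      by (rule box_indicator_limit[of a b]) (rule that)
    have C1c: "\<phi> n \<in> C1_compact_support \<Omega>" for n
      using \<phi>(1)[of n] ab unfolding C1_compact_support_iff by blast
    have m\<phi>: "\<phi> n \<in> borel_measurable M" for n
      using C1c[of n] by (intro measurable_M borel_measurable_continuous_onI C1_continuous)
        (auto simp: C1_compact_support_iff)
    have mg: "g \<in> borel_measurable M" using g by (rule borel_measurable_integrable)
    have "(\<lambda>n. \<integral>x. g x * \<phi> n x \<partial>M) \<longlonglongrightarrow> (\<integral>x. g x * indicator (box a b) x \<partial>M)"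
    proof (rule integral_dominated_convergence)
      have "(indicator (box a b) :: real^'n \<Rightarrow> real) \<in> borel_measurable M" by (intro measurable_M) simp
      then show "(\<lambda>x. g x * indicator (box a b) x) \<in> borel_measurable M" using mg by simp
      show "(\<lambda>x. g x * \<phi> n x) \<in> borel_measurable M" for n using mg m\<phi> by simp
      show "integrable M (\<lambda>x. \<bar>g x\<bar>)" using g by simp
      show "AE x in M. (\<lambda>n. g x * \<phi> n x) \<longlonglongrightarrow> g x * indicator (box a b) x"
        using \<phi>(4) by (auto intro!: tendsto_intros)
      show "AE x in M. norm (g x * \<phi> n x) \<le> \<bar>g x\<bar>" for n
        using \<phi>(2,3)[of n] by (auto simp: abs_mult intro!: mult_right_le_one_le)
    qed
    then have "(\<integral>x. g x * indicator (box a b) x \<partial>M) = 0"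
      using 0[OF C1c] by (simp add: LIMSEQ_const_iff)
    then have "(\<integral>x. indicator (box a b) x *\<^sub>R h x \<partial>lebesgue) = 0"
      unfolding h_def by (simp add: integral_restrict_space mult_ac)
    moreover have "(\<integral>x. indicator (box a b) x *\<^sub>R h x \<partial>lebesgue) = (\<integral>x. indicator (box a b) x *\<^sub>R g' x \<partial>lebesgue)"
    proof (rule integral_cong_AE)
      have "(indicator (box a b) :: real^'n \<Rightarrow> real) \<in> borel_measurable lebesgue"
        by (intro measurable_completion) simp
      then show "(\<lambda>x. indicator (box a b) x *\<^sub>R h x) \<in> borel_measurable lebesgue"
        "(\<lambda>x. indicator (box a b) x *\<^sub>R g' x) \<in> borel_measurable lebesgue"
        using g'm borel_measurable_integrable[OF h] by (auto intro: borel_measurable_scaleR)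
      show "AE x in lebesgue. indicator (box a b) x *\<^sub>R h x = indicator (box a b) x *\<^sub>R g' x"
        using ae' by eventually_elim simp
    qed
    moreover have "(\<lambda>x. indicator (box a b) x *\<^sub>R g' x) \<in> borel_measurable lborel"
      using g' by (intro borel_measurable_scaleR borel_measurable_indicator) auto
    ultimately show ?thesis by (simp add: integral_completion)
  qed
  \<comment> \<open>Localising to a box inside \<Omega> makes the box criterion applicable:
    intersections of boxes with it are again boxes inside \<Omega>.\<close>
  have Q: "AE x in lborel. x \<in> box c d \<longrightarrow> g' x = 0" if cd: "box c d \<subseteq> \<Omega>" for c d
  proof -
    have "AE x in lborel. indicator (box c d) x *\<^sub>R g' x = 0"
    proof (rule AE_lborel_eq_0_if_box_integrals)
      show "integrable lborel (\<lambda>x. indicator (box c d) x *\<^sub>R g' x)"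
        using intg' by (intro integrable_mult_indicator) auto
      fix a b :: "real^'n"
      obtain a' b' where ab: "box a b \<inter> box c d = box a' b'" using box_Int_box by blast
      have "(LINT x:box a b|lborel. indicator (box c d) x *\<^sub>R g' x) = (\<integral>x. indicator (box a b \<inter> box c d) x *\<^sub>R g' x \<partial>lborel)"
        unfolding set_lebesgue_integral_def by (simp add: indicator_inter_arith mult_ac)
      also have "\<dots> = 0" unfolding ab using ab cd by (intro box) auto
      finally show "(LINT x:box a b|lborel. indicator (box c d) x *\<^sub>R g' x) = 0" .
    qed
    then show ?thesis by (auto simp: indicator_def elim: eventually_mono)
  qed
  have "AE x in lborel. x \<in> \<Omega> \<longrightarrow> g' x = 0"
  proof -
    let ?a = "\<lambda>f :: real^'n \<Rightarrow> real \<times> real. (\<Sum>i\<in>Basis. fst (f i) *\<^sub>R i)"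
    let ?b = "\<lambda>f :: real^'n \<Rightarrow> real \<times> real. (\<Sum>i\<in>Basis. snd (f i) *\<^sub>R i)"
    \<comment> \<open>Boxes with rational corners, so that there are only countably many exceptional
      null sets.\<close>
    define I where "I = {f\<in>Basis \<rightarrow>\<^sub>E \<rat> \<times> \<rat>. box (?a f) (?b f) \<subseteq> \<Omega>}"
    have cI: "countable I" unfolding I_def
      by (rule countable_subset[of _ "Basis \<rightarrow>\<^sub>E \<rat> \<times> \<rat>"]) (auto intro!: countable_PiE countable_rat)
    have "AE x in lborel. \<forall>f\<in>I. x \<in> box (?a f) (?b f) \<longrightarrow> g' x = 0"
      by (rule AE_ball_countable'[OF Q cI]) (simp add: I_def)
    moreover have "\<Omega> = (\<Union>f\<in>I. box (?a f) (?b f))"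
      unfolding I_def by (rule open_UNION_box[OF open_domain])
    ultimately show ?thesis by (auto elim!: eventually_mono)
  qed
  then have "AE x in lebesgue. x \<in> \<Omega> \<longrightarrow> g' x = 0" by (rule AE_completion)
  then show ?thesis
    unfolding AE_M_iff using ae' by eventually_elim (auto simp: h_def)
qed

section \<open>The space \<open>L2\<close>\<close>

lemma L2_measurable: "u \<in> L2_space \<Omega> \<Longrightarrow> u \<in> borel_measurable M"
  by (simp add: L2_space_def)

lemma L2_integrable: "u \<in> L2_space \<Omega> \<Longrightarrow> integrable M (\<lambda>x. (norm (u x))\<^sup>2)"
  by (simp add: L2_space_def)

lemma L2_bound:
  fixes f :: "real^'n \<Rightarrow> 'b::euclidean_space" and u :: "real^'n \<Rightarrow> 'c::euclidean_space"
  assumes "u \<in> L2_space \<Omega>" "f \<in> borel_measurable M" "AE x in M. norm (f x) \<le> C * norm (u x)"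
  shows "f \<in> L2_space \<Omega>"
proof -
  have "integrable M (\<lambda>x. (norm (f x))\<^sup>2)"
  proof (rule Bochner_Integration.integrable_bound)
    show "integrable M (\<lambda>x. C\<^sup>2 * (norm (u x))\<^sup>2)" using L2_integrable[OF assms(1)] by simp
    show "(\<lambda>x. (norm (f x))\<^sup>2) \<in> borel_measurable M" using assms(2) by simp
    show "AE x in M. norm ((norm (f x))\<^sup>2) \<le> norm (C\<^sup>2 * (norm (u x))\<^sup>2)"
      using assms(3)
    proof eventually_elim
      case (elim x)
      then have "(norm (f x))\<^sup>2 \<le> (C * norm (u x))\<^sup>2" by (intro power_mono) auto
      then show ?case by (simp add: power_mult_distrib)
    qed
  qed
  then show ?thesis using assms(2) by (simp add: L2_space_def)
qed

lemma subspace_L2: "subspace (L2_space \<Omega> :: (real^'n \<Rightarrow> 'b::euclidean_space) set)"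
proof (rule subspaceI)
  show "0 \<in> L2_space \<Omega>" by (simp add: L2_space_def zero_fun_def)
  fix u v :: "real^'n \<Rightarrow> 'b" assume u: "u \<in> L2_space \<Omega>" and v: "v \<in> L2_space \<Omega>"
  have m: "u + v \<in> borel_measurable M"
    using L2_measurable[OF u] L2_measurable[OF v] unfolding plus_fun_def by simp
  have "integrable M (\<lambda>x. (norm ((u + v) x))\<^sup>2)"
  proof (rule Bochner_Integration.integrable_bound)
    show "integrable M (\<lambda>x. 2 * (norm (u x))\<^sup>2 + 2 * (norm (v x))\<^sup>2)"
      using L2_integrable[OF u] L2_integrable[OF v] by simp
    show "(\<lambda>x. (norm ((u + v) x))\<^sup>2) \<in> borel_measurable M" using m by measurable
    have "norm ((norm ((u + v) x))\<^sup>2) \<le> norm (2 * (norm (u x))\<^sup>2 + 2 * (norm (v x))\<^sup>2)" for x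
    proof -
      have "(norm (u x + v x))\<^sup>2 \<le> (norm (u x) + norm (v x))\<^sup>2"
        by (intro power_mono norm_triangle_ineq) auto
      also have "\<dots> \<le> 2 * (norm (u x))\<^sup>2 + 2 * (norm (v x))\<^sup>2"
        using sum_squares_bound[of "norm (u x)" "norm (v x)"] by (simp add: power2_sum)
      finally show ?thesis by simp
    qed
    then show "AE x in M. norm ((norm ((u + v) x))\<^sup>2) \<le> norm (2 * (norm (u x))\<^sup>2 + 2 * (norm (v x))\<^sup>2)" by simp
  qed
  then show "u + v \<in> L2_space \<Omega>" using m by (simp add: L2_space_def)
next
  fix c and u :: "real^'n \<Rightarrow> 'b" assume u: "u \<in> L2_space \<Omega>"
  show "c *\<^sub>R u \<in> L2_space \<Omega>"
  proof (rule L2_bound[OF u])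
    show "c *\<^sub>R u \<in> borel_measurable M" using L2_measurable[OF u] unfolding scaleR_fun_def by simp
    show "AE x in M. norm ((c *\<^sub>R u) x) \<le> \<bar>c\<bar> * norm (u x)" by simp
  qed
qed

lemma L2_inner_integrable:
  assumes "u \<in> L2_space \<Omega>" "v \<in> L2_space \<Omega>"
  shows "integrable M (\<lambda>x. u x \<bullet> v x)"
proof (rule Bochner_Integration.integrable_bound)
  show "integrable M (\<lambda>x. (norm (u x))\<^sup>2 + (norm (v x))\<^sup>2)"
    using L2_integrable[OF assms(1)] L2_integrable[OF assms(2)] by simp
  show "(\<lambda>x. u x \<bullet> v x) \<in> borel_measurable M"
    using L2_measurable[OF assms(1)] L2_measurable[OF assms(2)] by simp
  have "norm (u x \<bullet> v x) \<le> norm ((norm (u x))\<^sup>2 + (norm (v x))\<^sup>2)" for x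
  proof -
    have "\<bar>u x \<bullet> v x\<bar> \<le> norm (u x) * norm (v x)" by (rule Cauchy_Schwarz_ineq2)
    also have "2 * (norm (u x) * norm (v x)) \<le> (norm (u x))\<^sup>2 + (norm (v x))\<^sup>2"
      using sum_squares_bound[of "norm (u x)" "norm (v x)"] by simp
    finally show ?thesis by (simp add: field_simps)
  qed
  then show "AE x in M. norm (u x \<bullet> v x) \<le> norm ((norm (u x))\<^sup>2 + (norm (v x))\<^sup>2)" by simp
qed

lemma psd_L2: "psd_on (L2_space \<Omega> :: (real^'n \<Rightarrow> 'b::euclidean_space) set) (L2_inner \<Omega>)"
  unfolding psd_on_def
proof (intro conjI ballI)
  fix u :: "real^'n \<Rightarrow> 'b" assume u: "u \<in> L2_space \<Omega>"
  show "lin_on (L2_space \<Omega>) (L2_inner \<Omega> u)"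
    using L2_inner_integrable[OF u]
    by (intro lin_onI) (auto simp: L2_inner_def inner_add_right)
  show "0 \<le> L2_inner \<Omega> u u" by (simp add: L2_inner_def)
  fix v :: "real^'n \<Rightarrow> 'b"
  show "L2_inner \<Omega> u v = L2_inner \<Omega> v u" by (simp add: L2_inner_def inner_commute)
qed

lemma L2_inner_commute: "L2_inner \<Omega> u v = L2_inner \<Omega> v u"
  by (simp add: L2_inner_def inner_commute)

lemma L2_inner_self_eq_0_iff:
  assumes "u \<in> L2_space \<Omega>"
  shows "L2_inner \<Omega> u u = 0 \<longleftrightarrow> (AE x in M. u x = 0)"
  unfolding L2_inner_def
  by (subst integral_nonneg_eq_0_iff_AE[OF L2_inner_integrable[OF assms assms]]) auto

lemma L2_inner_cong:
  assumes "u \<in> L2_space \<Omega>" "v \<in> L2_space \<Omega>" "u' \<in> L2_space \<Omega>" "v' \<in> L2_space \<Omega>"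
    and "AE x in M. u x = u' x" "AE x in M. v x = v' x"
  shows "L2_inner \<Omega> u v = L2_inner \<Omega> u' v'"
  unfolding L2_inner_def
proof (rule integral_cong_AE)
  show "AE x in M. u x \<bullet> v x = u' x \<bullet> v' x" using assms(5,6) by eventually_elim simp
qed (use assms(1-4)[THEN L2_measurable] in simp_all)

lemma L2_norm_nonneg [simp]: "0 \<le> L2_norm \<Omega> u"
  by (simp add: L2_norm_def L2_inner_def)

lemma L2_norm_power2: "(L2_norm \<Omega> u)\<^sup>2 = L2_inner \<Omega> u u"
  by (simp add: L2_norm_def L2_inner_def)

lemma L2_cauchy_schwarz:
  assumes "u \<in> L2_space \<Omega>" "v \<in> L2_space \<Omega>"
  shows "\<bar>L2_inner \<Omega> u v\<bar> \<le> L2_norm \<Omega> u * L2_norm \<Omega> v"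
  using psd_on_cauchy_schwarz[OF psd_L2 subspace_L2 assms] by (simp add: L2_norm_def)

lemma L2_triangle:
  assumes "u \<in> L2_space \<Omega>" "v \<in> L2_space \<Omega>"
  shows "L2_norm \<Omega> (u + v) \<le> L2_norm \<Omega> u + L2_norm \<Omega> v"
  using psd_on_triangle[OF psd_L2 subspace_L2 assms] by (simp add: L2_norm_def)

lemma L2_norm_scaleR: "u \<in> L2_space \<Omega> \<Longrightarrow> L2_norm \<Omega> (c *\<^sub>R u) = \<bar>c\<bar> * L2_norm \<Omega> u"
  using psd_on_scaleR[OF psd_L2 subspace_L2] by (simp add: L2_norm_def)

lemma L2_norm_cong:
  assumes "u \<in> L2_space \<Omega>" "u' \<in> L2_space \<Omega>" "AE x in M. u x = u' x"
  shows "L2_norm \<Omega> u = L2_norm \<Omega> u'"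
  unfolding L2_norm_def using L2_inner_cong[OF assms(1,1,2,2,3,3)] by simp

lemma L2_norm_eq_0_iff:
  assumes "u \<in> L2_space \<Omega>"
  shows "L2_norm \<Omega> u = 0 \<longleftrightarrow> (AE x in M. u x = 0)"
  unfolding L2_norm_def using L2_inner_self_eq_0_iff[OF assms] by simp

lemma L2_norm_le_bound:
  fixes f :: "real^'n \<Rightarrow> 'b::euclidean_space" and u :: "real^'n \<Rightarrow> 'c::euclidean_space"
  assumes "u \<in> L2_space \<Omega>" "f \<in> L2_space \<Omega>" "0 \<le> C" "AE x in M. norm (f x) \<le> C * norm (u x)"
  shows "L2_norm \<Omega> f \<le> C * L2_norm \<Omega> u"
proof -
  have "L2_inner \<Omega> f f \<le> (\<integral>x. C\<^sup>2 * (u x \<bullet> u x) \<partial>M)"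
    unfolding L2_inner_def
  proof (rule integral_mono_AE)
    show "AE x in M. f x \<bullet> f x \<le> C\<^sup>2 * (u x \<bullet> u x)"
      using assms(4)
    proof eventually_elim
      case (elim x)
      then have "(norm (f x))\<^sup>2 \<le> (C * norm (u x))\<^sup>2" by (intro power_mono) auto
      then show ?case by (simp add: power_mult_distrib power2_norm_eq_inner)
    qed
  qed (use L2_inner_integrable assms in auto)
  also have "\<dots> = C\<^sup>2 * L2_inner \<Omega> u u" by (simp add: L2_inner_def)
  finally have "sqrt (L2_inner \<Omega> f f) \<le> sqrt (C\<^sup>2 * L2_inner \<Omega> u u)" by (rule real_sqrt_le_mono)
  then show ?thesis using assms(3) by (simp add: L2_norm_def real_sqrt_mult)
qed

lemma L2_bounded_linear:
  fixes T :: "'b::euclidean_space \<Rightarrow> 'c::euclidean_space"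
  assumes "bounded_linear T" "u \<in> L2_space \<Omega>"
  shows "(\<lambda>x. T (u x)) \<in> L2_space \<Omega>"
proof (rule L2_bound[OF assms(2)])
  show "(\<lambda>x. T (u x)) \<in> borel_measurable M"
    by (rule borel_measurable_continuous_on[OF linear_continuous_on[OF assms(1)] L2_measurable[OF assms(2)]])
  show "AE x in M. norm (T (u x)) \<le> onorm T * norm (u x)" using onorm[OF assms(1)] by simp
qed

section \<open>Bounded factors and operators that are linear almost everywhere\<close>

text \<open>Multiplication by an essentially bounded function maps \<open>L2_space\<close> to
  itself, which fails for a general L2 factor. Discrete velocities are essentially bounded, and this
  makes the products in the convective form square integrable.\<close>

definition ess_bounded :: "(real^'n \<Rightarrow> 'b::euclidean_space) \<Rightarrow> bool" where
  "ess_bounded w \<longleftrightarrow> w \<in> borel_measurable M \<and> (\<exists>C. AE x in M. norm (w x) \<le> C)"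

lemma ess_bounded_L2: "ess_bounded w \<Longrightarrow> w \<in> L2_space \<Omega>"
proof -
  assume w: "ess_bounded w"
  then obtain C where "AE x in M. norm (w x) \<le> C" by (auto simp: ess_bounded_def)
  then have "AE x in M. norm (w x) \<le> C * norm (1::real)" by simp
  moreover have "(\<lambda>x. 1::real) \<in> L2_space \<Omega>" by (simp add: L2_space_def)
  moreover have "w \<in> borel_measurable M" using w by (simp add: ess_bounded_def)
  ultimately show ?thesis using L2_bound[of "\<lambda>x. 1::real" w C] by blast
qed

lemma ess_bounded_bounded_linear:
  fixes T :: "'b::euclidean_space \<Rightarrow> 'c::euclidean_space"
  assumes "bounded_linear T" "ess_bounded u"
  shows "ess_bounded (\<lambda>x. T (u x))"
proof -
  obtain C where C: "AE x in M. norm (u x) \<le> C" and m: "u \<in> borel_measurable M"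
    using assms(2) by (auto simp: ess_bounded_def)
  have "AE x in M. norm (T (u x)) \<le> onorm T * C"
    using C
  proof eventually_elim
    case (elim x)
    have "norm (T (u x)) \<le> onorm T * norm (u x)" by (rule onorm[OF assms(1)])
    also have "\<dots> \<le> onorm T * C" using elim onorm_pos_le[OF assms(1)] by (rule mult_left_mono)
    finally show ?case .
  qed
  then show ?thesis
    using borel_measurable_continuous_on[OF linear_continuous_on[OF assms(1)] m]
    by (auto simp: ess_bounded_def)
qed

lemma L2_bilinear:
  fixes B :: "'b::euclidean_space \<Rightarrow> 'c::euclidean_space \<Rightarrow> 'd::euclidean_space"
  assumes B: "bounded_bilinear B" and u: "u \<in> L2_space \<Omega>" and w: "ess_bounded w"
  shows "(\<lambda>x. B (u x) (w x)) \<in> L2_space \<Omega>"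
proof -
  obtain C where C: "AE x in M. norm (w x) \<le> C" and m: "w \<in> borel_measurable M"
    using w by (auto simp: ess_bounded_def)
  obtain K where K: "K > 0" "\<And>a b. norm (B a b) \<le> norm a * norm b * K"
    using bounded_bilinear.pos_bounded[OF B] by auto
  show ?thesis
  proof (rule L2_bound[OF u])
    show "(\<lambda>x. B (u x) (w x)) \<in> borel_measurable M"
      using L2_measurable[OF u] m
      by (rule borel_measurable_continuous_Pair)
         (intro bounded_bilinear.continuous_on[OF B] continuous_intros)
    show "AE x in M. norm (B (u x) (w x)) \<le> (C * K) * norm (u x)"
      using C
    proof eventually_elim
      case (elim x)
      have "norm (B (u x) (w x)) \<le> norm (u x) * norm (w x) * K" by (rule K)
      also have "\<dots> \<le> norm (u x) * C * K" using elim K(1) by (intro mult_right_mono mult_left_mono) auto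
      finally show ?case by (simp add: mult_ac)
    qed
  qed
qed

text \<open>\<open>grad\<close> picks its value by \<open>SOME\<close>, so it is linear only almost everywhere.\<close>

definition op_lin :: "(real^'n \<Rightarrow> 'a::euclidean_space) set \<Rightarrow>
    ((real^'n \<Rightarrow> 'a) \<Rightarrow> real^'n \<Rightarrow> 'b::euclidean_space) \<Rightarrow> bool" where
  "op_lin S A \<longleftrightarrow> (\<forall>u\<in>S. A u \<in> L2_space \<Omega>) \<and>
     (\<forall>u\<in>S. \<forall>v\<in>S. AE x in M. A (u + v) x = A u x + A v x) \<and>
     (\<forall>c. \<forall>u\<in>S. AE x in M. A (c *\<^sub>R u) x = c *\<^sub>R A u x) \<and>
     (\<forall>u\<in>S. (AE x in M. u x = 0) \<longrightarrow> (AE x in M. A u x = 0))"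

lemma op_lin_L2: "op_lin S A \<Longrightarrow> u \<in> S \<Longrightarrow> A u \<in> L2_space \<Omega>"
  and op_lin_add: "op_lin S A \<Longrightarrow> u \<in> S \<Longrightarrow> v \<in> S \<Longrightarrow> AE x in M. A (u + v) x = A u x + A v x"
  and op_lin_scaleR: "op_lin S A \<Longrightarrow> u \<in> S \<Longrightarrow> AE x in M. A (c *\<^sub>R u) x = c *\<^sub>R A u x"
  and op_lin_null: "op_lin S A \<Longrightarrow> u \<in> S \<Longrightarrow> AE x in M. u x = 0 \<Longrightarrow> AE x in M. A u x = 0"
  by (auto simp: op_lin_def)

lemma op_lin_subset: "op_lin S A \<Longrightarrow> S' \<subseteq> S \<Longrightarrow> op_lin S' A"
  unfolding op_lin_def by (meson subsetD)

lemma op_lin_id: "S \<subseteq> L2_space \<Omega> \<Longrightarrow> op_lin S (\<lambda>u. u)"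
  by (auto simp: op_lin_def)

text \<open>The integral does not see null sets, so linearity of \<open>A\<close> almost everywhere
  becomes genuine linearity of the functional.\<close>

lemma op_lin_inner:
  assumes "op_lin S A" "subspace S" "g \<in> L2_space \<Omega>"
  shows "lin_on S (\<lambda>u. L2_inner \<Omega> g (A u))"
proof (rule lin_onI)
  note lg = psd_on_lin[OF psd_L2 assms(3)]
  fix u v assume uv: "u \<in> S" "v \<in> S"
  have "L2_inner \<Omega> g (A (u + v)) = L2_inner \<Omega> g (A u + A v)"
    using op_lin_add[OF assms(1) uv] op_lin_L2[OF assms(1)] uv assms subspace_add[OF assms(2)]
    by (intro L2_inner_cong) (auto intro: subspace_add[OF subspace_L2])
  also have "\<dots> = L2_inner \<Omega> g (A u) + L2_inner \<Omega> g (A v)"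
    using op_lin_L2[OF assms(1)] uv by (intro lin_on_add[OF lg]) auto
  finally show "L2_inner \<Omega> g (A (u + v)) = L2_inner \<Omega> g (A u) + L2_inner \<Omega> g (A v)" .
next
  note lg = psd_on_lin[OF psd_L2 assms(3)]
  fix c u assume u: "u \<in> S"
  have "L2_inner \<Omega> g (A (c *\<^sub>R u)) = L2_inner \<Omega> g (c *\<^sub>R A u)"
    using op_lin_scaleR[OF assms(1) u] op_lin_L2[OF assms(1)] u assms subspace_scale[OF assms(2)]
    by (intro L2_inner_cong) (auto intro: subspace_scale[OF subspace_L2])
  also have "\<dots> = c * L2_inner \<Omega> g (A u)"
    using op_lin_L2[OF assms(1) u] by (intro lin_on_scaleR[OF lg]) auto
  finally show "L2_inner \<Omega> g (A (c *\<^sub>R u)) = c * L2_inner \<Omega> g (A u)" .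
qed

lemma op_lin_inner_left:
  assumes "op_lin S A" "subspace S" "g \<in> L2_space \<Omega>"
  shows "lin_on S (\<lambda>u. L2_inner \<Omega> (A u) g)"
  using op_lin_inner[OF assms] by (simp add: L2_inner_commute)

lemma op_lin_inner_null:
  assumes "op_lin S A" "u \<in> S" "AE x in M. u x = 0"
  shows "L2_inner \<Omega> (A u) g = 0" "L2_inner \<Omega> g (A u) = 0"
proof -
  have "AE x in M. A u x \<bullet> g x = 0" using op_lin_null[OF assms] by eventually_elim simp
  then show "L2_inner \<Omega> (A u) g = 0" unfolding L2_inner_def by (rule integral_eq_zero_AE)
  then show "L2_inner \<Omega> g (A u) = 0" by (simp add: L2_inner_commute)
qed

lemma op_lin_diff:
  assumes "op_lin S A" "subspace S" "u \<in> S" "v \<in> S"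
  shows "AE x in M. A (u - v) x = A u x - A v x"
proof -
  have "AE x in M. A (u + (-1) *\<^sub>R v) x = A u x + A ((-1) *\<^sub>R v) x"
    by (rule op_lin_add[OF assms(1,3) subspace_scale[OF assms(2,4)]])
  moreover have "AE x in M. A ((-1) *\<^sub>R v) x = (-1) *\<^sub>R A v x"
    by (rule op_lin_scaleR[OF assms(1,4)])
  ultimately show ?thesis by eventually_elim simp
qed

lemma op_lin_psd:
  assumes "op_lin S A" "subspace S"
  shows "psd_on S (\<lambda>u v. L2_inner \<Omega> (A u) (A v))"
  unfolding psd_on_def
  using op_lin_inner[OF assms op_lin_L2[OF assms(1)]] psd_on_nonneg[OF psd_L2 op_lin_L2[OF assms(1)]]
  by (auto simp: L2_inner_commute)

lemma op_lin_comp: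
  fixes T :: "'b::euclidean_space \<Rightarrow> 'c::euclidean_space"
  assumes "op_lin S A" "bounded_linear T"
  shows "op_lin S (\<lambda>u x. T (A u x))"
  unfolding op_lin_def
proof (intro conjI ballI allI impI)
  interpret T: bounded_linear T by fact
  show "(\<lambda>x. T (A u x)) \<in> L2_space \<Omega>" if "u \<in> S" for u
    using op_lin_L2[OF assms(1) that] by (rule L2_bounded_linear[OF assms(2)])
  show "AE x in M. T (A (u + v) x) = T (A u x) + T (A v x)" if "u \<in> S" "v \<in> S" for u v
    using op_lin_add[OF assms(1) that] by eventually_elim (simp add: T.add)
  show "AE x in M. T (A (c *\<^sub>R u) x) = c *\<^sub>R T (A u x)" if "u \<in> S" for c u
    using op_lin_scaleR[OF assms(1) that, of c] by eventually_elim (simp add: T.scaleR)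
  show "AE x in M. T (A u x) = 0" if "u \<in> S" "AE x in M. u x = 0" for u
    using op_lin_null[OF assms(1) that] by eventually_elim (simp add: T.zero)
qed

lemma op_lin_bilinear:
  fixes B :: "'b::euclidean_space \<Rightarrow> 'c::euclidean_space \<Rightarrow> 'd::euclidean_space"
  assumes "op_lin S A" "bounded_bilinear B" "ess_bounded w"
  shows "op_lin S (\<lambda>u x. B (A u x) (w x))"
  unfolding op_lin_def
proof (intro conjI ballI allI impI)
  interpret B: bounded_bilinear B by fact
  show "(\<lambda>x. B (A u x) (w x)) \<in> L2_space \<Omega>" if "u \<in> S" for u
    using op_lin_L2[OF assms(1) that] assms(3) by (rule L2_bilinear[OF assms(2)])
  show "AE x in M. B (A (u + v) x) (w x) = B (A u x) (w x) + B (A v x) (w x)" if "u \<in> S" "v \<in> S" for u v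
    using op_lin_add[OF assms(1) that] by eventually_elim (simp add: B.add_left)
  show "AE x in M. B (A (c *\<^sub>R u) x) (w x) = c *\<^sub>R B (A u x) (w x)" if "u \<in> S" for c u
    using op_lin_scaleR[OF assms(1) that, of c] by eventually_elim (simp add: B.scaleR_left)
  show "AE x in M. B (A u x) (w x) = 0" if "u \<in> S" "AE x in M. u x = 0" for u
    using op_lin_null[OF assms(1) that] by eventually_elim (simp add: B.zero_left)
qed

lemma op_lin_bilinear_right:
  fixes B :: "'c::euclidean_space \<Rightarrow> 'b::euclidean_space \<Rightarrow> 'd::euclidean_space"
  assumes "\<And>v. v \<in> S \<Longrightarrow> ess_bounded v" "bounded_bilinear B" "g \<in> L2_space \<Omega>"
  shows "op_lin S (\<lambda>v x. B (g x) (v x))"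
  unfolding op_lin_def
proof (intro conjI ballI allI impI)
  interpret B: bounded_bilinear B by fact
  show "(\<lambda>x. B (g x) (v x)) \<in> L2_space \<Omega>" if "v \<in> S" for v
    using assms(3) assms(1)[OF that] by (rule L2_bilinear[OF assms(2)])
  show "AE x in M. B (g x) (v x) = 0" if "AE x in M. v x = 0" for v
    using that by eventually_elim (simp add: B.zero_right)
qed (simp_all add: bounded_bilinear.add_right[OF assms(2)] bounded_bilinear.scaleR_right[OF assms(2)])

section \<open>L2-valued functions of time\<close>

lemma L2_inner_diff_left:
  "u \<in> L2_space \<Omega> \<Longrightarrow> v \<in> L2_space \<Omega> \<Longrightarrow> w \<in> L2_space \<Omega> \<Longrightarrow>
    L2_inner \<Omega> (u - v) w = L2_inner \<Omega> u w - L2_inner \<Omega> v w"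
  by (rule lin_on_diff[OF psd_on_lin_left[OF psd_L2 subspace_L2] subspace_L2])

lemma L2_norm_sum_le:
  assumes "\<And>i. i \<in> I \<Longrightarrow> b i \<in> L2_space \<Omega>"
  shows "L2_norm \<Omega> (\<Sum>i\<in>I. c i *\<^sub>R b i) \<le> (\<Sum>i\<in>I. \<bar>c i\<bar> * L2_norm \<Omega> (b i))"
  using assms
proof (induction I rule: infinite_finite_induct)
  case (insert j I)
  have "L2_norm \<Omega> (c j *\<^sub>R b j + (\<Sum>i\<in>I. c i *\<^sub>R b i)) \<le> L2_norm \<Omega> (c j *\<^sub>R b j) + L2_norm \<Omega> (\<Sum>i\<in>I. c i *\<^sub>R b i)"
    using insert by (intro L2_triangle subspace_sum[OF subspace_L2] subspace_scale[OF subspace_L2]) auto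
  moreover have "L2_norm \<Omega> (c j *\<^sub>R b j) = \<bar>c j\<bar> * L2_norm \<Omega> (b j)"
    using insert by (intro L2_norm_scaleR) auto
  moreover have "L2_norm \<Omega> (\<Sum>i\<in>I. c i *\<^sub>R b i) \<le> (\<Sum>i\<in>I. \<bar>c i\<bar> * L2_norm \<Omega> (b i))"
    using insert by blast
  ultimately show ?case unfolding sum.insert[OF insert.hyps] by linarith
qed (simp_all add: L2_norm_def L2_inner_def)

text \<open>Reduces continuity and differentiability of a curve in the span of fixed functions to
  that of its real coordinates.\<close>

lemma L2_norm_sum_tendsto_0:
  assumes "\<And>i. i \<in> I \<Longrightarrow> b i \<in> L2_space \<Omega>" "\<And>i. i \<in> I \<Longrightarrow> (c i \<longlongrightarrow> 0) F"
  shows "((\<lambda>s. L2_norm \<Omega> (\<Sum>i\<in>I. c i s *\<^sub>R b i)) \<longlongrightarrow> 0) F"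
proof (rule Lim_null_comparison)
  show "\<forall>\<^sub>F s in F. norm (L2_norm \<Omega> (\<Sum>i\<in>I. c i s *\<^sub>R b i)) \<le> (\<Sum>i\<in>I. \<bar>c i s\<bar> * L2_norm \<Omega> (b i))"
    using L2_norm_sum_le[of I b, OF assms(1)] by simp
  have "((\<lambda>s. \<Sum>i\<in>I. \<bar>c i s\<bar> * L2_norm \<Omega> (b i)) \<longlongrightarrow> (\<Sum>i\<in>I. \<bar>0\<bar> * L2_norm \<Omega> (b i))) F"
    by (intro tendsto_intros assms(2))
  then show "((\<lambda>s. \<Sum>i\<in>I. \<bar>c i s\<bar> * L2_norm \<Omega> (b i)) \<longlongrightarrow> 0) F" by simp
qed

lemma has_L2_derivative_iff:
  "has_L2_derivative \<Omega> u u' t S \<longleftrightarrow>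
    ((\<lambda>s. L2_norm \<Omega> (inverse (s - t) *\<^sub>R (u s - u t) - u')) \<longlongrightarrow> 0) (at t within S)"
proof -
  have "(\<lambda>x. (u s x - u t x) /\<^sub>R (s - t) - u' x) = inverse (s - t) *\<^sub>R (u s - u t) - u'" for s
    by (simp add: fun_eq_iff)
  then show ?thesis by (simp add: has_L2_derivative_def)
qed

lemma L2_continuous_on_iff:
  "L2_continuous_on \<Omega> S u \<longleftrightarrow> (\<forall>t\<in>S. ((\<lambda>s. L2_norm \<Omega> (u s - u t)) \<longlongrightarrow> 0) (at t within S))"
  by (simp add: L2_continuous_on_def fun_diff_def)

lemma L2_continuous_inner:
  assumes "L2_continuous_on \<Omega> S u" "\<And>s. s \<in> S \<Longrightarrow> u s \<in> L2_space \<Omega>" "v \<in> L2_space \<Omega>"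
  shows "continuous_on S (\<lambda>s. L2_inner \<Omega> (u s) v)"
  unfolding continuous_on_def
proof
  fix t assume t: "t \<in> S"
  have "((\<lambda>s. L2_inner \<Omega> (u s) v - L2_inner \<Omega> (u t) v) \<longlongrightarrow> 0) (at t within S)"
  proof (rule Lim_null_comparison)
    have "norm (L2_inner \<Omega> (u s) v - L2_inner \<Omega> (u t) v) \<le> L2_norm \<Omega> (u s - u t) * L2_norm \<Omega> v" if "s \<in> S" for s
      using L2_cauchy_schwarz[OF subspace_diff[OF subspace_L2 assms(2)[OF that] assms(2)[OF t]] assms(3)]
      by (simp add: L2_inner_diff_left assms(2)[OF that] assms(2)[OF t] assms(3))
    then show "\<forall>\<^sub>F s in at t within S. norm (L2_inner \<Omega> (u s) v - L2_inner \<Omega> (u t) v) \<le> L2_norm \<Omega> (u s - u t) * L2_norm \<Omega> v"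
      by (auto simp: eventually_at_filter)
    show "((\<lambda>s. L2_norm \<Omega> (u s - u t) * L2_norm \<Omega> v) \<longlongrightarrow> 0) (at t within S)"
      using assms(1) t by (intro tendsto_mult_left_zero) (simp add: L2_continuous_on_iff)
  qed
  then show "((\<lambda>s. L2_inner \<Omega> (u s) v) \<longlongrightarrow> L2_inner \<Omega> (u t) v) (at t within S)" by (rule LIM_zero_cancel)
qed

text \<open>Supplies the bound on the reference filtered velocity that enters the Gronwall rate of
  the stability estimate.\<close>

lemma L2_continuous_norm_bounded:
  assumes "L2_continuous_on \<Omega> S u" "\<And>s. s \<in> S \<Longrightarrow> u s \<in> L2_space \<Omega>" "compact S"
  obtains W where "0 \<le> W" "\<And>s. s \<in> S \<Longrightarrow> L2_norm \<Omega> (u s) \<le> W"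
proof -
  have "continuous_on S (\<lambda>s. L2_norm \<Omega> (u s))"
    unfolding continuous_on_def
  proof
    fix t assume t: "t \<in> S"
    have "((\<lambda>s. L2_norm \<Omega> (u s) - L2_norm \<Omega> (u t)) \<longlongrightarrow> 0) (at t within S)"
    proof (rule Lim_null_comparison)
      have "norm (L2_norm \<Omega> (u s) - L2_norm \<Omega> (u t)) \<le> L2_norm \<Omega> (u s - u t)" if s: "s \<in> S" for s
      proof -
        note d = subspace_diff[OF subspace_L2 assms(2)[OF s] assms(2)[OF t]]
        have "L2_norm \<Omega> (u s) \<le> L2_norm \<Omega> (u s - u t) + L2_norm \<Omega> (u t)"
          using L2_triangle[OF d assms(2)[OF t]] by simp
        moreover have "L2_norm \<Omega> (u t) \<le> L2_norm \<Omega> (u s - u t) + L2_norm \<Omega> (u s)"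
          using L2_triangle[OF subspace_scale[OF subspace_L2 d, of "-1"] assms(2)[OF s]] L2_norm_scaleR[OF d, of "-1"]
          by simp
        ultimately show ?thesis by (simp add: abs_le_iff)
      qed
      then show "\<forall>\<^sub>F s in at t within S. norm (L2_norm \<Omega> (u s) - L2_norm \<Omega> (u t)) \<le> L2_norm \<Omega> (u s - u t)"
        by (auto simp: eventually_at_filter)
      show "((\<lambda>s. L2_norm \<Omega> (u s - u t)) \<longlongrightarrow> 0) (at t within S)"
        using assms(1) t by (simp add: L2_continuous_on_iff)
    qed
    then show "((\<lambda>s. L2_norm \<Omega> (u s)) \<longlongrightarrow> L2_norm \<Omega> (u t)) (at t within S)" by (rule LIM_zero_cancel)
  qed
  then have "bounded ((\<lambda>s. L2_norm \<Omega> (u s)) ` S)"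
    by (intro compact_imp_bounded compact_continuous_image assms(3))
  then obtain W where "W > 0" "\<And>s. s \<in> S \<Longrightarrow> L2_norm \<Omega> (u s) \<le> W" by (force simp: bounded_pos)
  then show ?thesis using that[of W] by auto
qed

text \<open>By Cauchy-Schwarz the error of the scalar difference quotient is at most the L2 error
  times the norm of \<open>v\<close>.\<close>

lemma L2_derivative_inner:
  assumes "has_L2_derivative \<Omega> u u' t S" "\<And>s. s \<in> S \<Longrightarrow> u s \<in> L2_space \<Omega>" "t \<in> S"
    and "u' \<in> L2_space \<Omega>" "v \<in> L2_space \<Omega>"
  shows "((\<lambda>s. L2_inner \<Omega> (u s) v) has_real_derivative L2_inner \<Omega> u' v) (at t within S)"
  unfolding has_field_derivative_iff
proof (rule LIM_zero_cancel, rule Lim_null_comparison)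
  let ?q = "\<lambda>s. inverse (s - t) *\<^sub>R (u s - u t)"
  have "norm ((L2_inner \<Omega> (u s) v - L2_inner \<Omega> (u t) v) / (s - t) - L2_inner \<Omega> u' v)
      \<le> L2_norm \<Omega> (?q s - u') * L2_norm \<Omega> v" if s: "s \<in> S" for s
  proof -
    have d: "u s - u t \<in> L2_space \<Omega>" by (rule subspace_diff[OF subspace_L2 assms(2)[OF s] assms(2)[OF assms(3)]])
    have q: "?q s \<in> L2_space \<Omega>" by (rule subspace_scale[OF subspace_L2 d])
    have "L2_inner \<Omega> (?q s) v = inverse (s - t) * L2_inner \<Omega> (u s - u t) v"
      by (rule lin_on_scaleR[OF psd_on_lin_left[OF psd_L2 subspace_L2 assms(5)] d])
    then have "L2_inner \<Omega> (?q s) v = (L2_inner \<Omega> (u s) v - L2_inner \<Omega> (u t) v) / (s - t)"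
      by (simp add: L2_inner_diff_left[OF assms(2)[OF s] assms(2)[OF assms(3)] assms(5)] divide_inverse mult.commute)
    then show ?thesis
      using L2_cauchy_schwarz[OF subspace_diff[OF subspace_L2 q assms(4)] assms(5)]
      by (simp add: L2_inner_diff_left[OF q assms(4,5)])
  qed
  then show "\<forall>\<^sub>F s in at t within S. norm ((L2_inner \<Omega> (u s) v - L2_inner \<Omega> (u t) v) / (s - t) - L2_inner \<Omega> u' v)
      \<le> L2_norm \<Omega> (?q s - u') * L2_norm \<Omega> v"
    by (auto simp: eventually_at_filter)
  show "((\<lambda>s. L2_norm \<Omega> (?q s - u') * L2_norm \<Omega> v) \<longlongrightarrow> 0) (at t within S)"
    using assms(1) unfolding has_L2_derivative_iff by (rule tendsto_mult_left_zero)
qed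

section \<open>Weak gradients\<close>

lemma compact_support_ess_bounded:
  fixes f :: "real^'n \<Rightarrow> 'b::euclidean_space"
  assumes "continuous_on UNIV f" "compact K" "\<And>x. x \<notin> K \<Longrightarrow> f x = 0"
  shows "ess_bounded f"
proof -
  obtain C where "\<And>x. norm (f x) \<le> C" using bounded_of_compact_support[OF assms] by metis
  then show ?thesis
    unfolding ess_bounded_def
    using measurable_M[OF borel_measurable_continuous_onI[OF assms(1)]] by auto
qed

lemma test_ess_bounded:
  fixes \<phi> :: "real^'n \<Rightarrow> 'b::euclidean_space"
  assumes "\<phi> \<in> C1_compact_support \<Omega>"
  shows "ess_bounded \<phi>" "ess_bounded (\<lambda>x. frechet_derivative \<phi> (at x) h)"
proof -
  obtain K where K: "C1 \<phi>" "compact K" "\<And>x. x \<notin> K \<Longrightarrow> \<phi> x = 0"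
    using assms by (auto simp: C1_compact_support_iff)
  show "ess_bounded \<phi>"
    by (rule compact_support_ess_bounded[OF C1_continuous[OF K(1)] K(2,3)])
  show "ess_bounded (\<lambda>x. frechet_derivative \<phi> (at x) h)"
    by (rule compact_support_ess_bounded[OF C1_continuous_derivative[OF K(1)] K(2)
        frechet_derivative_eq_0_outside[OF compact_imp_closed[OF K(2)] K(3)]])
qed

lemmas test_L2 = test_ess_bounded[THEN ess_bounded_L2]

lemma has_weak_gradient_iff:
  "has_weak_gradient \<Omega> v G \<longleftrightarrow> (\<forall>\<phi>\<in>C1_compact_support \<Omega>. \<forall>i j.
     L2_inner \<Omega> (\<lambda>x. v x $ i) (\<lambda>x. frechet_derivative \<phi> (at x) (axis j 1)) =
       - L2_inner \<Omega> (\<lambda>x. G x $ i $ j) \<phi>)"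
  by (simp add: has_weak_gradient_def L2_inner_def)

lemma bounded_linear_entry: "bounded_linear (\<lambda>A::real^'n^'n. A $ i $ j)"
  using bounded_linear_compose[OF bounded_linear_vec_nth bounded_linear_vec_nth] .

text \<open>Entry by entry, the difference of two weak gradients is orthogonal to every test
  function.\<close>

lemma weak_gradient_unique:
  assumes "G \<in> L2_space \<Omega>" "H \<in> L2_space \<Omega>" "has_weak_gradient \<Omega> v G" "has_weak_gradient \<Omega> v H"
  shows "AE x in M. G x = H x"
proof -
  have "AE x in M. G x $ i $ j - H x $ i $ j = 0" for i j
  proof (rule fundamental_lemma)
    have GH: "(\<lambda>x. G x $ i $ j) \<in> L2_space \<Omega>" "(\<lambda>x. H x $ i $ j) \<in> L2_space \<Omega>"
      using L2_bounded_linear[OF bounded_linear_entry] assms(1,2) by auto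
    \<comment> \<open>Integrability of an L2 function is obtained from its product with 1, which is
      square integrable on a set of finite measure.\<close>
    have one: "(\<lambda>x. 1::real) \<in> L2_space \<Omega>" by (simp add: L2_space_def)
    show "integrable M (\<lambda>x. G x $ i $ j - H x $ i $ j)"
      using L2_inner_integrable[OF GH(1) one] L2_inner_integrable[OF GH(2) one] by simp
    fix \<phi> :: "real^'n \<Rightarrow> real" assume \<phi>: "\<phi> \<in> C1_compact_support \<Omega>"
    have "(\<integral>x. (G x $ i $ j - H x $ i $ j) * \<phi> x \<partial>M) =
        L2_inner \<Omega> (\<lambda>x. G x $ i $ j) \<phi> - L2_inner \<Omega> (\<lambda>x. H x $ i $ j) \<phi>"
      using L2_inner_integrable[OF GH(1) test_L2(1)[OF \<phi>]] L2_inner_integrable[OF GH(2) test_L2(1)[OF \<phi>]]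
      by (simp add: L2_inner_def left_diff_distrib)
    also have "\<dots> = 0" using assms(3,4) \<phi> unfolding has_weak_gradient_iff by (metis diff_self neg_equal_iff_equal)
    finally show "(\<integral>x. (G x $ i $ j - H x $ i $ j) * \<phi> x \<partial>M) = 0" .
  qed
  then have "AE x in M. \<forall>i j. G x $ i $ j - H x $ i $ j = 0"
    by (simp add: AE_all_countable)
  then show ?thesis by eventually_elim (simp add: vec_eq_iff)
qed

lemma H1_L2: "v \<in> H1_space \<Omega> \<Longrightarrow> v \<in> L2_space \<Omega>"
  by (simp add: H1_space_def)

lemma H1_I: "v \<in> L2_space \<Omega> \<Longrightarrow> G \<in> L2_space \<Omega> \<Longrightarrow> has_weak_gradient \<Omega> v G \<Longrightarrow> v \<in> H1_space \<Omega>"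
  by (auto simp: H1_space_def)

lemma grad_works:
  assumes "v \<in> H1_space \<Omega>"
  shows "grad \<Omega> v \<in> L2_space \<Omega>" "has_weak_gradient \<Omega> v (grad \<Omega> v)"
proof -
  have "\<exists>G. G \<in> L2_space \<Omega> \<and> has_weak_gradient \<Omega> v G"
    using assms unfolding H1_space_def by blast
  from someI_ex[OF this] show "grad \<Omega> v \<in> L2_space \<Omega>" "has_weak_gradient \<Omega> v (grad \<Omega> v)"
    by (auto simp: grad_def)
qed

lemma grad_eq:
  assumes "v \<in> L2_space \<Omega>" "G \<in> L2_space \<Omega>" "has_weak_gradient \<Omega> v G"
  shows "AE x in M. grad \<Omega> v x = G x"
  using weak_gradient_unique[OF grad_works(1) _ grad_works(2)] H1_I[OF assms] assms by blast

lemma has_weak_gradient_add: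
  assumes "u \<in> L2_space \<Omega>" "v \<in> L2_space \<Omega>" "G \<in> L2_space \<Omega>" "H \<in> L2_space \<Omega>"
    and "has_weak_gradient \<Omega> u G" "has_weak_gradient \<Omega> v H"
  shows "has_weak_gradient \<Omega> (u + v) (G + H)"
  unfolding has_weak_gradient_iff
proof (intro ballI allI)
  fix \<phi> :: "real^'n \<Rightarrow> real" and i j assume \<phi>: "\<phi> \<in> C1_compact_support \<Omega>"
  note l = lin_on_add[OF op_lin_inner_left[OF op_lin_comp[OF op_lin_id[OF subset_refl]] subspace_L2]]
  show "L2_inner \<Omega> (\<lambda>x. (u + v) x $ i) (\<lambda>x. frechet_derivative \<phi> (at x) (axis j 1)) =
       - L2_inner \<Omega> (\<lambda>x. (G + H) x $ i $ j) \<phi>"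
    using l[OF bounded_linear_vec_nth test_L2(2)[OF \<phi>] assms(1,2), of i "axis j 1"]
      l[OF bounded_linear_entry test_L2(1)[OF \<phi>] assms(3,4), of i j] assms(5,6) \<phi>
    unfolding has_weak_gradient_iff by simp
qed

lemma has_weak_gradient_scaleR:
  assumes "u \<in> L2_space \<Omega>" "G \<in> L2_space \<Omega>" "has_weak_gradient \<Omega> u G"
  shows "has_weak_gradient \<Omega> (c *\<^sub>R u) (c *\<^sub>R G)"
  using assms(3) unfolding has_weak_gradient_iff L2_inner_def by (simp add: mult.assoc)

lemma has_weak_gradient_null:
  assumes "u \<in> L2_space \<Omega>" "AE x in M. u x = 0"
  shows "has_weak_gradient \<Omega> u 0"
  unfolding has_weak_gradient_iff
proof (intro ballI allI)
  fix \<phi> :: "real^'n \<Rightarrow> real" and i j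
  have "L2_inner \<Omega> (\<lambda>x. u x $ i) (\<lambda>x. frechet_derivative \<phi> (at x) (axis j 1)) = 0"
    unfolding L2_inner_def by (rule integral_eq_zero_AE) (use assms(2) in \<open>eventually_elim, simp\<close>)
  then show "L2_inner \<Omega> (\<lambda>x. u x $ i) (\<lambda>x. frechet_derivative \<phi> (at x) (axis j 1)) =
       - L2_inner \<Omega> (\<lambda>x. (0 :: _ \<Rightarrow> real^'n^'n) x $ i $ j) \<phi>"
    by (simp add: L2_inner_def)
qed

section \<open>The space H1\<close>

lemma subspace_H1: "subspace (H1_space \<Omega>)"
proof (rule subspaceI)
  show "0 \<in> H1_space \<Omega>"
    by (rule H1_I[of 0 0]) (auto intro: subspace_0[OF subspace_L2] has_weak_gradient_null)
  show "u + v \<in> H1_space \<Omega>" if "u \<in> H1_space \<Omega>" "v \<in> H1_space \<Omega>" for u v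
    using H1_L2[OF that(1)] H1_L2[OF that(2)] grad_works[OF that(1)] grad_works[OF that(2)]
    by (intro H1_I[of _ "grad \<Omega> u + grad \<Omega> v"] has_weak_gradient_add)
       (auto intro: subspace_add[OF subspace_L2])
  show "c *\<^sub>R u \<in> H1_space \<Omega>" if "u \<in> H1_space \<Omega>" for c u
    using H1_L2[OF that] grad_works[OF that]
    by (intro H1_I[of _ "c *\<^sub>R grad \<Omega> u"] has_weak_gradient_scaleR)
       (auto intro: subspace_scale[OF subspace_L2])
qed

lemma op_lin_grad: "op_lin (H1_space \<Omega>) (grad \<Omega>)"
  unfolding op_lin_def
proof (intro conjI ballI allI impI)
  show "grad \<Omega> u \<in> L2_space \<Omega>" if "u \<in> H1_space \<Omega>" for u using grad_works(1)[OF that] .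
  show "AE x in M. grad \<Omega> (u + v) x = grad \<Omega> u x + grad \<Omega> v x" if "u \<in> H1_space \<Omega>" "v \<in> H1_space \<Omega>" for u v
    using grad_eq[OF _ _ has_weak_gradient_add[OF H1_L2[OF that(1)] H1_L2[OF that(2)]
        grad_works(1)[OF that(1)] grad_works(1)[OF that(2)] grad_works(2)[OF that(1)] grad_works(2)[OF that(2)]]]
      H1_L2[OF that(1)] H1_L2[OF that(2)] grad_works(1)[OF that(1)] grad_works(1)[OF that(2)]
    by (simp add: subspace_add[OF subspace_L2])
  show "AE x in M. grad \<Omega> (c *\<^sub>R u) x = c *\<^sub>R grad \<Omega> u x" if "u \<in> H1_space \<Omega>" for c u
    using grad_eq[OF _ _ has_weak_gradient_scaleR[OF H1_L2[OF that] grad_works[OF that], of c]]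
      H1_L2[OF that] grad_works(1)[OF that]
    by (simp add: subspace_scale[OF subspace_L2])
  show "AE x in M. grad \<Omega> u x = 0" if "u \<in> H1_space \<Omega>" "AE x in M. u x = 0" for u
    using grad_eq[OF H1_L2[OF that(1)] subspace_0[OF subspace_L2] has_weak_gradient_null[OF H1_L2[OF that(1)] that(2)]]
    by simp
qed

lemma op_lin_div: "op_lin (H1_space \<Omega>) (div_field \<Omega>)"
  using op_lin_comp[OF op_lin_grad bounded_linear_trace] by (simp add: div_field_def[abs_def])

lemma op_lin_sym_grad: "op_lin (H1_space \<Omega>) (sym_grad \<Omega>)"
  using op_lin_comp[OF op_lin_grad bounded_linear_sym_part]
  by (simp add: sym_grad_def[abs_def] sym_part_def[abs_def])

definition H1_inner :: "(real^'n \<Rightarrow> real^'n) \<Rightarrow> (real^'n \<Rightarrow> real^'n) \<Rightarrow> real" where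
  "H1_inner u v = L2_inner \<Omega> u v + L2_inner \<Omega> (grad \<Omega> u) (grad \<Omega> v)"

lemma H1_norm_eq: "H1_norm \<Omega> u = sqrt (H1_inner u u)"
  by (simp add: H1_norm_def H1_inner_def L2_norm_power2)

lemma psd_H1: "psd_on (H1_space \<Omega>) H1_inner"
  unfolding H1_inner_def[abs_def]
  by (intro psd_on_add op_lin_psd[OF op_lin_grad subspace_H1] psd_on_subset[OF psd_L2]) (auto intro: H1_L2)

lemma H1_triangle:
  "u \<in> H1_space \<Omega> \<Longrightarrow> v \<in> H1_space \<Omega> \<Longrightarrow> H1_norm \<Omega> (u + v) \<le> H1_norm \<Omega> u + H1_norm \<Omega> v"
  unfolding H1_norm_eq by (rule psd_on_triangle[OF psd_H1 subspace_H1])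

lemma H1_norm_scaleR: "u \<in> H1_space \<Omega> \<Longrightarrow> H1_norm \<Omega> (c *\<^sub>R u) = \<bar>c\<bar> * H1_norm \<Omega> u"
  unfolding H1_norm_eq by (rule psd_on_scaleR[OF psd_H1 subspace_H1])

lemma H1_norm_nonneg [simp]: "0 \<le> H1_norm \<Omega> u"
  by (simp add: H1_norm_def)

lemma L2_norm_le_H1_norm: "L2_norm \<Omega> u \<le> H1_norm \<Omega> u" "L2_norm \<Omega> (grad \<Omega> u) \<le> H1_norm \<Omega> u"
  unfolding H1_norm_def by (auto intro!: real_le_rsqrt)

lemma H1_norm_cong:
  assumes "u \<in> H1_space \<Omega>" "v \<in> H1_space \<Omega>" "AE x in M. u x = v x"
  shows "H1_norm \<Omega> u = H1_norm \<Omega> v"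
proof -
  have uv: "u - v \<in> H1_space \<Omega>" by (rule subspace_diff[OF subspace_H1 assms(1,2)])
  have "AE x in M. (u - v) x = 0" using assms(3) by eventually_elim simp
  then have "AE x in M. grad \<Omega> (u - v) x = 0" by (rule op_lin_null[OF op_lin_grad uv])
  then have "AE x in M. grad \<Omega> u x = grad \<Omega> v x"
    using op_lin_diff[OF op_lin_grad subspace_H1 assms(1,2)] by eventually_elim simp
  then show ?thesis
    unfolding H1_norm_def
    using L2_norm_cong[OF H1_L2[OF assms(1)] H1_L2[OF assms(2)] assms(3)]
      L2_norm_cong[OF grad_works(1)[OF assms(1)] grad_works(1)[OF assms(2)]] by simp
qed

section \<open>Test functions and the boundary condition\<close>

lemma test_mult:
  fixes \<phi> \<psi> :: "real^'n \<Rightarrow> real"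
  assumes "\<phi> \<in> C1_compact_support \<Omega>" "C1 \<psi>"
  shows "(\<lambda>x. \<psi> x * \<phi> x) \<in> C1_compact_support \<Omega>"
  using assms C1_mult[of \<psi> \<phi>] unfolding C1_compact_support_iff by (metis mult_zero_right)

lemma test_component:
  fixes \<phi> :: "real^'n \<Rightarrow> real^'n"
  assumes "\<phi> \<in> C1_compact_support \<Omega>"
  shows "(\<lambda>x. \<phi> x $ i) \<in> C1_compact_support \<Omega>"
    and "frechet_derivative (\<lambda>x. \<phi> x $ i) (at x) h = frechet_derivative \<phi> (at x) h $ i"
proof -
  obtain K where K: "C1 \<phi>" "compact K" "K \<subseteq> \<Omega>" "\<And>x. x \<notin> K \<Longrightarrow> \<phi> x = 0"
    using assms by (auto simp: C1_compact_support_iff)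
  show "(\<lambda>x. \<phi> x $ i) \<in> C1_compact_support \<Omega>"
    unfolding C1_compact_support_iff
    using C1_bounded_linear_compose(1)[OF bounded_linear_vec_nth K(1), of i] K by auto
  show "frechet_derivative (\<lambda>x. \<phi> x $ i) (at x) h = frechet_derivative \<phi> (at x) h $ i"
    by (rule C1_bounded_linear_compose(2)[OF bounded_linear_vec_nth K(1)])
qed

lemma subspace_test: "subspace (C1_compact_support \<Omega> :: (real^'n \<Rightarrow> 'b::euclidean_space) set)"
proof (rule subspaceI)
  show "0 \<in> C1_compact_support \<Omega>"
    unfolding C1_compact_support_iff zero_fun_def by (auto intro!: C1_const exI[of _ "{}"])
  show "u + v \<in> C1_compact_support \<Omega>"
    if uv: "u \<in> C1_compact_support \<Omega>" "v \<in> C1_compact_support \<Omega>" for u v :: "real^'n \<Rightarrow> 'b"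
  proof -
    obtain K where K: "C1 u" "compact K" "K \<subseteq> \<Omega>" "\<And>x. x \<notin> K \<Longrightarrow> u x = 0"
      using uv(1) by (auto simp: C1_compact_support_iff)
    obtain L where L: "C1 v" "compact L" "L \<subseteq> \<Omega>" "\<And>x. x \<notin> L \<Longrightarrow> v x = 0"
      using uv(2) by (auto simp: C1_compact_support_iff)
    show ?thesis
      unfolding C1_compact_support_iff plus_fun_def
      using C1_add[OF K(1) L(1)] K L by (intro conjI exI[of _ "K \<union> L"]) auto
  qed
  show "c *\<^sub>R u \<in> C1_compact_support \<Omega>"
    if u: "u \<in> C1_compact_support \<Omega>" for c and u :: "real^'n \<Rightarrow> 'b"
  proof -
    obtain K where K: "C1 u" "compact K" "K \<subseteq> \<Omega>" "\<And>x. x \<notin> K \<Longrightarrow> u x = 0"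
      using u by (auto simp: C1_compact_support_iff)
    show ?thesis
      unfolding C1_compact_support_iff scaleR_fun_def
      using C1_bounded_linear_compose(1)[OF bounded_linear_scaleR_right K(1), of c] K
      by (intro conjI exI[of _ K]) auto
  qed
qed

text \<open>The product of two test functions is a test function, so the integral of its derivative
  vanishes.\<close>

lemma integration_by_parts:
  fixes \<phi> \<psi> :: "real^'n \<Rightarrow> real"
  assumes "\<phi> \<in> C1_compact_support \<Omega>" "\<psi> \<in> C1_compact_support \<Omega>"
  shows "L2_inner \<Omega> \<phi> (\<lambda>x. frechet_derivative \<psi> (at x) h) = - L2_inner \<Omega> (\<lambda>x. frechet_derivative \<phi> (at x) h) \<psi>"
proof -
  have C1: "C1 \<phi>" "C1 \<psi>" using assms by (auto simp: C1_compact_support_iff)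
  have "0 = (\<integral>x. frechet_derivative (\<lambda>x. \<phi> x * \<psi> x) (at x) h \<partial>M)"
    using integral_test_derivative_eq_0[OF test_mult[OF assms(2) C1(1)]] by simp
  also have "\<dots> = (\<integral>x. \<phi> x * frechet_derivative \<psi> (at x) h + frechet_derivative \<phi> (at x) h * \<psi> x \<partial>M)"
    by (simp add: frechet_derivative_mult[OF C1])
  also have "\<dots> = L2_inner \<Omega> \<phi> (\<lambda>x. frechet_derivative \<psi> (at x) h) + L2_inner \<Omega> (\<lambda>x. frechet_derivative \<phi> (at x) h) \<psi>"
    using L2_inner_integrable[OF test_L2(1)[OF assms(1)] test_L2(2)[OF assms(2)]]
      L2_inner_integrable[OF test_L2(2)[OF assms(1)] test_L2(1)[OF assms(2)]]
    by (simp add: L2_inner_def)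
  finally show ?thesis by simp
qed

text \<open>The boundary condition in \<open>velocity_space\<close> is phrased with
  \<open>grad\<close> of a difference from a test function, which a priori is some weak gradient;
  here the contribution of the test function is identified with its classical derivative.\<close>

lemma test_weak_gradient:
  fixes \<phi> :: "real^'n \<Rightarrow> real^'n"
  assumes \<phi>: "\<phi> \<in> C1_compact_support \<Omega>"
  defines "G \<equiv> \<lambda>x. \<chi> i j. frechet_derivative \<phi> (at x) (axis j 1) $ i"
  shows "has_weak_gradient \<Omega> \<phi> G" "G \<in> L2_space \<Omega>" "\<phi> \<in> H1_space \<Omega>"
    "AE x in M. grad \<Omega> \<phi> x = G x"
proof -
  show 1: "has_weak_gradient \<Omega> \<phi> G"
    unfolding has_weak_gradient_iff G_def
    using integration_by_parts[OF test_component(1)[OF \<phi>]] by (simp add: test_component(2)[OF \<phi>])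
  obtain K where K: "C1 \<phi>" "compact K" "\<And>x. x \<notin> K \<Longrightarrow> \<phi> x = 0"
    using \<phi> by (auto simp: C1_compact_support_iff)
  have "ess_bounded G"
  proof (rule compact_support_ess_bounded[OF _ K(2)])
    show "continuous_on UNIV G"
      unfolding G_def
      by (intro continuous_on_vec_lambda continuous_intros C1_continuous_derivative[OF K(1)])
    show "G x = 0" if "x \<notin> K" for x
      unfolding G_def
      by (simp add: vec_eq_iff frechet_derivative_eq_0_outside[OF compact_imp_closed[OF K(2)] K(3) that])
  qed
  then show 2: "G \<in> L2_space \<Omega>" by (rule ess_bounded_L2)
  show "\<phi> \<in> H1_space \<Omega>" by (rule H1_I[OF test_L2(1)[OF \<phi>] 2 1])
  show "AE x in M. grad \<Omega> \<phi> x = G x" by (rule grad_eq[OF test_L2(1)[OF \<phi>] 2 1])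
qed

lemma velocity_H1: "v \<in> velocity_space \<Omega> \<Longrightarrow> v \<in> H1_space \<Omega>"
  by (simp add: velocity_space_def)

lemma velocity_L2: "v \<in> velocity_space \<Omega> \<Longrightarrow> v \<in> L2_space \<Omega>"
  by (simp add: velocity_H1 H1_L2)

lemma velocity_space_iff:
  "v \<in> velocity_space \<Omega> \<longleftrightarrow> v \<in> H1_space \<Omega> \<and>
     (\<exists>\<phi>. (\<forall>m::nat. \<phi> m \<in> C1_compact_support \<Omega>) \<and> (\<lambda>m. H1_norm \<Omega> (\<phi> m - v)) \<longlonglongrightarrow> 0)"
  by (simp add: velocity_space_def fun_diff_def)

lemma subspace_velocity: "subspace (velocity_space \<Omega>)"
proof (rule subspaceI)
  note H1 = test_weak_gradient(3)
  show "0 \<in> velocity_space \<Omega>"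
    unfolding velocity_space_iff
  proof (intro conjI exI[of _ "\<lambda>m. 0"] allI)
    have "H1_norm \<Omega> (0 *\<^sub>R (0 :: real^'n \<Rightarrow> real^'n)) = \<bar>0\<bar> * H1_norm \<Omega> 0"
      by (rule H1_norm_scaleR[OF subspace_0[OF subspace_H1]])
    then show "(\<lambda>m. H1_norm \<Omega> (0 - 0)) \<longlonglongrightarrow> 0" by simp
  qed (rule subspace_0[OF subspace_H1] subspace_0[OF subspace_test])+
  show "u + v \<in> velocity_space \<Omega>" if uv: "u \<in> velocity_space \<Omega>" "v \<in> velocity_space \<Omega>" for u v
  proof -
    obtain \<phi> where \<phi>: "\<And>m::nat. \<phi> m \<in> C1_compact_support \<Omega>" "(\<lambda>m. H1_norm \<Omega> (\<phi> m - u)) \<longlonglongrightarrow> 0"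
      using uv(1) by (auto simp: velocity_space_iff)
    obtain \<psi> where \<psi>: "\<And>m::nat. \<psi> m \<in> C1_compact_support \<Omega>" "(\<lambda>m. H1_norm \<Omega> (\<psi> m - v)) \<longlonglongrightarrow> 0"
      using uv(2) by (auto simp: velocity_space_iff)
    have u: "u \<in> H1_space \<Omega>" and v: "v \<in> H1_space \<Omega>" using uv by (auto simp: velocity_H1)
    have "(\<lambda>m. H1_norm \<Omega> ((\<phi> m + \<psi> m) - (u + v))) \<longlonglongrightarrow> 0"
    proof (rule tendsto_sandwich[OF _ _ tendsto_const])
      show "(\<lambda>m. H1_norm \<Omega> (\<phi> m - u) + H1_norm \<Omega> (\<psi> m - v)) \<longlonglongrightarrow> 0"
        using tendsto_add[OF \<phi>(2) \<psi>(2)] by simp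
      have "H1_norm \<Omega> ((\<phi> m + \<psi> m) - (u + v)) \<le> H1_norm \<Omega> (\<phi> m - u) + H1_norm \<Omega> (\<psi> m - v)" for m
        using H1_triangle[OF subspace_diff[OF subspace_H1 H1[OF \<phi>(1)] u] subspace_diff[OF subspace_H1 H1[OF \<psi>(1)] v], of m m]
        by (simp add: algebra_simps)
      then show "\<forall>\<^sub>F m in sequentially. H1_norm \<Omega> ((\<phi> m + \<psi> m) - (u + v)) \<le> H1_norm \<Omega> (\<phi> m - u) + H1_norm \<Omega> (\<psi> m - v)"
        by simp
    qed simp
    then show ?thesis
      unfolding velocity_space_iff
      using subspace_add[OF subspace_H1 u v] subspace_add[OF subspace_test \<phi>(1) \<psi>(1)]
      by (intro conjI exI[of _ "\<lambda>m. \<phi> m + \<psi> m"]) auto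
  qed
  show "c *\<^sub>R u \<in> velocity_space \<Omega>" if u: "u \<in> velocity_space \<Omega>" for c u
  proof -
    obtain \<phi> where \<phi>: "\<And>m::nat. \<phi> m \<in> C1_compact_support \<Omega>" "(\<lambda>m. H1_norm \<Omega> (\<phi> m - u)) \<longlonglongrightarrow> 0"
      using u by (auto simp: velocity_space_iff)
    have uH: "u \<in> H1_space \<Omega>" using u by (rule velocity_H1)
    have "H1_norm \<Omega> (c *\<^sub>R \<phi> m - c *\<^sub>R u) = \<bar>c\<bar> * H1_norm \<Omega> (\<phi> m - u)" for m
      using H1_norm_scaleR[OF subspace_diff[OF subspace_H1 H1[OF \<phi>(1)] uH]] by (simp add: scaleR_diff_right)
    then have "(\<lambda>m. H1_norm \<Omega> (c *\<^sub>R \<phi> m - c *\<^sub>R u)) \<longlonglongrightarrow> 0"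
      using tendsto_mult_right_zero[OF \<phi>(2)] by simp
    then show ?thesis
      unfolding velocity_space_iff
      using subspace_scale[OF subspace_H1 uH] subspace_scale[OF subspace_test \<phi>(1)]
      by (intro conjI exI[of _ "\<lambda>m. c *\<^sub>R \<phi> m"]) auto
  qed
qed

section \<open>Passing to the limit in L2 products\<close>

definition L2_lim :: "(nat \<Rightarrow> real^'n \<Rightarrow> 'b::euclidean_space) \<Rightarrow> (real^'n \<Rightarrow> 'b) \<Rightarrow> bool" where
  "L2_lim f u \<longleftrightarrow> (\<forall>m. f m \<in> L2_space \<Omega>) \<and> u \<in> L2_space \<Omega> \<and> (\<lambda>m. L2_norm \<Omega> (f m - u)) \<longlonglongrightarrow> 0"

lemma L2_lim_inner:
  assumes "L2_lim f u" "g \<in> L2_space \<Omega>"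
  shows "(\<lambda>m. L2_inner \<Omega> g (f m)) \<longlonglongrightarrow> L2_inner \<Omega> g u"
proof -
  have d: "f m - u \<in> L2_space \<Omega>" for m
    using assms(1) by (auto simp: L2_lim_def intro: subspace_diff[OF subspace_L2])
  have "(\<lambda>m. L2_inner \<Omega> g (f m - u)) \<longlonglongrightarrow> 0"
  proof (rule Lim_null_comparison)
    show "\<forall>\<^sub>F m in sequentially. norm (L2_inner \<Omega> g (f m - u)) \<le> L2_norm \<Omega> g * L2_norm \<Omega> (f m - u)"
      using L2_cauchy_schwarz[OF assms(2) d] by simp
    show "(\<lambda>m. L2_norm \<Omega> g * L2_norm \<Omega> (f m - u)) \<longlonglongrightarrow> 0"
      using assms(1) by (intro tendsto_mult_right_zero) (simp add: L2_lim_def)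
  qed
  moreover have "L2_inner \<Omega> g (f m - u) = L2_inner \<Omega> g (f m) - L2_inner \<Omega> g u" for m
    using assms by (intro lin_on_diff[OF psd_on_lin[OF psd_L2] subspace_L2]) (auto simp: L2_lim_def)
  ultimately show ?thesis by (simp add: LIM_zero_iff)
qed

lemma L2_lim_bounded_linear:
  fixes T :: "'b::euclidean_space \<Rightarrow> 'c::euclidean_space"
  assumes "L2_lim f u" "bounded_linear T"
  shows "L2_lim (\<lambda>m x. T (f m x)) (\<lambda>x. T (u x))"
proof -
  have L2: "f m \<in> L2_space \<Omega>" "u \<in> L2_space \<Omega>" "f m - u \<in> L2_space \<Omega>" for m
    using assms(1) by (auto simp: L2_lim_def intro: subspace_diff[OF subspace_L2])
  interpret T: bounded_linear T by fact
  have eq: "(\<lambda>x. T (f m x)) - (\<lambda>x. T (u x)) = (\<lambda>x. T ((f m - u) x))" for m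
    by (simp add: fun_eq_iff T.diff)
  have "(\<lambda>m. L2_norm \<Omega> ((\<lambda>x. T (f m x)) - (\<lambda>x. T (u x)))) \<longlonglongrightarrow> 0"
  proof (rule Lim_null_comparison)
    show "\<forall>\<^sub>F m in sequentially. norm (L2_norm \<Omega> ((\<lambda>x. T (f m x)) - (\<lambda>x. T (u x)))) \<le> onorm T * L2_norm \<Omega> (f m - u)"
      unfolding eq using L2_norm_le_bound[OF L2(3) L2_bounded_linear[OF assms(2) L2(3)] onorm_pos_le[OF assms(2)]]
        onorm[OF assms(2)] by simp
    show "(\<lambda>m. onorm T * L2_norm \<Omega> (f m - u)) \<longlonglongrightarrow> 0"
      using assms(1) by (intro tendsto_mult_right_zero) (simp add: L2_lim_def)
  qed
  then show ?thesis using L2_bounded_linear[OF assms(2)] L2 by (simp add: L2_lim_def)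
qed

text \<open>Puts the boundary condition into the form used in limits: the approximants and their
  classical derivatives converge componentwise in L2, so either can be inserted in an L2 product
  with a fixed factor.\<close>

lemma velocity_approx:
  assumes "v \<in> velocity_space \<Omega>"
  obtains \<phi> where "\<And>m. \<phi> m \<in> C1_compact_support \<Omega>"
    "\<And>i. L2_lim (\<lambda>m x. \<phi> m x $ i) (\<lambda>x. v x $ i)"
    "\<And>i j. L2_lim (\<lambda>m x. frechet_derivative (\<lambda>x. \<phi> m x $ i) (at x) (axis j 1)) (\<lambda>x. grad \<Omega> v x $ i $ j)"
proof -
  obtain \<phi> where \<phi>: "\<And>m::nat. \<phi> m \<in> C1_compact_support \<Omega>" "(\<lambda>m. H1_norm \<Omega> (\<phi> m - v)) \<longlonglongrightarrow> 0"
    using assms by (auto simp: velocity_space_iff)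
  have vH: "v \<in> H1_space \<Omega>" using assms by (rule velocity_H1)
  note \<phi>H = test_weak_gradient(3)[OF \<phi>(1)]
  have 1: "L2_lim \<phi> v"
  proof -
    have "(\<lambda>m. L2_norm \<Omega> (\<phi> m - v)) \<longlonglongrightarrow> 0"
      by (rule Lim_null_comparison[OF _ \<phi>(2)]) (simp add: L2_norm_le_H1_norm)
    then show ?thesis using H1_L2[OF vH] H1_L2[OF \<phi>H] by (simp add: L2_lim_def)
  qed
  define G where "G m x = (\<chi> i j. frechet_derivative (\<phi> m) (at x) (axis j 1) $ i)" for m x
  have GL2: "G m \<in> L2_space \<Omega>" and G: "AE x in M. grad \<Omega> (\<phi> m) x = G m x" for m
    using test_weak_gradient[OF \<phi>(1)] unfolding G_def by blast+
  have 2: "L2_lim G (grad \<Omega> v)"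
  proof -
    have "L2_norm \<Omega> (G m - grad \<Omega> v) = L2_norm \<Omega> (grad \<Omega> (\<phi> m - v))" for m
    proof (rule L2_norm_cong)
      show "AE x in M. (G m - grad \<Omega> v) x = grad \<Omega> (\<phi> m - v) x"
        using G[of m] op_lin_diff[OF op_lin_grad subspace_H1 \<phi>H vH, of m] by eventually_elim simp
    qed (auto intro: subspace_diff[OF subspace_L2] GL2 grad_works(1) vH subspace_diff[OF subspace_H1] \<phi>H)
    then have "(\<lambda>m. L2_norm \<Omega> (G m - grad \<Omega> v)) \<longlonglongrightarrow> 0"
      by (intro Lim_null_comparison[OF _ \<phi>(2)]) (simp add: L2_norm_le_H1_norm)
    then show ?thesis using GL2 grad_works(1)[OF vH] by (simp add: L2_lim_def)
  qed
  show ?thesis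
  proof (rule that[OF \<phi>(1)])
    show "L2_lim (\<lambda>m x. \<phi> m x $ i) (\<lambda>x. v x $ i)" for i
      by (rule L2_lim_bounded_linear[OF 1 bounded_linear_vec_nth])
    show "L2_lim (\<lambda>m x. frechet_derivative (\<lambda>x. \<phi> m x $ i) (at x) (axis j 1)) (\<lambda>x. grad \<Omega> v x $ i $ j)" for i j
      using L2_lim_bounded_linear[OF 2 bounded_linear_entry, of i j]
      by (simp add: G_def test_component(2)[OF \<phi>(1)])
  qed
qed

text \<open>The qualitative part of the Poincare inequality, with the multiplier
  \<open>x $ j\<close>, which is bounded because \<Omega> is. If the gradient vanishes, testing with
  \<open>x $ j * \<phi>\<close> shows that the product of \<open>v $ i\<close> and \<phi> is minus
  the product of \<open>v $ i * x $ j\<close> with the derivative of \<phi> in direction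
  \<open>j\<close>. Let \<phi> approximate \<open>v $ i\<close>: the left side tends to the squared
  norm of \<open>v $ i\<close>, the right side to 0, since the limit of the derivatives is the
  gradient.\<close>

lemma velocity_grad_0:
  assumes v: "v \<in> velocity_space \<Omega>" and 0: "AE x in M. grad \<Omega> v x = 0"
  shows "AE x in M. v x = 0"
proof -
  have vH: "v \<in> H1_space \<Omega>" using v by (rule velocity_H1)
  obtain \<phi> where \<phi>: "\<And>m. \<phi> m \<in> C1_compact_support \<Omega>"
    "\<And>i. L2_lim (\<lambda>m x. \<phi> m x $ i) (\<lambda>x. v x $ i)"
    "\<And>i j. L2_lim (\<lambda>m x. frechet_derivative (\<lambda>x. \<phi> m x $ i) (at x) (axis j 1)) (\<lambda>x. grad \<Omega> v x $ i $ j)"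
    using velocity_approx[OF v] by metis
  obtain r where r: "\<And>x. x \<in> \<Omega> \<Longrightarrow> norm x \<le> r"
    using bounded_domain by (auto simp: bounded_iff)
  have "AE x in M. v x $ i = 0" for i
  proof -
    fix j :: 'n
    have vi: "(\<lambda>x. v x $ i) \<in> L2_space \<Omega>"
      by (rule L2_bounded_linear[OF bounded_linear_vec_nth H1_L2[OF vH]])
    have "(\<lambda>x. x $ j) \<in> borel_measurable M"
      by (intro measurable_M borel_measurable_continuous_onI continuous_intros)
    moreover have "AE x in M. norm (x $ j) \<le> r"
    proof (rule AE_I2)
      fix x assume "x \<in> space M"
      then show "norm (x $ j) \<le> r" using r[of x] component_le_norm_cart[of x j] by simp
    qed
    ultimately have xj: "ess_bounded (\<lambda>x. x $ j)" by (auto simp: ess_bounded_def)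
    have xv: "(\<lambda>x. v x $ i * x $ j) \<in> L2_space \<Omega>"
      by (rule L2_bilinear[OF bounded_bilinear_mult vi xj])
    let ?\<phi> = "\<lambda>m x. \<phi> m x $ i"
    let ?D = "\<lambda>m x. frechet_derivative (?\<phi> m) (at x) (axis j 1)"
    have eq: "L2_inner \<Omega> (\<lambda>x. v x $ i) (?\<phi> m) = - L2_inner \<Omega> (\<lambda>x. v x $ i * x $ j) (?D m)" for m
    proof -
      have C1x: "C1 (\<lambda>x::real^'n. x $ j)" by (rule C1_bounded_linear[OF bounded_linear_vec_nth])
      have t: "?\<phi> m \<in> C1_compact_support \<Omega>" by (rule test_component(1)[OF \<phi>(1)])
      then have C1\<phi>: "C1 (?\<phi> m)" by (simp add: C1_compact_support_iff)
      have dx: "frechet_derivative (\<lambda>x::real^'n. x $ j) (at x) (axis j 1) = 1" for x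
        using frechet_derivative_at[OF bounded_linear_imp_has_derivative[OF bounded_linear_vec_nth], of j x]
        by (metis axis_nth)
      have "L2_inner \<Omega> (\<lambda>x. v x $ i) (\<lambda>x. frechet_derivative (\<lambda>x. x $ j * ?\<phi> m x) (at x) (axis j 1)) =
          - L2_inner \<Omega> (\<lambda>x. grad \<Omega> v x $ i $ j) (\<lambda>x. x $ j * ?\<phi> m x)"
        using grad_works(2)[OF vH] test_mult[OF t C1x] unfolding has_weak_gradient_iff by blast
      also have "L2_inner \<Omega> (\<lambda>x. grad \<Omega> v x $ i $ j) (\<lambda>x. x $ j * ?\<phi> m x) = 0"
        unfolding L2_inner_def by (rule integral_eq_zero_AE) (use 0 in \<open>eventually_elim, simp\<close>)
      finally have "0 = (\<integral>x. v x $ i * (x $ j * ?D m x + ?\<phi> m x) \<partial>M)"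
        by (simp add: L2_inner_def frechet_derivative_mult[OF C1x C1\<phi>] dx)
      also have "\<dots> = (\<integral>x. (v x $ i * x $ j) * ?D m x + v x $ i * ?\<phi> m x \<partial>M)"
        by (simp add: algebra_simps)
      also have "\<dots> = L2_inner \<Omega> (\<lambda>x. v x $ i * x $ j) (?D m) + L2_inner \<Omega> (\<lambda>x. v x $ i) (?\<phi> m)"
        using L2_inner_integrable[OF xv test_L2(2)[OF t]] L2_inner_integrable[OF vi test_L2(1)[OF t]]
        by (simp add: L2_inner_def)
      finally show ?thesis by simp
    qed
    have "(\<lambda>m. - L2_inner \<Omega> (\<lambda>x. v x $ i * x $ j) (?D m)) \<longlonglongrightarrow>
        - L2_inner \<Omega> (\<lambda>x. v x $ i * x $ j) (\<lambda>x. grad \<Omega> v x $ i $ j)"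
      by (intro tendsto_minus L2_lim_inner[OF \<phi>(3) xv])
    moreover have "L2_inner \<Omega> (\<lambda>x. v x $ i * x $ j) (\<lambda>x. grad \<Omega> v x $ i $ j) = 0"
      unfolding L2_inner_def by (rule integral_eq_zero_AE) (use 0 in \<open>eventually_elim, simp\<close>)
    ultimately have "(\<lambda>m. L2_inner \<Omega> (\<lambda>x. v x $ i) (?\<phi> m)) \<longlonglongrightarrow> 0" using eq by simp
    moreover have "(\<lambda>m. L2_inner \<Omega> (\<lambda>x. v x $ i) (?\<phi> m)) \<longlonglongrightarrow> L2_inner \<Omega> (\<lambda>x. v x $ i) (\<lambda>x. v x $ i)"
      by (rule L2_lim_inner[OF \<phi>(2) vi])
    ultimately have "L2_inner \<Omega> (\<lambda>x. v x $ i) (\<lambda>x. v x $ i) = 0" using LIMSEQ_unique by blast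
    then show ?thesis using L2_inner_self_eq_0_iff[OF vi] by simp
  qed
  then have "AE x in M. \<forall>i. v x $ i = 0" by (simp add: AE_all_countable)
  then show ?thesis by eventually_elim (simp add: vec_eq_iff)
qed

section \<open>The cancellation in the convective form\<close>

lemma ess_bounded_mult:
  fixes u w :: "real^'n \<Rightarrow> real"
  assumes "ess_bounded u" "ess_bounded w"
  shows "ess_bounded (\<lambda>x. u x * w x)"
proof -
  obtain C where C: "AE x in M. norm (u x) \<le> C" using assms(1) by (auto simp: ess_bounded_def)
  obtain D where D: "AE x in M. norm (w x) \<le> D" using assms(2) by (auto simp: ess_bounded_def)
  have "AE x in M. norm (u x * w x) \<le> C * D"
    using C D
  proof eventually_elim
    case (elim x)
    then show ?case unfolding norm_mult by (intro mult_mono) (auto intro: order_trans[OF norm_ge_zero])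
  qed
  then show ?thesis using assms by (auto simp: ess_bounded_def)
qed

text \<open>Only one factor is approximated by test functions at a time, the other ones being bounded;
  this avoids the Sobolev embedding.\<close>

lemma bounded_square_derivative:
  assumes v: "v \<in> velocity_space \<Omega>" and b: "ess_bounded v" and \<psi>: "\<psi> \<in> C1_compact_support \<Omega>"
  shows "L2_inner \<Omega> (\<lambda>x. v x $ i * v x $ i) (\<lambda>x. frechet_derivative \<psi> (at x) (axis j 1)) =
    - 2 * L2_inner \<Omega> (\<lambda>x. v x $ i * grad \<Omega> v x $ i $ j) \<psi>"
proof -
  have vH: "v \<in> H1_space \<Omega>" using v by (rule velocity_H1)
  obtain \<phi> where \<phi>: "\<And>m. \<phi> m \<in> C1_compact_support \<Omega>"
    "\<And>i. L2_lim (\<lambda>m x. \<phi> m x $ i) (\<lambda>x. v x $ i)"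
    "\<And>i j. L2_lim (\<lambda>m x. frechet_derivative (\<lambda>x. \<phi> m x $ i) (at x) (axis j 1)) (\<lambda>x. grad \<Omega> v x $ i $ j)"
    using velocity_approx[OF v] by metis
  let ?v = "\<lambda>x. v x $ i" and ?G = "\<lambda>x. grad \<Omega> v x $ i $ j"
  let ?\<phi> = "\<lambda>m x. \<phi> m x $ i"
  let ?D = "\<lambda>m x. frechet_derivative (?\<phi> m) (at x) (axis j 1)"
  let ?d = "\<lambda>x. frechet_derivative \<psi> (at x) (axis j 1)"
  have vi: "?v \<in> L2_space \<Omega>" by (rule L2_bounded_linear[OF bounded_linear_vec_nth H1_L2[OF vH]])
  have Gij: "?G \<in> L2_space \<Omega>" by (rule L2_bounded_linear[OF bounded_linear_entry grad_works(1)[OF vH]])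
  have L: "(\<lambda>x. ?v x * ?d x) \<in> L2_space \<Omega>" "(\<lambda>x. ?v x * \<psi> x) \<in> L2_space \<Omega>" "(\<lambda>x. ?G x * \<psi> x) \<in> L2_space \<Omega>"
    using L2_bilinear[OF bounded_bilinear_mult] vi Gij test_ess_bounded[OF \<psi>] by auto
  \<comment> \<open>The weak derivative of \<open>v $ i\<close> is tested with the product of an
    approximant and \<psi>, and the terms are sorted so that the approximant or its derivative is
    the second factor of each L2 product.\<close>
  have eq: "L2_inner \<Omega> (\<lambda>x. ?v x * ?d x) (?\<phi> m) + L2_inner \<Omega> (\<lambda>x. ?v x * \<psi> x) (?D m) = - L2_inner \<Omega> (\<lambda>x. ?G x * \<psi> x) (?\<phi> m)" for m
  proof -
    have t: "?\<phi> m \<in> C1_compact_support \<Omega>" by (rule test_component(1)[OF \<phi>(1)])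
    have C1: "C1 (?\<phi> m)" "C1 \<psi>" using t \<psi> by (auto simp: C1_compact_support_iff)
    have "L2_inner \<Omega> (\<lambda>x. ?v x * ?d x) (?\<phi> m) + L2_inner \<Omega> (\<lambda>x. ?v x * \<psi> x) (?D m) =
        (\<integral>x. (?v x * ?d x) * ?\<phi> m x + (?v x * \<psi> x) * ?D m x \<partial>M)"
      using L2_inner_integrable[OF L(1) test_L2(1)[OF t]] L2_inner_integrable[OF L(2) test_L2(2)[OF t]]
      by (simp add: L2_inner_def)
    also have "\<dots> = L2_inner \<Omega> ?v (\<lambda>x. frechet_derivative (\<lambda>x. ?\<phi> m x * \<psi> x) (at x) (axis j 1))"
      unfolding L2_inner_def frechet_derivative_mult[OF C1] by (simp add: algebra_simps)
    also have "\<dots> = - L2_inner \<Omega> ?G (\<lambda>x. ?\<phi> m x * \<psi> x)"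
      using grad_works(2)[OF vH] test_mult[OF \<psi> C1(1)] unfolding has_weak_gradient_iff by blast
    also have "\<dots> = - L2_inner \<Omega> (\<lambda>x. ?G x * \<psi> x) (?\<phi> m)" by (simp add: L2_inner_def mult_ac)
    finally show ?thesis .
  qed
  have "(\<lambda>m. L2_inner \<Omega> (\<lambda>x. ?v x * ?d x) (?\<phi> m) + L2_inner \<Omega> (\<lambda>x. ?v x * \<psi> x) (?D m)) \<longlonglongrightarrow>
      L2_inner \<Omega> (\<lambda>x. ?v x * ?d x) ?v + L2_inner \<Omega> (\<lambda>x. ?v x * \<psi> x) ?G"
    by (intro tendsto_add L2_lim_inner \<phi> L)
  moreover have "(\<lambda>m. - L2_inner \<Omega> (\<lambda>x. ?G x * \<psi> x) (?\<phi> m)) \<longlonglongrightarrow> - L2_inner \<Omega> (\<lambda>x. ?G x * \<psi> x) ?v"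
    by (intro tendsto_minus L2_lim_inner \<phi> L)
  ultimately have "L2_inner \<Omega> (\<lambda>x. ?v x * ?d x) ?v + L2_inner \<Omega> (\<lambda>x. ?v x * \<psi> x) ?G = - L2_inner \<Omega> (\<lambda>x. ?G x * \<psi> x) ?v"
    unfolding eq by (rule LIMSEQ_unique)
  then show ?thesis by (simp add: L2_inner_def mult_ac)
qed

text \<open>The second limit: \<psi> runs through approximants of \<open>v $ j\<close>. Both sides
  converge because, for bounded \<open>v\<close>, the square of \<open>v $ i\<close> and the product
  of \<open>v $ i\<close> with its derivative are square integrable.\<close>

lemma bounded_square_divergence:
  assumes v: "v \<in> velocity_space \<Omega>" and b: "ess_bounded v"
  shows "L2_inner \<Omega> (\<lambda>x. v x $ i * v x $ i) (\<lambda>x. grad \<Omega> v x $ j $ j) =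
    - 2 * L2_inner \<Omega> (\<lambda>x. v x $ i * grad \<Omega> v x $ i $ j) (\<lambda>x. v x $ j)"
proof -
  have vH: "v \<in> H1_space \<Omega>" using v by (rule velocity_H1)
  obtain \<phi> where \<phi>: "\<And>m. \<phi> m \<in> C1_compact_support \<Omega>"
    "\<And>i. L2_lim (\<lambda>m x. \<phi> m x $ i) (\<lambda>x. v x $ i)"
    "\<And>i j. L2_lim (\<lambda>m x. frechet_derivative (\<lambda>x. \<phi> m x $ i) (at x) (axis j 1)) (\<lambda>x. grad \<Omega> v x $ i $ j)"
    using velocity_approx[OF v] by metis
  have bi: "ess_bounded (\<lambda>x. v x $ i)" by (rule ess_bounded_bounded_linear[OF bounded_linear_vec_nth b])
  have L: "(\<lambda>x. v x $ i * v x $ i) \<in> L2_space \<Omega>" by (intro ess_bounded_L2 ess_bounded_mult bi)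
  have L': "(\<lambda>x. v x $ i * grad \<Omega> v x $ i $ j) \<in> L2_space \<Omega>"
    using L2_bilinear[OF bounded_bilinear_mult L2_bounded_linear[OF bounded_linear_entry grad_works(1)[OF vH]] bi]
    by (simp add: mult.commute)
  have "(\<lambda>m. L2_inner \<Omega> (\<lambda>x. v x $ i * v x $ i) (\<lambda>x. frechet_derivative (\<lambda>x. \<phi> m x $ j) (at x) (axis j 1))) \<longlonglongrightarrow>
     L2_inner \<Omega> (\<lambda>x. v x $ i * v x $ i) (\<lambda>x. grad \<Omega> v x $ j $ j)"
    by (rule L2_lim_inner[OF \<phi>(3) L])
  moreover have "(\<lambda>m. - 2 * L2_inner \<Omega> (\<lambda>x. v x $ i * grad \<Omega> v x $ i $ j) (\<lambda>x. \<phi> m x $ j)) \<longlonglongrightarrow>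
     - 2 * L2_inner \<Omega> (\<lambda>x. v x $ i * grad \<Omega> v x $ i $ j) (\<lambda>x. v x $ j)"
    by (intro tendsto_mult_left L2_lim_inner[OF \<phi>(2) L'])
  ultimately show ?thesis
    unfolding bounded_square_derivative[OF v b test_component(1)[OF \<phi>(1)]] by (rule LIMSEQ_unique)
qed

text \<open>Pointwise the integrand is the sum over \<open>i\<close> and \<open>j\<close> of the
  formal derivative in direction \<open>j\<close> of \<open>(v $ i)\<^sup>2 * v $ j\<close>;
  \<open>bounded_square_divergence\<close> says that each of these summands integrates to 0.\<close>

lemma emac_form_self_eq_0:
  assumes v: "v \<in> velocity_space \<Omega>" and b: "ess_bounded v"
  shows "emac_form \<Omega> v v v = 0"
proof -
  have vH: "v \<in> H1_space \<Omega>" using v by (rule velocity_H1)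
  define G where "G = grad \<Omega> v"
  have GL: "G \<in> L2_space \<Omega>" unfolding G_def by (rule grad_works(1)[OF vH])
  have vL: "v \<in> L2_space \<Omega>" by (rule H1_L2[OF vH])
  have bi: "ess_bounded (\<lambda>x. v x $ i)" for i by (rule ess_bounded_bounded_linear[OF bounded_linear_vec_nth b])
  have Gij: "(\<lambda>x. G x $ i $ j) \<in> L2_space \<Omega>" for i j by (rule L2_bounded_linear[OF bounded_linear_entry GL])
  have L: "(\<lambda>x. sym_grad \<Omega> v x *v v x) \<in> L2_space \<Omega>" "(\<lambda>x. div_field \<Omega> v x *\<^sub>R v x) \<in> L2_space \<Omega>"
    by (intro L2_bilinear[OF bounded_bilinear_matrix_vector _ b] op_lin_L2[OF op_lin_sym_grad vH],
        intro L2_bilinear[OF bounded_bilinear_scaleR _ b] op_lin_L2[OF op_lin_div vH])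
  have I1: "integrable M (\<lambda>x. (v x $ i * v x $ i) * G x $ j $ j)" for i j
    using L2_inner_integrable[OF ess_bounded_L2[OF ess_bounded_mult[OF bi bi]] Gij] by simp
  have I2: "integrable M (\<lambda>x. (v x $ i * G x $ i $ j) * v x $ j)" for i j
    using L2_inner_integrable[OF L2_bilinear[OF bounded_bilinear_mult Gij bi] ess_bounded_L2[OF bi]]
    by (simp add: mult_ac)
  have pw: "2 * ((sym_part A *v w) \<bullet> w) + (trace A *\<^sub>R w) \<bullet> w =
      (\<Sum>i\<in>UNIV. \<Sum>j\<in>UNIV. (w $ i * w $ i) * A $ j $ j + 2 * ((w $ i * A $ i $ j) * w $ j))"
    for A :: "real^'n^'n" and w :: "real^'n"
  proof -
    have "(A *v w) \<bullet> w = (\<Sum>i\<in>UNIV. \<Sum>j\<in>UNIV. (w $ i * A $ i $ j) * w $ j)"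
      by (simp add: inner_vec_def matrix_vector_mult_def sum_distrib_left sum_distrib_right mult_ac)
    \<comment> \<open>Symmetrising a matrix does not change its quadratic form.\<close>
    moreover have "(transpose A *v w) \<bullet> w = (A *v w) \<bullet> w"
      by (metis dot_lmul_matrix inner_commute transpose_matrix_vector)
    moreover have "(trace A *\<^sub>R w) \<bullet> w = (\<Sum>i\<in>UNIV. \<Sum>j\<in>UNIV. (w $ i * w $ i) * A $ j $ j)"
      by (simp add: inner_vec_def trace_def sum_distrib_left sum_distrib_right mult_ac)
    ultimately show ?thesis
      by (simp add: sym_part_def scaleR_matrix_vector_assoc[symmetric] matrix_vector_mult_add_rdistrib
          inner_add_left sum.distrib sum_distrib_left)
  qed
  have "emac_form \<Omega> v v v = (\<integral>x. 2 * ((sym_part (G x) *v v x) \<bullet> v x) + (trace (G x) *\<^sub>R v x) \<bullet> v x \<partial>M)"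
    using L2_inner_integrable[OF L(1) vL] L2_inner_integrable[OF L(2) vL]
    by (simp add: emac_form_def L2_inner_def sym_grad_def div_field_def sym_part_def G_def)
  also have "\<dots> = (\<Sum>i\<in>UNIV. \<Sum>j\<in>UNIV. \<integral>x. (v x $ i * v x $ i) * G x $ j $ j + 2 * ((v x $ i * G x $ i $ j) * v x $ j) \<partial>M)"
    unfolding pw using I1 I2 by (simp add: Bochner_Integration.integral_sum)
  also have "\<dots> = (\<Sum>i\<in>UNIV. \<Sum>j\<in>UNIV. L2_inner \<Omega> (\<lambda>x. v x $ i * v x $ i) (\<lambda>x. G x $ j $ j)
      + 2 * L2_inner \<Omega> (\<lambda>x. v x $ i * G x $ i $ j) (\<lambda>x. v x $ j))"
    using I1 I2 by (simp add: L2_inner_def)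
  also have "\<dots> = 0"
    using bounded_square_divergence[OF v b] by (simp add: G_def)
  finally show ?thesis .
qed

end

section \<open>Finite element spaces\<close>

definition monomial :: "('n \<Rightarrow> nat) \<Rightarrow> real^'n \<Rightarrow> real" where
  "monomial e x = (\<Prod>i\<in>UNIV. (x $ i) ^ e i)"

lemma continuous_on_monomial: "continuous_on S (monomial e)"
  unfolding monomial_def by (intro continuous_intros)

definition multi_indices :: "nat \<Rightarrow> ('n::finite \<Rightarrow> nat) set" where
  "multi_indices m = {e. (\<Sum>i\<in>UNIV. e i) \<le> m}"

lemma finite_multi_indices: "finite (multi_indices m :: ('n::finite \<Rightarrow> nat) set)"
proof (rule finite_subset)
  show "multi_indices m \<subseteq> (UNIV :: 'n set) \<rightarrow>\<^sub>E {..m}"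
  proof
    fix e :: "'n \<Rightarrow> nat" assume e: "e \<in> multi_indices m"
    have "e i \<le> (\<Sum>i\<in>UNIV. e i)" for i by (rule member_le_sum) auto
    then show "e \<in> UNIV \<rightarrow>\<^sub>E {..m}" using e by (force simp: multi_indices_def intro: order_trans)
  qed
  show "finite ((UNIV :: 'n set) \<rightarrow>\<^sub>E {..m})" by (intro finite_PiE) auto
qed

lemma poly_space_iff: "p \<in> poly_space m \<longleftrightarrow> (\<exists>c. \<forall>x. p x = (\<Sum>e\<in>multi_indices m. c e * monomial e x))"
  by (simp add: poly_space_def multi_indices_def monomial_def)

lemma poly_space_continuous: "p \<in> poly_space m \<Longrightarrow> continuous_on S p"
proof -
  assume "p \<in> poly_space m"
  then obtain c where "\<And>x. p x = (\<Sum>e\<in>multi_indices m. c e * monomial e x)"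
    by (auto simp: poly_space_iff)
  then have "p = (\<lambda>x. \<Sum>e\<in>multi_indices m. c e * monomial e x)" by auto
  then show ?thesis by (simp add: continuous_intros continuous_on_monomial)
qed

lemma subspace_poly_space: "subspace (poly_space m :: (real^'n \<Rightarrow> real) set)"
proof (rule subspaceI)
  show "0 \<in> poly_space m" by (auto simp: poly_space_iff intro!: exI[of _ "\<lambda>_. 0"])
  show "p + q \<in> poly_space m" if pq: "p \<in> poly_space m" "q \<in> poly_space m" for p q :: "real^'n \<Rightarrow> real"
  proof -
    obtain c where "\<And>x. p x = (\<Sum>e\<in>multi_indices m. c e * monomial e x)"
      using pq(1) by (auto simp: poly_space_iff)
    moreover obtain d where "\<And>x. q x = (\<Sum>e\<in>multi_indices m. d e * monomial e x)"
      using pq(2) by (auto simp: poly_space_iff)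
    ultimately show ?thesis
      by (auto simp: poly_space_iff algebra_simps sum.distrib intro!: exI[of _ "\<lambda>e. c e + d e"])
  qed
  show "a *\<^sub>R p \<in> poly_space m" if p: "p \<in> poly_space m" for a and p :: "real^'n \<Rightarrow> real"
  proof -
    obtain c where "\<And>x. p x = (\<Sum>e\<in>multi_indices m. c e * monomial e x)"
      using p by (auto simp: poly_space_iff)
    then show ?thesis
      by (auto simp: poly_space_iff sum_distrib_left mult.assoc intro!: exI[of _ "\<lambda>e. a * c e"])
  qed
qed

lemma subspace_piecewise_poly: "subspace (piecewise_poly \<T> m :: (real^'n \<Rightarrow> real) set)"
proof (rule subspaceI)
  note P = subspace_poly_space
  show "0 \<in> piecewise_poly \<T> m"
    unfolding piecewise_poly_def by (auto intro!: bexI[of _ 0] subspace_0[OF P])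
  show "p + q \<in> piecewise_poly \<T> m" if pq: "p \<in> piecewise_poly \<T> m" "q \<in> piecewise_poly \<T> m"
    for p q :: "real^'n \<Rightarrow> real"
    unfolding piecewise_poly_def
  proof (intro CollectI ballI)
    fix K assume K: "K \<in> \<T>"
    obtain a where a: "a \<in> poly_space m" "AE x in lebesgue_on K. p x = a x"
      using pq(1) K by (auto simp: piecewise_poly_def)
    obtain b where b: "b \<in> poly_space m" "AE x in lebesgue_on K. q x = b x"
      using pq(2) K by (auto simp: piecewise_poly_def)
    have "AE x in lebesgue_on K. (p + q) x = (a + b) x" using a(2) b(2) by eventually_elim simp
    then show "\<exists>r\<in>poly_space m. AE x in lebesgue_on K. (p + q) x = r x"
      using subspace_add[OF P a(1) b(1)] by blast
  qed
  show "c *\<^sub>R p \<in> piecewise_poly \<T> m" if p: "p \<in> piecewise_poly \<T> m" for c and p :: "real^'n \<Rightarrow> real"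
    unfolding piecewise_poly_def
  proof (intro CollectI ballI)
    fix K assume K: "K \<in> \<T>"
    obtain a where a: "a \<in> poly_space m" "AE x in lebesgue_on K. p x = a x"
      using p K by (auto simp: piecewise_poly_def)
    have "AE x in lebesgue_on K. (c *\<^sub>R p) x = (c *\<^sub>R a) x" using a(2) by eventually_elim simp
    then show "\<exists>r\<in>poly_space m. AE x in lebesgue_on K. (c *\<^sub>R p) x = r x"
      using subspace_scale[OF P a(1)] by blast
  qed
qed

locale fe_space = bounded_domain \<Omega> for \<Omega> :: "(real^'n) set" +
  fixes \<T> :: "(real^'n) set set" and k :: nat
  assumes triangulation: "conforming_triangulation \<Omega> \<T>"
begin

abbreviation X :: "(real^'n \<Rightarrow> real^'n) set" where "X \<equiv> fe_velocity \<Omega> \<T> k"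
abbreviation Q :: "(real^'n \<Rightarrow> real) set" where "Q \<equiv> fe_pressure \<Omega> \<T> k"
abbreviation V :: "(real^'n \<Rightarrow> real^'n) set" where "V \<equiv> fe_div_free \<Omega> \<T> k"

lemma finite_cells: "finite \<T>"
  using triangulation by (simp add: conforming_triangulation_def triangulation_def)

lemma compact_cell: "K \<in> \<T> \<Longrightarrow> compact K"
  using triangulation compact_simplex by (auto simp: conforming_triangulation_def)

lemma cell_lebesgue: "K \<in> \<T> \<Longrightarrow> K \<in> sets lebesgue"
  using compact_cell by (intro sets_completionI_sets) (simp add: borel_compact)

lemma domain_cells: "x \<in> \<Omega> \<Longrightarrow> \<exists>K\<in>\<T>. x \<in> K"
  using triangulation closure_subset[of \<Omega>] by (auto simp: conforming_triangulation_def)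

lemma AE_cell: "K \<in> \<T> \<Longrightarrow> AE x in lebesgue_on K. P x \<Longrightarrow> AE x in M. x \<in> K \<longrightarrow> P x"
  using cell_lebesgue[of K] by (auto simp: AE_restrict_space_iff AE_M_iff elim: eventually_mono)

text \<open>There are finitely many cells, each of them is compact, and a polynomial is bounded on a
  compact set.\<close>

lemma piecewise_poly_bounded:
  assumes "q \<in> L2_space \<Omega>" "q \<in> piecewise_poly \<T> m"
  shows "ess_bounded q"
proof -
  have "\<exists>C. AE x in M. x \<in> K \<longrightarrow> norm (q x) \<le> C" if K: "K \<in> \<T>" for K
  proof -
    obtain p where p: "p \<in> poly_space m" "AE x in lebesgue_on K. q x = p x"
      using assms(2) K by (auto simp: piecewise_poly_def)
    have "bounded (p ` K)"
      by (intro compact_imp_bounded compact_continuous_image poly_space_continuous[OF p(1)] compact_cell[OF K])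
    then obtain C where "\<And>x. x \<in> K \<Longrightarrow> norm (p x) \<le> C" by (auto simp: bounded_iff)
    then have "AE x in M. x \<in> K \<longrightarrow> norm (q x) \<le> C"
      using AE_cell[OF K p(2)] by (auto elim: eventually_mono)
    then show ?thesis by blast
  qed
  then obtain C where C: "\<And>K. K \<in> \<T> \<Longrightarrow> AE x in M. x \<in> K \<longrightarrow> norm (q x) \<le> C K" by metis
  have "AE x in M. \<forall>K\<in>\<T>. x \<in> K \<longrightarrow> norm (q x) \<le> C K"
    by (rule AE_finite_allI[OF finite_cells C])
  then have "AE x in M. norm (q x) \<le> (\<Sum>K\<in>\<T>. \<bar>C K\<bar>)"
    using AE_space
  proof eventually_elim
    case (elim x)
    then obtain K where K: "K \<in> \<T>" "x \<in> K" using domain_cells[of x] by auto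
    then have "norm (q x) \<le> \<bar>C K\<bar>" using elim by force
    also have "\<dots> \<le> (\<Sum>K\<in>\<T>. \<bar>C K\<bar>)" using K finite_cells by (intro member_le_sum) auto
    finally show ?case .
  qed
  then show ?thesis using L2_measurable[OF assms(1)] by (auto simp: ess_bounded_def)
qed

definition cell_monomial :: "(real^'n) set \<Rightarrow> ('n \<Rightarrow> nat) \<Rightarrow> real^'n \<Rightarrow> real" where
  "cell_monomial K e x = indicator K x * monomial e x"

lemma cell_monomial_L2:
  assumes "K \<in> \<T>"
  shows "cell_monomial K e \<in> L2_space \<Omega>"
proof (rule ess_bounded_L2)
  have "bounded (monomial e ` K)"
    by (intro compact_imp_bounded compact_continuous_image continuous_on_monomial compact_cell assms)
  then obtain C where C: "\<And>x. x \<in> K \<Longrightarrow> norm (monomial e x) \<le> C" by (auto simp: bounded_iff)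
  have "norm (cell_monomial K e x) \<le> \<bar>C\<bar>" for x
    using C[of x] by (auto simp: cell_monomial_def indicator_def)
  moreover have "cell_monomial K e \<in> borel_measurable borel"
    unfolding cell_monomial_def
    using borel_measurable_continuous_onI[OF continuous_on_monomial] borel_compact[OF compact_cell[OF assms]]
    by (intro borel_measurable_times borel_measurable_indicator) auto
  ultimately show "ess_bounded (cell_monomial K e)"
    by (auto simp: ess_bounded_def intro: measurable_M)
qed

text \<open>On a cell \<open>q\<close> is a combination of monomials, so the integral of \<open>q\<^sup>2\<close> over the cell is a
  combination of the moments of \<open>q\<close>. Hence finitely many functionals detect whether \<open>q = 0\<close>.\<close>

lemma piecewise_poly_moments:
  assumes q: "q \<in> L2_space \<Omega>" "q \<in> piecewise_poly \<T> m"
    and 0: "\<And>K e. K \<in> \<T> \<Longrightarrow> e \<in> multi_indices m \<Longrightarrow> L2_inner \<Omega> q (cell_monomial K e) = 0"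
  shows "AE x in M. q x = 0"
proof -
  have "AE x in M. x \<in> K \<longrightarrow> q x = 0" if K: "K \<in> \<T>" for K
  proof -
    obtain p where p: "p \<in> poly_space m" "AE x in lebesgue_on K. q x = p x"
      using q(2) K by (auto simp: piecewise_poly_def)
    obtain c where c: "\<And>x. p x = (\<Sum>e\<in>multi_indices m. c e * monomial e x)"
      using p(1) by (auto simp: poly_space_iff)
    define P where "P = (\<Sum>e\<in>multi_indices m. c e *\<^sub>R cell_monomial K e)"
    have PL: "P \<in> L2_space \<Omega>"
      unfolding P_def using cell_monomial_L2[OF K]
      by (intro subspace_sum[OF subspace_L2] subspace_scale[OF subspace_L2])
    have Pp: "P x = indicator K x * p x" for x
      by (simp add: P_def c cell_monomial_def sum_distrib_left mult_ac)
    have "L2_inner \<Omega> q P = (\<Sum>e\<in>multi_indices m. c e * L2_inner \<Omega> q (cell_monomial K e))"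
      unfolding P_def
      by (rule lin_on_sum_scaleR[OF psd_on_lin[OF psd_L2 q(1)] subspace_L2 cell_monomial_L2[OF K]])
    then have z: "L2_inner \<Omega> q P = 0" using 0[OF K] by simp
    have ae: "AE x in M. q x * P x = indicator K x * (q x)\<^sup>2"
      using AE_cell[OF K p(2)] by eventually_elim (auto simp: Pp indicator_def power2_eq_square)
    have int: "integrable M (\<lambda>x. q x * P x)" using L2_inner_integrable[OF q(1) PL] by simp
    have "AE x in M. q x * P x = 0"
    proof (subst integral_nonneg_eq_0_iff_AE[OF int, symmetric])
      show "AE x in M. 0 \<le> q x * P x" using ae by eventually_elim simp
      show "(\<integral>x. q x * P x \<partial>M) = 0" using z by (simp add: L2_inner_def)
    qed
    then show ?thesis using ae by eventually_elim (auto simp: indicator_def)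
  qed
  then have "AE x in M. \<forall>K\<in>\<T>. x \<in> K \<longrightarrow> q x = 0" by (intro AE_finite_allI[OF finite_cells])
  then show ?thesis using AE_space by eventually_elim (use domain_cells in auto)
qed

section \<open>The discrete spaces modulo null functions\<close>

lemma X_velocity: "v \<in> X \<Longrightarrow> v \<in> velocity_space \<Omega>"
  by (simp add: fe_velocity_def)

lemma X_H1: "v \<in> X \<Longrightarrow> v \<in> H1_space \<Omega>"
  by (simp add: X_velocity velocity_H1)

lemma X_L2: "v \<in> X \<Longrightarrow> v \<in> L2_space \<Omega>"
  by (simp add: X_velocity velocity_L2)

lemma V_X: "v \<in> V \<Longrightarrow> v \<in> X"
  by (simp add: fe_div_free_def)

lemma Q_L2: "q \<in> Q \<Longrightarrow> q \<in> L2_space \<Omega>"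
  by (simp add: fe_pressure_def pressure_space_def)

lemma X_ess_bounded:
  assumes "v \<in> X"
  shows "ess_bounded v"
proof -
  have "ess_bounded (\<lambda>x. v x $ i)" for i
    using assms L2_bounded_linear[OF bounded_linear_vec_nth X_L2[OF assms]]
    by (intro piecewise_poly_bounded) (auto simp: fe_velocity_def)
  then have "\<forall>i. \<exists>C. AE x in M. \<bar>v x $ i\<bar> \<le> C" by (simp add: ess_bounded_def)
  then obtain C where "\<And>i. AE x in M. \<bar>v x $ i\<bar> \<le> C i" by metis
  then have "AE x in M. \<forall>i. \<bar>v x $ i\<bar> \<le> C i" by (simp add: AE_all_countable)
  then have "AE x in M. norm (v x) \<le> (\<Sum>i\<in>UNIV. C i)"
    by eventually_elim (auto intro!: order_trans[OF norm_le_l1_cart] sum_mono)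
  then show ?thesis using L2_measurable[OF X_L2[OF assms]] by (auto simp: ess_bounded_def)
qed

lemma subspace_X: "subspace X"
proof (rule subspaceI)
  note W = subspace_velocity and P = subspace_piecewise_poly[of \<T> k]
  have comp: "(\<lambda>x. (0 :: real^'n \<Rightarrow> real^'n) x $ i) = 0"
    "(\<lambda>x. (u + v) x $ i) = (\<lambda>x. u x $ i) + (\<lambda>x. v x $ i)"
    "(\<lambda>x. (c *\<^sub>R u) x $ i) = c *\<^sub>R (\<lambda>x. u x $ i)" for u v :: "real^'n \<Rightarrow> real^'n" and c i
    by (simp_all add: fun_eq_iff)
  show "0 \<in> X" "\<And>u v. u \<in> X \<Longrightarrow> v \<in> X \<Longrightarrow> u + v \<in> X" "\<And>c u. u \<in> X \<Longrightarrow> c *\<^sub>R u \<in> X"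
    unfolding fe_velocity_def mem_Collect_eq comp
    by (auto intro: subspace_0[OF W] subspace_0[OF P] subspace_add[OF W] subspace_add[OF P]
        subspace_scale[OF W] subspace_scale[OF P])
qed

lemma subspace_Q: "subspace Q"
proof -
  have one: "(\<lambda>x. 1::real) \<in> L2_space \<Omega>" by (simp add: L2_space_def)
  have eq: "Q = {q \<in> L2_space \<Omega>. L2_inner \<Omega> (\<lambda>x. 1::real) q = 0} \<inter> piecewise_poly \<T> (k - 1)"
    by (auto simp: fe_pressure_def pressure_space_def L2_inner_def)
  have "subspace {q \<in> L2_space \<Omega>. L2_inner \<Omega> (\<lambda>x. 1::real) q = 0}"
    using subspace_L2 psd_on_lin[OF psd_L2 one] lin_on_0[OF psd_on_lin[OF psd_L2 one] subspace_L2]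
    by (auto simp: subspace_def lin_on_def)
  then show ?thesis unfolding eq by (intro subspace_inter subspace_piecewise_poly)
qed

lemma op_lin_X:
  shows "op_lin X (\<lambda>u. u)" "op_lin X (grad \<Omega>)" "op_lin X (div_field \<Omega>)" "op_lin X (sym_grad \<Omega>)"
  using op_lin_id[of X] op_lin_subset[OF op_lin_grad, of X] op_lin_subset[OF op_lin_div, of X]
    op_lin_subset[OF op_lin_sym_grad, of X] X_L2 X_H1 by auto

lemmas X_grad_L2 = op_lin_L2[OF op_lin_X(2)] and X_div_L2 = op_lin_L2[OF op_lin_X(3)]

lemma subspace_V: "subspace V"
proof -
  have lin: "lin_on X (\<lambda>v. L2_inner \<Omega> (div_field \<Omega> v) q)" if "q \<in> Q" for q
    by (rule op_lin_inner_left[OF op_lin_X(3) subspace_X Q_L2[OF that]])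
  show ?thesis
    unfolding fe_div_free_def
    using subspace_X lin lin_on_0[OF lin subspace_X] by (auto simp: subspace_def lin_on_def)
qed

lemma X_null_iff: "v \<in> X \<Longrightarrow> L2_inner \<Omega> v v = 0 \<longleftrightarrow> (AE x in M. v x = 0)"
  by (simp add: L2_inner_self_eq_0_iff X_L2)

text \<open>Finite dimension modulo null functions is witnessed by the moments of the components.
  The subspace and the form are left free because bases are needed for the L2 product on
  \<open>X\<close> and \<open>V\<close>, for the gradient form on \<open>X\<close> and for the
  filter form on \<open>V\<close>.\<close>

lemma ex_onb_X:
  assumes "subspace S" "S \<subseteq> X" "psd_on S B"
    and null: "\<And>v. v \<in> S \<Longrightarrow> AE x in M. v x = 0 \<Longrightarrow> B v v = 0"
  shows "\<exists>m e. onb_on S B m e"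
proof (rule ex_onb_on_finite[OF assms(1,3)])
  let ?I = "(UNIV :: 'n set) \<times> \<T> \<times> (multi_indices k :: ('n \<Rightarrow> nat) set)"
  let ?d = "\<lambda>(i, K, e) v. L2_inner \<Omega> (cell_monomial K e) (\<lambda>x. v x $ i)"
  show "finite ?I" by (intro finite_cartesian_product finite_cells finite_multi_indices) simp
  show "lin_on S (?d z)" if "z \<in> ?I" for z
    using that
    by (auto intro!: op_lin_inner[OF op_lin_comp[OF op_lin_subset[OF op_lin_X(1) assms(2)] bounded_linear_vec_nth] assms(1)]
        cell_monomial_L2)
  fix v assume v: "v \<in> S" and z: "\<forall>z\<in>?I. ?d z v = 0"
  then have vX: "v \<in> X" using assms(2) by auto
  have "AE x in M. v x $ i = 0" for i
  proof (rule piecewise_poly_moments)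
    show "(\<lambda>x. v x $ i) \<in> L2_space \<Omega>" by (rule L2_bounded_linear[OF bounded_linear_vec_nth X_L2[OF vX]])
    show "(\<lambda>x. v x $ i) \<in> piecewise_poly \<T> k" using vX by (simp add: fe_velocity_def)
    show "L2_inner \<Omega> (\<lambda>x. v x $ i) (cell_monomial K e) = 0" if "K \<in> \<T>" "e \<in> multi_indices k" for K e
      using z that by (auto simp: L2_inner_commute)
  qed
  then have "AE x in M. \<forall>i. v x $ i = 0" by (simp add: AE_all_countable)
  then have "AE x in M. v x = 0" by eventually_elim (simp add: vec_eq_iff)
  then show "B v v = 0" by (rule null[OF v])
qed

lemma ex_onb_Q: "\<exists>m e. onb_on Q (L2_inner \<Omega>) m e"
proof (rule ex_onb_on_finite[OF subspace_Q])
  let ?I = "\<T> \<times> (multi_indices (k - 1) :: ('n \<Rightarrow> nat) set)"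
  let ?d = "\<lambda>(K, e) v. L2_inner \<Omega> (cell_monomial K e) v"
  show "psd_on Q (L2_inner \<Omega>)" using psd_on_subset[OF psd_L2, of Q] Q_L2 by auto
  show "finite ?I" by (intro finite_cartesian_product finite_cells finite_multi_indices)
  show "lin_on Q (?d z)" if "z \<in> ?I" for z
    using that Q_L2 by (auto intro!: lin_on_subset[OF psd_on_lin[OF psd_L2 cell_monomial_L2]])
  fix q assume q: "q \<in> Q" and z: "\<forall>z\<in>?I. ?d z q = 0"
  have "AE x in M. q x = 0"
  proof (rule piecewise_poly_moments[OF Q_L2[OF q]])
    show "q \<in> piecewise_poly \<T> (k - 1)" using q by (simp add: fe_pressure_def)
    show "L2_inner \<Omega> q (cell_monomial K e) = 0" if "K \<in> \<T>" "e \<in> multi_indices (k - 1)" for K e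
      using z that by (auto simp: L2_inner_commute)
  qed
  then show "L2_inner \<Omega> q q = 0" using L2_inner_self_eq_0_iff[OF Q_L2[OF q]] by simp
qed

lemma psd_X: "psd_on X (L2_inner \<Omega>)"
  using psd_on_subset[OF psd_L2, of X] X_L2 by auto

lemma psd_grad: "psd_on X (\<lambda>u v. L2_inner \<Omega> (grad \<Omega> u) (grad \<Omega> v))"
  by (rule op_lin_psd[OF op_lin_X(2) subspace_X])

lemma onb_X_L2: "\<exists>m e. onb_on X (L2_inner \<Omega>) m e"
  by (rule ex_onb_X[OF subspace_X subset_refl psd_X]) (simp add: X_null_iff)

text \<open>By \<open>velocity_grad_0\<close> every null vector of the gradient form vanishes almost
  everywhere, so on the finite-dimensional quotient the L2 product is bounded by that form. The
  inf-sup condition measures velocities by their gradients, whence the need for this bound.\<close>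

lemma poincare_inequality: "\<exists>C\<ge>0. \<forall>v\<in>X. L2_norm \<Omega> v \<le> C * L2_norm \<Omega> (grad \<Omega> v)"
proof -
  let ?a = "\<lambda>u v. L2_inner \<Omega> (grad \<Omega> u) (grad \<Omega> v)"
  have "\<exists>m e. onb_on X ?a m e"
    by (rule ex_onb_X[OF subspace_X subset_refl psd_grad]) (simp add: op_lin_inner_null[OF op_lin_X(2)])
  then obtain m e where onb: "onb_on X ?a m e" by blast
  have null: "L2_inner \<Omega> u v = 0" if "u \<in> X" "v \<in> X" "?a v v = 0" for u v
  proof -
    have "AE x in M. grad \<Omega> v x = 0" using that(3) L2_inner_self_eq_0_iff[OF X_grad_L2[OF that(2)]] by simp
    then have "AE x in M. v x = 0" by (rule velocity_grad_0[OF X_velocity[OF that(2)]])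
    then show ?thesis by (rule op_lin_inner_null(2)[OF op_lin_X(1) that(2)])
  qed
  have bound: "\<exists>C\<ge>0. \<forall>u\<in>X. \<forall>v\<in>X. \<bar>L2_inner \<Omega> u v\<bar> \<le> C * sqrt (?a u u) * sqrt (?a v v)"
  proof (rule onb_on_bounded2[OF onb subspace_X psd_grad])
    show "L2_inner \<Omega> u v = 0" if "u \<in> X" "v \<in> X" "?a u u = 0" for u v
      using null[OF that(2,1,3)] by (simp add: L2_inner_commute)
  qed (auto intro: psd_on_lin[OF psd_X] psd_on_lin_left[OF psd_X subspace_X] null)
  obtain C where C: "C \<ge> 0" "\<And>u v. u \<in> X \<Longrightarrow> v \<in> X \<Longrightarrow> \<bar>L2_inner \<Omega> u v\<bar> \<le> C * sqrt (?a u u) * sqrt (?a v v)"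
    using bound by blast
  have "L2_norm \<Omega> v \<le> sqrt C * L2_norm \<Omega> (grad \<Omega> v)" if "v \<in> X" for v
  proof -
    have "L2_inner \<Omega> v v \<le> C * (L2_norm \<Omega> (grad \<Omega> v))\<^sup>2"
      using C(2)[OF that that] by (simp add: L2_norm_def[symmetric] power2_eq_square)
    then have "sqrt (L2_inner \<Omega> v v) \<le> sqrt (C * (L2_norm \<Omega> (grad \<Omega> v))\<^sup>2)" by (rule real_sqrt_le_mono)
    then show ?thesis by (simp add: L2_norm_def[symmetric] real_sqrt_mult)
  qed
  then show ?thesis using C(1) by (intro exI[of _ "sqrt C"]) auto
qed

text \<open>Norm equivalence in finite dimension takes the place of a scaling argument on each cell,
  so the constant depends on the triangulation. It converts L2 estimates of discrete velocities into
  H1 estimates.\<close>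

lemma inverse_inequality: "\<exists>C\<ge>0. \<forall>v\<in>X. H1_norm \<Omega> v \<le> C * L2_norm \<Omega> v"
proof -
  obtain m e where onb: "onb_on X (L2_inner \<Omega>) m e" using onb_X_L2 by blast
  have psd: "psd_on X H1_inner" using psd_on_subset[OF psd_H1, of X] X_H1 by auto
  have null: "H1_inner u v = 0" if "u \<in> X" "v \<in> X" "L2_inner \<Omega> v v = 0" for u v
    using that op_lin_inner_null(2)[OF op_lin_X(1) that(2)] op_lin_inner_null(2)[OF op_lin_X(2) that(2)]
    by (simp add: X_null_iff H1_inner_def)
  have bound: "\<exists>C\<ge>0. \<forall>u\<in>X. \<forall>v\<in>X. \<bar>H1_inner u v\<bar> \<le> C * sqrt (L2_inner \<Omega> u u) * sqrt (L2_inner \<Omega> v v)"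
  proof (rule onb_on_bounded2[OF onb subspace_X psd_X])
    show "H1_inner u v = 0" if "u \<in> X" "v \<in> X" "L2_inner \<Omega> u u = 0" for u v
      using null[OF that(2,1,3)] psd_on_sym[OF psd that(1,2)] by simp
  qed (auto intro: psd_on_lin[OF psd] psd_on_lin_left[OF psd subspace_X] null)
  obtain C where C: "C \<ge> 0"
    "\<And>u v. u \<in> X \<Longrightarrow> v \<in> X \<Longrightarrow> \<bar>H1_inner u v\<bar> \<le> C * sqrt (L2_inner \<Omega> u u) * sqrt (L2_inner \<Omega> v v)"
    using bound by blast
  have "H1_norm \<Omega> v \<le> sqrt C * L2_norm \<Omega> v" if "v \<in> X" for v
  proof -
    have "H1_inner v v \<le> C * (L2_norm \<Omega> v)\<^sup>2"
      using C(2)[OF that that] by (simp add: L2_norm_def[symmetric] power2_eq_square)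
    then have "sqrt (H1_inner v v) \<le> sqrt (C * (L2_norm \<Omega> v)\<^sup>2)" by (rule real_sqrt_le_mono)
    then show ?thesis by (simp add: H1_norm_eq real_sqrt_mult)
  qed
  then show ?thesis using C(1) by (intro exI[of _ "sqrt C"]) auto
qed

section \<open>The convective form on discrete velocities\<close>

lemma emac_lin:
  assumes "u \<in> X" "v \<in> X" "w \<in> X"
  shows "lin_on X (\<lambda>u. emac_form \<Omega> u v w)" "lin_on X (\<lambda>v. emac_form \<Omega> u v w)" "lin_on X (emac_form \<Omega> u v)"
proof -
  note mv = bounded_bilinear_matrix_vector and sm = bounded_bilinear_scaleR
  note b = X_ess_bounded
  note S = op_lin_L2[OF op_lin_X(4)] and D = X_div_L2
  show "lin_on X (\<lambda>u. emac_form \<Omega> u v w)"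
    unfolding emac_form_def
    by (intro lin_on_compose_add lin_on_compose_mult op_lin_inner_left[OF _ subspace_X X_L2[OF assms(3)]]
        op_lin_bilinear[OF op_lin_X(4) mv b[OF assms(2)]] op_lin_bilinear[OF op_lin_X(3) sm b[OF assms(2)]])
  show "lin_on X (\<lambda>v. emac_form \<Omega> u v w)"
    unfolding emac_form_def
    by (intro lin_on_compose_add lin_on_compose_mult op_lin_inner_left[OF _ subspace_X X_L2[OF assms(3)]]
        op_lin_bilinear_right[OF b mv S[OF assms(1)]] op_lin_bilinear_right[OF b sm D[OF assms(1)]])
  show "lin_on X (emac_form \<Omega> u v)"
    unfolding emac_form_def[abs_def]
    by (intro lin_on_compose_add lin_on_compose_mult op_lin_inner[OF op_lin_X(1) subspace_X]
        L2_bilinear[OF mv S[OF assms(1)] b[OF assms(2)]] L2_bilinear[OF sm D[OF assms(1)] b[OF assms(2)]])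
qed

lemma emac_null:
  assumes "u \<in> X" "v \<in> X" "w \<in> X"
  shows "AE x in M. u x = 0 \<Longrightarrow> emac_form \<Omega> u v w = 0" "AE x in M. v x = 0 \<Longrightarrow> emac_form \<Omega> u v w = 0"
    "AE x in M. w x = 0 \<Longrightarrow> emac_form \<Omega> u v w = 0"
proof -
  note mv = bounded_bilinear_matrix_vector and sm = bounded_bilinear_scaleR
  note b = X_ess_bounded
  note S = op_lin_L2[OF op_lin_X(4)] and D = X_div_L2
  show "emac_form \<Omega> u v w = 0" if "AE x in M. u x = 0"
    unfolding emac_form_def
    using op_lin_inner_null(1)[OF op_lin_bilinear[OF op_lin_X(4) mv b[OF assms(2)]] assms(1) that]
      op_lin_inner_null(1)[OF op_lin_bilinear[OF op_lin_X(3) sm b[OF assms(2)]] assms(1) that] by simp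
  show "emac_form \<Omega> u v w = 0" if "AE x in M. v x = 0"
    unfolding emac_form_def
    using op_lin_inner_null(1)[OF op_lin_bilinear_right[OF b mv S[OF assms(1)]] assms(2) that]
      op_lin_inner_null(1)[OF op_lin_bilinear_right[OF b sm D[OF assms(1)]] assms(2) that] by simp
  show "emac_form \<Omega> u v w = 0" if "AE x in M. w x = 0"
    unfolding emac_form_def using op_lin_inner_null(2)[OF op_lin_X(1) assms(3) that] by simp
qed

lemma emac_bounded:
  "\<exists>C\<ge>0. \<forall>u\<in>X. \<forall>v\<in>X. \<forall>w\<in>X. \<bar>emac_form \<Omega> u v w\<bar> \<le> C * L2_norm \<Omega> u * L2_norm \<Omega> v * L2_norm \<Omega> w"
proof -
  obtain m e where onb: "onb_on X (L2_inner \<Omega>) m e" using onb_X_L2 by blast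
  show ?thesis
    unfolding L2_norm_def
    by (rule onb_on_bounded3[OF onb subspace_X psd_X]) (auto simp: emac_lin X_null_iff emac_null)
qed

lemma emac_self: "w \<in> X \<Longrightarrow> emac_form \<Omega> w w w = 0"
  by (intro emac_form_self_eq_0 X_velocity X_ess_bounded)

section \<open>Representation of functionals by velocities and pressures\<close>

text \<open>Inverts the discrete filter: applied to the filter form with a fixed first argument
  \<open>w\<close>, it yields the velocity whose filtered velocity is \<open>w\<close>.\<close>

lemma riesz_V:
  assumes "lin_on V l" "\<And>v. v \<in> V \<Longrightarrow> AE x in M. v x = 0 \<Longrightarrow> l v = 0"
  shows "\<exists>r\<in>V. \<forall>v\<in>V. L2_inner \<Omega> r v = l v"
proof -
  have psd: "psd_on V (L2_inner \<Omega>)" using psd_on_subset[OF psd_X, of V] V_X by auto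
  obtain m e where "onb_on V (L2_inner \<Omega>) m e"
    using ex_onb_X[OF subspace_V _ psd] V_X X_null_iff by blast
  then show ?thesis
    by (rule onb_on_riesz[OF _ subspace_V psd assms(1)]) (simp add: assms(2) X_null_iff V_X)
qed

text \<open>A basis of \<open>Q\<close> reduces the divergence constraint to finitely many
  functionals whose common kernel in \<open>X\<close> is \<open>V\<close>. The coefficients given by
  \<open>functional_in_span\<close> are then the coordinates of the pressure.\<close>

lemma ex_pressure:
  assumes l: "lin_on X l" and 0: "\<And>v. v \<in> V \<Longrightarrow> l v = 0"
  shows "\<exists>q\<in>Q. \<forall>v\<in>X. L2_inner \<Omega> q (div_field \<Omega> v) = l v"
proof -
  obtain n e where onb: "onb_on Q (L2_inner \<Omega>) n e" using ex_onb_Q by blast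
  note eQ = onb_on_mem[OF onb]
  have lin: "lin_on X (\<lambda>v. L2_inner \<Omega> (e i) (div_field \<Omega> v))" if "i < n" for i
    by (rule op_lin_inner[OF op_lin_X(3) subspace_X Q_L2[OF eQ[OF that]]])
  have "\<exists>c. \<forall>v\<in>X. l v = (\<Sum>i<n. c i * L2_inner \<Omega> (e i) (div_field \<Omega> v))"
  proof (rule functional_in_span[OF subspace_X l lin])
    fix v assume v: "v \<in> X" and z: "\<forall>i<n. L2_inner \<Omega> (e i) (div_field \<Omega> v) = 0"
    have "L2_inner \<Omega> (div_field \<Omega> v) q = 0" if q: "q \<in> Q" for q
    proof -
      have "L2_inner \<Omega> (div_field \<Omega> v) q = (\<Sum>i<n. L2_inner \<Omega> q (e i) * L2_inner \<Omega> (div_field \<Omega> v) (e i))"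
      proof (rule onb_on_expand[OF onb subspace_Q _ q])
        show "lin_on Q (L2_inner \<Omega> (div_field \<Omega> v))"
          using Q_L2 by (intro lin_on_subset[OF psd_on_lin[OF psd_L2 X_div_L2[OF v]]]) auto
        show "L2_inner \<Omega> (div_field \<Omega> v) p = 0" if "p \<in> Q" "L2_inner \<Omega> p p = 0" for p
          using psd_on_null(1)[OF psd_L2 subspace_L2 X_div_L2[OF v] Q_L2[OF that(1)]] that(2) by blast
      qed
      then show ?thesis using z by (simp add: L2_inner_commute[of "div_field \<Omega> v"])
    qed
    then have "v \<in> V" using v by (simp add: fe_div_free_def)
    then show "l v = 0" by (rule 0)
  qed
  then obtain c where c: "\<And>v. v \<in> X \<Longrightarrow> l v = (\<Sum>i<n. c i * L2_inner \<Omega> (e i) (div_field \<Omega> v))" by blast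
  show ?thesis
  proof (intro bexI ballI)
    let ?q = "\<Sum>i<n. c i *\<^sub>R e i"
    show "?q \<in> Q" using eQ by (intro subspace_sum[OF subspace_Q] subspace_scale[OF subspace_Q]) auto
    fix v assume v: "v \<in> X"
    have "L2_inner \<Omega> ?q (div_field \<Omega> v) = (\<Sum>i<n. c i * L2_inner \<Omega> (e i) (div_field \<Omega> v))"
      using eQ Q_L2 by (intro lin_on_sum_scaleR[OF psd_on_lin_left[OF psd_L2 subspace_L2 X_div_L2[OF v]] subspace_L2]) auto
    then show "L2_inner \<Omega> ?q (div_field \<Omega> v) = l v" using c[OF v] by simp
  qed
qed

text \<open>The form in which the inf-sup condition is applied to differences of multipliers. A
  velocity with zero gradient norm contributes the quotient \<open>x / 0 = 0\<close>, which is why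
  \<open>m\<close> is taken nonnegative.\<close>

lemma inf_sup_bound:
  assumes "inf_sup_condition \<Omega> \<T> k"
  shows "\<exists>\<beta>>0. \<forall>q\<in>Q. \<forall>m\<ge>0. (\<forall>v\<in>X. L2_inner \<Omega> q (div_field \<Omega> v) \<le> m * L2_norm \<Omega> (grad \<Omega> v)) \<longrightarrow>
    \<beta> * L2_norm \<Omega> q \<le> m"
proof -
  obtain \<beta> where \<beta>: "\<beta> > 0" "\<And>q. q \<in> Q \<Longrightarrow>
      \<beta> * L2_norm \<Omega> q \<le> (SUP v\<in>X. L2_inner \<Omega> q (div_field \<Omega> v) / L2_norm \<Omega> (grad \<Omega> v))"
    using assms unfolding inf_sup_condition_def by auto
  have "\<beta> * L2_norm \<Omega> q \<le> m"
    if q: "q \<in> Q" and m: "m \<ge> 0" and le: "\<And>v. v \<in> X \<Longrightarrow> L2_inner \<Omega> q (div_field \<Omega> v) \<le> m * L2_norm \<Omega> (grad \<Omega> v)" for q m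
  proof -
    have "(SUP v\<in>X. L2_inner \<Omega> q (div_field \<Omega> v) / L2_norm \<Omega> (grad \<Omega> v)) \<le> m"
    proof (rule cSUP_least)
      show "X \<noteq> {}" using subspace_0[OF subspace_X] by auto
      fix v assume v: "v \<in> X"
      show "L2_inner \<Omega> q (div_field \<Omega> v) / L2_norm \<Omega> (grad \<Omega> v) \<le> m"
      proof (cases "L2_norm \<Omega> (grad \<Omega> v) = 0")
        case False
        then have "L2_norm \<Omega> (grad \<Omega> v) > 0" using L2_norm_nonneg[of "grad \<Omega> v"] by linarith
        then show ?thesis using le[OF v] by (simp add: divide_simps)
      qed (simp add: m)
    qed
    then show ?thesis using \<beta>(2)[OF q] by linarith
  qed
  then show ?thesis using \<beta>(1) by (intro exI[of _ \<beta>]) auto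
qed

section \<open>The semi-discrete system\<close>

definition stiff :: "(real^'n \<Rightarrow> real^'n) \<Rightarrow> (real^'n \<Rightarrow> real^'n) \<Rightarrow> real" where
  "stiff u v = L2_inner \<Omega> (grad \<Omega> u) (grad \<Omega> v)"

definition filter_form :: "real \<Rightarrow> (real^'n \<Rightarrow> real^'n) \<Rightarrow> (real^'n \<Rightarrow> real^'n) \<Rightarrow> real" where
  "filter_form \<alpha> u v = \<alpha>\<^sup>2 * stiff u v + L2_inner \<Omega> u v"

lemma psd_stiff: "psd_on X stiff"
  using psd_grad by (simp add: stiff_def[abs_def])

lemma psd_filter_form: "psd_on X (filter_form \<alpha>)"
  unfolding filter_form_def[abs_def] by (intro psd_on_add psd_on_mult psd_stiff psd_X) simp

lemma V_subset_X: "V \<subseteq> X"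
  using V_X by auto

lemma stiff_null: "u \<in> X \<Longrightarrow> AE x in M. u x = 0 \<Longrightarrow> stiff u v = 0 \<and> stiff v u = 0"
  using op_lin_inner_null[OF op_lin_X(2)] by (simp add: stiff_def)

lemma filter_form_null: "u \<in> X \<Longrightarrow> AE x in M. u x = 0 \<Longrightarrow> filter_form \<alpha> u v = 0 \<and> filter_form \<alpha> v u = 0"
  using stiff_null op_lin_inner_null[OF op_lin_X(1)] by (simp add: filter_form_def)

lemma L2_le_filter_form: "u \<in> X \<Longrightarrow> (L2_norm \<Omega> u)\<^sup>2 \<le> filter_form \<alpha> u u"
  using psd_on_nonneg[OF psd_stiff] by (simp add: filter_form_def L2_norm_power2)

lemma filter_form_definite:
  assumes "u \<in> X" "filter_form \<alpha> u u = 0"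
  shows "AE x in M. u x = 0"
proof -
  have "L2_norm \<Omega> u = 0" using L2_le_filter_form[OF assms(1), of \<alpha>] assms(2) by simp
  then show ?thesis using L2_norm_eq_0_iff[OF X_L2[OF assms(1)]] by simp
qed

lemma V_div: "v \<in> V \<Longrightarrow> q \<in> Q \<Longrightarrow> L2_inner \<Omega> q (div_field \<Omega> v) = 0"
  by (simp add: fe_div_free_def L2_inner_commute)

lemma filter_eq_iff:
  "filter_eq \<Omega> \<T> k \<alpha> u w lam \<longleftrightarrow>
     (\<forall>v\<in>X. L2_inner \<Omega> lam (div_field \<Omega> v) + filter_form \<alpha> w v = L2_inner \<Omega> u v)"
  by (simp add: filter_eq_def filter_form_def stiff_def add.assoc)

lemma momentum_eq_iff:
  "momentum_eq \<Omega> \<T> k \<nu> f u u' P w \<longleftrightarrow>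
     (\<forall>v\<in>X. L2_inner \<Omega> u' v + emac_form \<Omega> w w v - L2_inner \<Omega> P (div_field \<Omega> v) + \<nu> * stiff u v = L2_inner \<Omega> f v)"
  by (simp add: momentum_eq_def stiff_def)

text \<open>Discretely, \<open>u = (1 - \<alpha>\<^sup>2 \<Delta>) w\<close>, so the viscous term is nonnegative when tested with \<open>w\<close>.\<close>

lemma filtered_stiff_nonneg:
  assumes u: "u \<in> V" and w: "w \<in> V" and \<alpha>: "\<alpha> > 0"
    and filter: "\<And>v. v \<in> V \<Longrightarrow> L2_inner \<Omega> u v = filter_form \<alpha> w v"
  shows "0 \<le> stiff u w"
proof -
  note uX = V_X[OF u] and wX = V_X[OF w]
  let ?u = "L2_norm \<Omega> u" and ?w = "L2_norm \<Omega> w"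
  have cs: "L2_inner \<Omega> u w \<le> ?u * ?w"
    using L2_cauchy_schwarz[OF X_L2[OF uX] X_L2[OF wX]] by linarith
  \<comment> \<open>The filter does not increase the L2 norm: the squared norm of \<open>w\<close>
    is at most \<open>m(w, w) = (u, w)\<close>, so \<open>w\<close> is no larger than
    \<open>u\<close> and \<open>(w, u) \<le> (u, u)\<close>. Since \<open>(u, u)\<close> is
    \<open>(w, u)\<close> plus a positive multiple of \<open>stiff w u\<close>, the latter is
    nonnegative.\<close>
  have "?w\<^sup>2 \<le> L2_inner \<Omega> u w" using L2_le_filter_form[OF wX, of \<alpha>] filter[OF w] by simp
  then have "?w * ?w \<le> ?u * ?w" using cs by (simp add: power2_eq_square)
  then have "?w \<le> ?u" by (cases "?w = 0") (auto dest: mult_right_le_imp_le simp: less_le)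
  then have "?u * ?w \<le> ?u\<^sup>2" by (simp add: power2_eq_square mult_left_mono)
  then have "L2_inner \<Omega> w u \<le> L2_inner \<Omega> u u" using cs by (simp add: L2_norm_power2 L2_inner_commute)
  also have "\<dots> = \<alpha>\<^sup>2 * stiff w u + L2_inner \<Omega> w u" using filter[OF u] by (simp add: filter_form_def)
  finally have "0 \<le> \<alpha>\<^sup>2 * stiff w u" by simp
  then have "0 \<le> stiff w u" using \<alpha> by (simp add: zero_le_mult_iff)
  then show ?thesis by (simp add: stiff_def L2_inner_commute)
qed

lemma emac_sum:
  assumes "\<And>i. i \<in> I \<Longrightarrow> e i \<in> X" "v \<in> X"
  shows "emac_form \<Omega> (\<Sum>j\<in>I. y j *\<^sub>R e j) (\<Sum>j\<in>I. y j *\<^sub>R e j) v =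
    (\<Sum>j\<in>I. \<Sum>k\<in>I. emac_form \<Omega> (e j) (e k) v * (y j * y k))"
proof -
  let ?w = "\<Sum>j\<in>I. y j *\<^sub>R e j"
  have w: "?w \<in> X" using assms by (intro subspace_sum[OF subspace_X] subspace_scale[OF subspace_X]) auto
  have "emac_form \<Omega> ?w ?w v = (\<Sum>j\<in>I. y j * emac_form \<Omega> (e j) ?w v)"
    using assms by (intro lin_on_sum_scaleR[OF emac_lin(1)[OF w w assms(2)] subspace_X]) auto
  also have "\<dots> = (\<Sum>j\<in>I. y j * (\<Sum>k\<in>I. y k * emac_form \<Omega> (e j) (e k) v))"
    using assms lin_on_sum_scaleR[OF emac_lin(2)[OF _ w assms(2)] subspace_X, of _ I e y]
    by (intro sum.cong) auto
  finally show ?thesis by (simp add: sum_distrib_left mult_ac)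
qed

section \<open>Existence\<close>

lemma existence:
  assumes \<alpha>: "\<alpha> > 0" and \<nu>: "\<nu> > 0" and T: "T > 0" and data: "emac_reg_data \<Omega> \<T> k \<alpha> T f u0 w0"
  shows "\<exists>u P w lam. emac_reg_solution \<Omega> \<T> k \<nu> \<alpha> T f u0 w0 u P w lam"
proof -
  have u0: "u0 \<in> V" and w0: "w0 \<in> V" and fL2: "\<And>t. t \<in> {0..T} \<Longrightarrow> f t \<in> L2_space \<Omega>"
    and fcont: "\<And>v. v \<in> X \<Longrightarrow> continuous_on {0..T} (\<lambda>t. L2_inner \<Omega> (f t) v)"
    using data by (auto simp: emac_reg_data_def)
  obtain lam0 where lam0: "lam0 \<in> Q" "filter_eq \<Omega> \<T> k \<alpha> u0 w0 lam0"
    using data by (auto simp: emac_reg_data_def)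
  let ?m = "filter_form \<alpha>"
  have psd: "psd_on V ?m" by (rule psd_on_subset[OF psd_filter_form V_subset_X])
  have "\<exists>n e. onb_on V ?m n e"
    by (rule ex_onb_X[OF subspace_V V_subset_X psd]) (simp add: filter_form_null V_X)
  then obtain N e where onb: "onb_on V ?m N e" by blast
  have eV: "e i \<in> V" if "i < N" for i by (rule onb_on_mem[OF onb that])
  have eX: "e i \<in> X" if "i < N" for i using eV[OF that] by (rule V_X)
  \<comment> \<open>\<open>g i\<close> is the velocity whose filtered velocity is
    \<open>e i\<close>: combining the \<open>g i\<close> with the coordinates of \<open>w\<close>
    gives \<open>u\<close>.\<close>
  have "\<forall>i. \<exists>r. i < N \<longrightarrow> r \<in> V \<and> (\<forall>v\<in>V. L2_inner \<Omega> r v = ?m (e i) v)"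
  proof
    fix i
    show "\<exists>r. i < N \<longrightarrow> r \<in> V \<and> (\<forall>v\<in>V. L2_inner \<Omega> r v = ?m (e i) v)"
    proof (cases "i < N")
      case True
      have "\<exists>r\<in>V. \<forall>v\<in>V. L2_inner \<Omega> r v = ?m (e i) v"
        by (rule riesz_V[OF psd_on_lin[OF psd eV[OF True]]]) (simp add: filter_form_null V_X)
      then show ?thesis by blast
    qed simp
  qed
  then obtain g where g: "\<And>i. i < N \<Longrightarrow> g i \<in> V" "\<And>i v. i < N \<Longrightarrow> v \<in> V \<Longrightarrow> L2_inner \<Omega> (g i) v = ?m (e i) v"
    by metis
  have gX: "g i \<in> X" if "i < N" for i using g(1)[OF that] by (rule V_X)
  define lc where "lc b y = (\<Sum>i<N. y i *\<^sub>R b i)" for b :: "nat \<Rightarrow> real^'n \<Rightarrow> real^'n" and y :: "nat \<Rightarrow> real"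
  have lcV: "lc b y \<in> V" if "\<And>i. i < N \<Longrightarrow> b i \<in> V" for b y
    unfolding lc_def using that by (intro subspace_sum[OF subspace_V] subspace_scale[OF subspace_V]) auto
  have WV: "lc e y \<in> V" and UV: "lc g y \<in> V" for y using eV g(1) by (auto intro: lcV)
  note WX = V_X[OF WV] and UX = V_X[OF UV]
  have lc_lin: "l (lc b y) = (\<Sum>i<N. y i * l (b i))" if "\<And>i. i < N \<Longrightarrow> b i \<in> X" "lin_on X l" for l b y
    unfolding lc_def using that by (intro lin_on_sum_scaleR[OF _ subspace_X]) auto
  have filter: "L2_inner \<Omega> (lc g y) v = ?m (lc e y) v" if "v \<in> V" for y v
    using lc_lin[OF gX psd_on_lin_left[OF psd_X subspace_X V_X[OF that]]]
      lc_lin[OF eX psd_on_lin_left[OF psd_filter_form subspace_X V_X[OF that]]] g(2)[OF _ that]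
    by simp
  define A where "A i j = \<nu> * stiff (g j) (e i)" for i j
  define q where "q i j k = emac_form \<Omega> (e j) (e k) (e i)" for i j k
  have q_emac: "emac_form \<Omega> (lc e y) (lc e y) (e i) = (\<Sum>j<N. \<Sum>k<N. q i j k * (y j * y k))" if "i < N" for y i
    unfolding lc_def q_def using eX that by (intro emac_sum) auto
  have A_stiff: "\<nu> * stiff (lc g y) (e i) = (\<Sum>j<N. A i j * y j)" if "i < N" for y i
    using lc_lin[OF gX psd_on_lin_left[OF psd_stiff subspace_X eX[OF that]]]
    by (simp add: A_def sum_distrib_left mult_ac)
  have "\<exists>y. \<forall>i<N. y i 0 = ?m w0 (e i) \<and> (\<forall>t\<in>{0..T}. (y i has_real_derivative
     L2_inner \<Omega> (f t) (e i) - (\<Sum>j<N. \<Sum>k<N. q i j k * (y j t * y k t)) - (\<Sum>j<N. A i j * y j t)) (at t within {0..T}))"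
  proof (rule galerkin_ode)
    show "continuous_on {0..T} (\<lambda>t. L2_inner \<Omega> (f t) (e i))" if "i < N" for i by (rule fcont[OF eX[OF that]])
    fix y :: "nat \<Rightarrow> real"
    have "(\<Sum>i<N. (\<Sum>j<N. \<Sum>k<N. q i j k * (y j * y k)) * y i) = (\<Sum>i<N. y i * emac_form \<Omega> (lc e y) (lc e y) (e i))"
      using q_emac by (intro sum.cong) (auto simp: mult.commute)
    also have "\<dots> = emac_form \<Omega> (lc e y) (lc e y) (lc e y)"
      by (rule lc_lin[OF eX emac_lin(3)[OF WX WX WX], symmetric])
    finally show "(\<Sum>i<N. (\<Sum>j<N. \<Sum>k<N. q i j k * (y j * y k)) * y i) = 0" by (simp add: emac_self[OF WX])
    have "(\<Sum>i<N. (\<Sum>j<N. A i j * y j) * y i) = (\<Sum>i<N. y i * (\<nu> * stiff (lc g y) (e i)))"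
      using A_stiff by (intro sum.cong) (auto simp: mult.commute)
    also have "\<dots> = \<nu> * stiff (lc g y) (lc e y)"
      using lc_lin[OF eX psd_on_lin[OF psd_stiff UX]] by (simp add: sum_distrib_left mult_ac)
    also have "\<dots> \<ge> 0"
      using \<nu> filtered_stiff_nonneg[OF UV WV \<alpha> filter] by simp
    finally show "0 \<le> (\<Sum>i<N. (\<Sum>j<N. A i j * y j) * y i)" .
  qed (use T in simp)
  then obtain y where y0: "\<And>i. i < N \<Longrightarrow> y i 0 = ?m w0 (e i)"
    and y: "\<And>i t. i < N \<Longrightarrow> t \<in> {0..T} \<Longrightarrow> (y i has_real_derivative
     L2_inner \<Omega> (f t) (e i) - (\<Sum>j<N. \<Sum>k<N. q i j k * (y j t * y k t)) - (\<Sum>j<N. A i j * y j t)) (at t within {0..T})"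
    by blast
  define y' where "y' i t = L2_inner \<Omega> (f t) (e i) - (\<Sum>j<N. \<Sum>k<N. q i j k * (y j t * y k t)) - (\<Sum>j<N. A i j * y j t)" for i t
  define w where "w t = lc e (\<lambda>i. y i t)" for t
  define u where "u t = lc g (\<lambda>i. y i t)" for t
  define u' where "u' t = lc g (\<lambda>i. y' i t)" for t
  have wV: "w t \<in> V" and uV: "u t \<in> V" and u'V: "u' t \<in> V" for t
    unfolding w_def u_def u'_def by (rule WV UV)+
  have filt: "L2_inner \<Omega> (u t) v = ?m (w t) v" if "v \<in> V" for t v
    unfolding u_def w_def by (rule filter[OF that])
  \<comment> \<open>The residual of the momentum equation without its pressure term. It vanishes on
    \<open>V\<close>, so \<open>ex_pressure\<close> represents it by a pressure.\<close>
  define l where "l t v = L2_inner \<Omega> (u' t) v + emac_form \<Omega> (w t) (w t) v + \<nu> * stiff (u t) v - L2_inner \<Omega> (f t) v" for t v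
  have lin_l: "lin_on X (l t)" if "t \<in> {0..T}" for t
    unfolding l_def[abs_def]
    by (intro lin_on_compose_diff lin_on_compose_add lin_on_compose_mult emac_lin(3)[where w = "w t"]
        psd_on_lin[OF psd_X] psd_on_lin[OF psd_stiff] lin_on_subset[OF psd_on_lin[OF psd_L2 fL2[OF that]]]
        V_X wV uV u'V) (auto simp: X_L2)
  have l0: "l t v = 0" if t: "t \<in> {0..T}" and v: "v \<in> V" for t v
  proof -
    have "l t (e i) = 0" if i: "i < N" for i
    proof -
      \<comment> \<open>Orthonormality for the filter form turns the mass matrix into the identity:
        what remains of the time derivative is \<open>y' i t\<close>.\<close>
      have "L2_inner \<Omega> (u' t) (e i) = ?m (lc e (\<lambda>i. y' i t)) (e i)"
        unfolding u'_def by (rule filter[OF eV[OF i]])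
      also have "\<dots> = (\<Sum>j<N. y' j t * ?m (e j) (e i))"
        by (rule lc_lin[OF eX psd_on_lin_left[OF psd_filter_form subspace_X eX[OF i]]])
      also have "\<dots> = (\<Sum>j<N. if j = i then y' j t else 0)"
        using onb_on_orth[OF onb _ i] by (intro sum.cong) auto
      also have "\<dots> = y' i t" using i by simp
      finally show ?thesis
        using q_emac[OF i] A_stiff[OF i] by (simp add: l_def w_def u_def y'_def)
    qed
    moreover have "l t v = (\<Sum>i<N. ?m v (e i) * l t (e i))"
    proof (rule onb_on_expand[OF onb subspace_V lin_on_subset[OF lin_l[OF t] V_subset_X] v])
      fix v assume v: "v \<in> V" and z: "?m v v = 0"
      have n: "AE x in M. v x = 0" by (rule filter_form_definite[OF V_X[OF v] z])
      show "l t v = 0"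
        using op_lin_inner_null(2)[OF op_lin_X(1) V_X[OF v] n] stiff_null[OF V_X[OF v] n]
          emac_null(3)[OF V_X[OF wV] V_X[OF wV] V_X[OF v] n]
        by (simp add: l_def)
    qed
    ultimately show ?thesis by simp
  qed
  have "\<forall>t. \<exists>p. t \<in> {0..T} \<longrightarrow> p \<in> Q \<and> (\<forall>v\<in>X. L2_inner \<Omega> p (div_field \<Omega> v) = l t v)"
    using ex_pressure[OF lin_l l0] by blast
  then obtain P where P: "\<And>t. t \<in> {0..T} \<Longrightarrow> P t \<in> Q"
    "\<And>t v. t \<in> {0..T} \<Longrightarrow> v \<in> X \<Longrightarrow> L2_inner \<Omega> (P t) (div_field \<Omega> v) = l t v"
    by metis
  \<comment> \<open>The second multiplier arises in the same way from the residual of the filter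
    equation.\<close>
  have "\<exists>p\<in>Q. \<forall>v\<in>X. L2_inner \<Omega> p (div_field \<Omega> v) = L2_inner \<Omega> (u t) v - ?m (w t) v" for t
    by (rule ex_pressure)
       (auto intro!: lin_on_compose_diff psd_on_lin[OF psd_X] psd_on_lin[OF psd_filter_form] V_X wV uV simp: filt)
  then obtain lam where lam: "\<And>t. lam t \<in> Q"
    "\<And>t v. v \<in> X \<Longrightarrow> L2_inner \<Omega> (lam t) (div_field \<Omega> v) = L2_inner \<Omega> (u t) v - ?m (w t) v"
    by metis
  have diff: "lc b (\<lambda>i. y i s) - lc b (\<lambda>i. y i t) = (\<Sum>i<N. (y i s - y i t) *\<^sub>R b i)" for b s t
    by (simp add: lc_def sum_subtractf scaleR_diff_left)
  have cont: "L2_continuous_on \<Omega> {0..T} (\<lambda>t. lc b (\<lambda>i. y i t))" if b: "\<And>i. i < N \<Longrightarrow> b i \<in> X" for b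
    unfolding L2_continuous_on_iff diff
  proof (intro ballI L2_norm_sum_tendsto_0)
    fix t i assume t: "t \<in> {0..T}" and i: "i \<in> {..<N}"
    have "continuous (at t within {0..T}) (y i)" using y[OF _ t, of i] i by (auto intro: DERIV_continuous)
    then have "((\<lambda>s. y i s) \<longlongrightarrow> y i t) (at t within {0..T})" by (simp add: continuous_within)
    then show "((\<lambda>s. y i s - y i t) \<longlongrightarrow> 0) (at t within {0..T})" by (rule LIM_zero)
  qed (use b X_L2 in auto)
  have deriv: "has_L2_derivative \<Omega> u (u' t) t {0..T}" if t: "t \<in> {0..T}" for t
  proof -
    have eq: "inverse (s - t) *\<^sub>R (u s - u t) - u' t = (\<Sum>i<N. ((y i s - y i t) / (s - t) - y' i t) *\<^sub>R g i)" for s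
      unfolding u_def diff unfolding u'_def lc_def
      by (simp add: scaleR_sum_right sum_subtractf[symmetric] scaleR_diff_left[symmetric] divide_inverse mult.commute)
    show ?thesis
      unfolding has_L2_derivative_iff eq
    proof (rule L2_norm_sum_tendsto_0)
      fix i assume i: "i \<in> {..<N}"
      then show "((\<lambda>s. (y i s - y i t) / (s - t) - y' i t) \<longlongrightarrow> 0) (at t within {0..T})"
        using y[OF _ t, of i] unfolding has_field_derivative_iff y'_def by (intro LIM_zero) auto
    qed (use gX X_L2 in auto)
  qed
  have w0_eq: "AE x in M. w 0 x = w0 x"
  proof -
    have r: "?m (w0 - w 0) (w0 - w 0) = 0"
    proof -
      have "w 0 = (\<Sum>i<N. ?m w0 (e i) *\<^sub>R e i)" unfolding w_def lc_def using y0 by (intro sum.cong) auto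
      then show ?thesis using onb w0 by (simp add: onb_on_def Let_def)
    qed
    have "AE x in M. (w0 - w 0) x = 0"
      by (rule filter_form_definite[OF subspace_diff[OF subspace_X V_X[OF w0] V_X[OF wV]] r])
    then show ?thesis by eventually_elim simp
  qed
  \<comment> \<open>The compatibility of the initial data enters here: on \<open>V\<close> both
    \<open>u 0\<close> and \<open>u0\<close> are represented by the filter form of
    \<open>w0\<close>, so their difference is orthogonal to itself.\<close>
  have u0_eq: "AE x in M. u 0 x = u0 x"
  proof -
    define d where "d = u 0 - u0"
    have dV: "d \<in> V" unfolding d_def by (rule subspace_diff[OF subspace_V uV u0])
    have "L2_inner \<Omega> (u 0) d = ?m (w 0) d" by (rule filt[OF dV])
    also have "?m (w 0) d = ?m w0 d"
    proof -
      have wd: "w 0 - w0 \<in> X" by (rule subspace_diff[OF subspace_X V_X[OF wV] V_X[OF w0]])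
      have "AE x in M. (w 0 - w0) x = 0" using w0_eq by eventually_elim simp
      then have "?m (w 0 - w0) d = 0" using filter_form_null[OF wd] by blast
      then show ?thesis
        using lin_on_diff[OF psd_on_lin_left[OF psd_filter_form subspace_X V_X[OF dV]] subspace_X V_X[OF wV] V_X[OF w0]]
        by simp
    qed
    also have "\<dots> = L2_inner \<Omega> u0 d"
      using lam0(2) V_div[OF dV lam0(1)] V_X[OF dV] unfolding filter_eq_iff by (metis add_0)
    finally have "L2_inner \<Omega> d d = 0"
      using L2_inner_diff_left[OF X_L2[OF V_X[OF uV]] X_L2[OF V_X[OF u0]] X_L2[OF V_X[OF dV]], of 0]
      by (simp flip: d_def)
    then have "AE x in M. d x = 0" using X_null_iff[OF V_X[OF dV]] by simp
    then show ?thesis by eventually_elim (simp add: d_def)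
  qed
  have "emac_reg_solution \<Omega> \<T> k \<nu> \<alpha> T f u0 w0 u P w lam"
    unfolding emac_reg_solution_def
  proof (intro conjI ballI)
    show "u t \<in> X" "w t \<in> X" for t by (rule V_X uV wV)+
    show "P t \<in> Q" if "t \<in> {0<..T}" for t using that by (intro P(1)) auto
    show "lam t \<in> Q" for t by (rule lam(1))
    show "L2_continuous_on \<Omega> {0..T} u" "L2_continuous_on \<Omega> {0..T} w"
      unfolding u_def[abs_def] w_def[abs_def] using cont[of g] cont[of e] gX eX by blast+
    show "AE x in M. u 0 x = u0 x" "AE x in M. w 0 x = w0 x" by (rule u0_eq w0_eq)+
    show "incompressible_eq \<Omega> \<T> k (u t)" "incompressible_eq \<Omega> \<T> k (w t)" for t
      using uV wV by (auto simp: incompressible_eq_def fe_div_free_def)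
    show "filter_eq \<Omega> \<T> k \<alpha> (u t) (w t) (lam t)" for t
      unfolding filter_eq_iff using lam(2) by simp
    fix t assume "t \<in> {0<..T}"
    then have t: "t \<in> {0..T}" by auto
    show "\<exists>u'\<in>X. has_L2_derivative \<Omega> u u' t {0..T} \<and> momentum_eq \<Omega> \<T> k \<nu> (f t) (u t) u' (P t) (w t)"
      using deriv[OF t] V_X[OF u'V] P(2)[OF t]
      by (intro bexI[of _ "u' t"]) (auto simp: momentum_eq_iff l_def)
  qed
  then show ?thesis by blast
qed

section \<open>Stability\<close>

text \<open>In finite dimension even a functional that involves derivatives is continuous for the L2
  norm, the norm in which time derivatives are taken.\<close>

lemma functional_bounded_on_X:
  assumes "lin_on X l" "\<And>v. v \<in> X \<Longrightarrow> AE x in M. v x = 0 \<Longrightarrow> l v = 0"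
  shows "\<exists>C\<ge>0. \<forall>v\<in>X. \<bar>l v\<bar> \<le> C * L2_norm \<Omega> v"
proof -
  obtain n e where onb: "onb_on X (L2_inner \<Omega>) n e" using onb_X_L2 by blast
  have "\<bar>l v\<bar> \<le> (\<Sum>i<n. \<bar>l (e i)\<bar>) * L2_norm \<Omega> v" if "v \<in> X" for v
    unfolding L2_norm_def
    by (rule onb_on_bounded[OF onb subspace_X psd_X assms(1) _ order_refl that]) (simp add: assms(2) X_null_iff)
  then show ?thesis by (intro exI[of _ "\<Sum>i<n. \<bar>l (e i)\<bar>"]) (auto intro: sum_nonneg)
qed

text \<open>The difference quotients lie in \<open>V\<close>, and the divergence constraints are
  continuous for the L2 norm on \<open>X\<close>, so they pass to the limit.\<close>

lemma derivative_in_V: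
  assumes deriv: "has_L2_derivative \<Omega> u u' t {0..T}" and u: "\<And>s. s \<in> {0<..T} \<Longrightarrow> u s \<in> V"
    and t: "t \<in> {0<..T}" and u': "u' \<in> X"
  shows "u' \<in> V"
proof -
  have "L2_inner \<Omega> (div_field \<Omega> u') p = 0" if p: "p \<in> Q" for p
  proof -
    define l where "l v = L2_inner \<Omega> (div_field \<Omega> v) p" for v
    have lin: "lin_on X l"
      unfolding l_def[abs_def] by (rule op_lin_inner_left[OF op_lin_X(3) subspace_X Q_L2[OF p]])
    obtain C where C: "C \<ge> 0" "\<And>v. v \<in> X \<Longrightarrow> \<bar>l v\<bar> \<le> C * L2_norm \<Omega> v"
      using functional_bounded_on_X[OF lin] op_lin_inner_null(1)[OF op_lin_X(3)] unfolding l_def by blast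
    have lV: "l v = 0" if "v \<in> V" for v using that p by (simp add: l_def fe_div_free_def)
    let ?D = "\<lambda>s. inverse (s - t) *\<^sub>R (u s - u t)"
    have le: "norm (l u') \<le> C * L2_norm \<Omega> (?D s - u')" if s: "s \<in> {0<..T}" for s
    proof -
      have DV: "?D s \<in> V"
        by (intro subspace_scale[OF subspace_V] subspace_diff[OF subspace_V] u s t)
      have "l (?D s - u') = - l u'"
        using lin_on_diff[OF lin subspace_X V_X[OF DV] u'] lV[OF DV] by simp
      then show ?thesis using C(2)[OF subspace_diff[OF subspace_X V_X[OF DV] u']] by simp
    qed
    have "((\<lambda>s. l u') \<longlongrightarrow> 0) (at t within {0..T})"
    proof (rule Lim_null_comparison)
      \<comment> \<open>Membership of \<open>u s\<close> in \<open>V\<close> is available at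
        positive times; since \<open>t\<close> is positive, these fill a neighbourhood of
        it.\<close>
      have "\<forall>\<^sub>F s in at t within {0..T}. s \<in> {0<..}"
        using t by (intro eventually_at_topological[THEN iffD2] exI[of _ "{0<..}"]) auto
      moreover have "\<forall>\<^sub>F s in at t within {0..T}. s \<in> {0..T}" by (auto simp: eventually_at_filter)
      ultimately show "\<forall>\<^sub>F s in at t within {0..T}. norm (l u') \<le> C * L2_norm \<Omega> (?D s - u')"
        by eventually_elim (use le in auto)
      show "((\<lambda>s. C * L2_norm \<Omega> (?D s - u')) \<longlongrightarrow> 0) (at t within {0..T})"
        using deriv unfolding has_L2_derivative_iff by (rule tendsto_mult_right_zero)
    qed
    moreover have "at t within {0..T} \<noteq> bot"
      using t by (simp add: trivial_limit_within islimpt_Icc)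
    ultimately have "l u' = 0" using tendsto_unique[OF _ tendsto_const] by blast
    then show ?thesis by (simp add: l_def)
  qed
  then show ?thesis using u' by (simp add: fe_div_free_def)
qed

text \<open>Arranged so that for \<open>v = e\<close> the only term without the reference
  \<open>w\<close> is \<open>emac_form \<Omega> e e e\<close>, which vanishes. The energy estimate
  is thereby linear in the energy, with a rate that depends on \<open>w\<close> alone.\<close>

lemma emac_diff:
  assumes "b \<in> X" "w \<in> X" "v \<in> X"
  defines "e \<equiv> b - w"
  shows "emac_form \<Omega> b b v - emac_form \<Omega> w w v = emac_form \<Omega> e w v + emac_form \<Omega> w e v + emac_form \<Omega> e e v"
proof -
  have e: "e \<in> X" unfolding e_def by (rule subspace_diff[OF subspace_X assms(1,2)])
  have b: "b = w + e" by (simp add: e_def)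
  have "emac_form \<Omega> (w + e) (w + e) v = emac_form \<Omega> w (w + e) v + emac_form \<Omega> e (w + e) v"
    using lin_on_add[OF emac_lin(1)[OF e _ assms(3)] assms(2) e] assms(1) b by simp
  moreover have "emac_form \<Omega> w (w + e) v = emac_form \<Omega> w w v + emac_form \<Omega> w e v"
    by (rule lin_on_add[OF emac_lin(2)[OF assms(2) e assms(3)] assms(2) e])
  moreover have "emac_form \<Omega> e (w + e) v = emac_form \<Omega> e w v + emac_form \<Omega> e e v"
    by (rule lin_on_add[OF emac_lin(2)[OF e e assms(3)] assms(2) e])
  ultimately show ?thesis unfolding b by simp
qed

lemma solution_V:
  assumes "emac_reg_solution \<Omega> \<T> k \<nu> \<alpha> T f u0 w0 u P w lam" "t \<in> {0<..T}"
  shows "u t \<in> V" "w t \<in> V"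
  using assms unfolding emac_reg_solution_def by (auto simp: incompressible_eq_def fe_div_free_def)

text \<open>The solution \<open>(u, P, w, lam)\<close> is a fixed reference: \<open>C\<close> may
  depend on it but not on the perturbed solution. The energy controls the error of \<open>w\<close>,
  the filter equation that of \<open>u\<close>, the momentum equation the time derivative of the
  latter, and the inf-sup condition the multipliers. The bound \<delta> \<le> 1 keeps the convective
  difference, which is quadratic in the error, below a multiple of \<delta>.\<close>

lemma stability:
  assumes infsup: "inf_sup_condition \<Omega> \<T> k" and \<alpha>: "\<alpha> > 0" and \<nu>: "\<nu> > 0" and T: "T > 0"
    and data: "emac_reg_data \<Omega> \<T> k \<alpha> T f u0 w0"
    and sol: "emac_reg_solution \<Omega> \<T> k \<nu> \<alpha> T f u0 w0 u P w lam"
  shows "\<exists>C\<ge>0. \<forall>\<delta> g a0 b0 a R b \<mu>. 0 < \<delta> \<and> \<delta> \<le> 1 \<and>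
      emac_reg_data \<Omega> \<T> k \<alpha> T g a0 b0 \<and> emac_reg_solution \<Omega> \<T> k \<nu> \<alpha> T g a0 b0 a R b \<mu> \<and>
      H1_norm \<Omega> (a0 - u0) < \<delta> \<and> (\<forall>t\<in>{0..T}. L2_norm \<Omega> (g t - f t) < \<delta>) \<longrightarrow>
      (\<forall>t\<in>{0<..T}. H1_norm \<Omega> (a t - u t) \<le> C * \<delta> \<and> H1_norm \<Omega> (b t - w t) \<le> C * \<delta> \<and>
        L2_norm \<Omega> (R t - P t) \<le> C * \<delta> \<and> L2_norm \<Omega> (\<mu> t - lam t) \<le> C * \<delta>)"
proof -
  obtain Ci where Ci: "Ci \<ge> 0" "\<And>v. v \<in> X \<Longrightarrow> H1_norm \<Omega> v \<le> Ci * L2_norm \<Omega> v"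
    using inverse_inequality by blast
  obtain Cp where Cp: "Cp \<ge> 0" "\<And>v. v \<in> X \<Longrightarrow> L2_norm \<Omega> v \<le> Cp * L2_norm \<Omega> (grad \<Omega> v)"
    using poincare_inequality by blast
  obtain Ce where Ce: "Ce \<ge> 0" "\<And>u v w. u \<in> X \<Longrightarrow> v \<in> X \<Longrightarrow> w \<in> X \<Longrightarrow>
      \<bar>emac_form \<Omega> u v w\<bar> \<le> Ce * L2_norm \<Omega> u * L2_norm \<Omega> v * L2_norm \<Omega> w"
    using emac_bounded by blast
  obtain \<beta> where \<beta>: "\<beta> > 0" "\<And>p m. p \<in> Q \<Longrightarrow> m \<ge> 0 \<Longrightarrow>
      (\<And>v. v \<in> X \<Longrightarrow> L2_inner \<Omega> p (div_field \<Omega> v) \<le> m * L2_norm \<Omega> (grad \<Omega> v)) \<Longrightarrow> \<beta> * L2_norm \<Omega> p \<le> m"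
    using inf_sup_bound[OF infsup] by blast
  have uwX: "\<And>t. t \<in> {0..T} \<Longrightarrow> u t \<in> X \<and> w t \<in> X" and PQ: "\<And>t. t \<in> {0<..T} \<Longrightarrow> P t \<in> Q \<and> lam t \<in> Q"
    and ucont: "L2_continuous_on \<Omega> {0..T} u" and wcont: "L2_continuous_on \<Omega> {0..T} w"
    and u_init: "AE x in M. u 0 x = u0 x"
    using sol unfolding emac_reg_solution_def by auto
  obtain W where W: "0 \<le> W" "\<And>t. t \<in> {0..T} \<Longrightarrow> L2_norm \<Omega> (w t) \<le> W"
    using L2_continuous_norm_bounded[OF wcont _ compact_Icc] uwX X_L2 by metis
  let ?m = "filter_form \<alpha>"
  have psd: "psd_on V ?m" by (rule psd_on_subset[OF psd_filter_form V_subset_X])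
  have "\<exists>n e. onb_on V ?m n e"
    by (rule ex_onb_X[OF subspace_V V_subset_X psd]) (simp add: filter_form_null V_X)
  then obtain N e where onb: "onb_on V ?m N e" by blast
  have eV: "e i \<in> V" if "i < N" for i by (rule onb_on_mem[OF onb that])
  have eX: "e i \<in> X" if "i < N" for i using eV[OF that] by (rule V_X)
  have stiff_le: "\<bar>stiff v v'\<bar> \<le> Ci\<^sup>2 * L2_norm \<Omega> v * L2_norm \<Omega> v'" if "v \<in> X" "v' \<in> X" for v v'
  proof -
    have "\<bar>stiff v v'\<bar> \<le> L2_norm \<Omega> (grad \<Omega> v) * L2_norm \<Omega> (grad \<Omega> v')"
      unfolding stiff_def by (rule L2_cauchy_schwarz[OF X_grad_L2[OF that(1)] X_grad_L2[OF that(2)]])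
    also have "\<dots> \<le> (Ci * L2_norm \<Omega> v) * (Ci * L2_norm \<Omega> v')"
      using Ci(2)[OF that(1)] Ci(2)[OF that(2)] L2_norm_le_H1_norm(2)[of v] L2_norm_le_H1_norm(2)[of v'] Ci(1)
      by (intro mult_mono) auto
    finally show ?thesis by (simp add: power2_eq_square mult_ac)
  qed
  \<comment> \<open>The continuity constant of the filter form for the L2 norm, obtained from the
    inverse inequality.\<close>
  define Cm where "Cm = \<alpha>\<^sup>2 * Ci\<^sup>2 + 1"
  have Cm0: "Cm \<ge> 0" by (simp add: Cm_def)
  have m_le: "\<bar>?m v v'\<bar> \<le> Cm * L2_norm \<Omega> v * L2_norm \<Omega> v'" if "v \<in> X" "v' \<in> X" for v v'
  proof -
    have "\<bar>?m v v'\<bar> \<le> \<alpha>\<^sup>2 * \<bar>stiff v v'\<bar> + \<bar>L2_inner \<Omega> v v'\<bar>"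
      unfolding filter_form_def by (intro order_trans[OF abs_triangle_ineq]) (simp add: abs_mult)
    also have "\<dots> \<le> \<alpha>\<^sup>2 * (Ci\<^sup>2 * L2_norm \<Omega> v * L2_norm \<Omega> v') + L2_norm \<Omega> v * L2_norm \<Omega> v'"
      using stiff_le[OF that] L2_cauchy_schwarz[OF X_L2[OF that(1)] X_L2[OF that(2)]]
      by (intro add_mono mult_left_mono) auto
    finally show ?thesis by (simp add: Cm_def algebra_simps)
  qed
  \<comment> \<open>Chosen so that \<open>S * \<delta>\<^sup>2\<close> bounds the initial
    energy.\<close>
  define S where "S = (\<Sum>i<N. (L2_norm \<Omega> (e i))\<^sup>2)"
  have S0: "S \<ge> 0" unfolding S_def by (intro sum_nonneg) auto
  \<comment> \<open>The Gronwall rate: 1 comes from splitting the force term by Young's inequality,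
    \<open>4 * Ce * W\<close> from twice the two convective terms that contain the reference
    \<open>w\<close>.\<close>
  define L where "L = 1 + 4 * Ce * W"
  have L0: "L \<ge> 0" unfolding L_def using Ce W by (intro add_nonneg_nonneg mult_nonneg_nonneg) auto
  \<comment> \<open>The Gronwall bound at time \<open>T\<close>, with initial value
    \<open>S * \<delta>\<^sup>2\<close> and source \<open>\<delta>\<^sup>2\<close>, is
    \<open>(K * \<delta>)\<^sup>2\<close>. Thus \<open>K * \<delta>\<close> bounds the L2 error of
    \<open>w\<close>, and \<open>Ku * \<delta>\<close> will bound that of \<open>u\<close>.\<close>
  define K where "K = sqrt ((S + T) * exp (L * T))"
  have K0: "K \<ge> 0" unfolding K_def using S0 T by simp
  define Ku where "Ku = Cm * K"
  have Ku0: "Ku \<ge> 0" unfolding Ku_def using Cm0 K0 by simp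
  \<comment> \<open>The mixed convective terms give \<open>2 * W * K\<close>, the purely quadratic
    one gives \<open>K\<^sup>2\<close> once \<delta> \<le> 1 has been used.\<close>
  define Kc where "Kc = Ce * (2 * W * K + K\<^sup>2)"
  have Kc0: "Kc \<ge> 0" unfolding Kc_def using Ce W K0 by (intro mult_nonneg_nonneg add_nonneg_nonneg) auto
  \<comment> \<open>The contributions of force, convection and viscosity, in this order.\<close>
  define Kr where "Kr = 1 + Kc + \<nu> * Ci\<^sup>2 * Ku"
  have Kr0: "Kr \<ge> 0" unfolding Kr_def using Kc0 Ku0 \<nu> by (intro add_nonneg_nonneg mult_nonneg_nonneg) auto
  \<comment> \<open>One constant for all four estimates: the summands belong to \<open>u\<close>,
    \<open>w\<close>, \<open>P\<close> and \<open>lam\<close>.\<close>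
  define C where "C = Ci * Ku + Ci * K + 2 * Kr * Cp / \<beta> + (Ku + Cm * K) * Cp / \<beta>"
  have C_parts: "0 \<le> Ci * Ku" "0 \<le> Ci * K" "0 \<le> 2 * Kr * Cp / \<beta>" "0 \<le> (Ku + Cm * K) * Cp / \<beta>"
    using Ci Ku0 K0 Kr0 Cp \<beta> Cm0 by (auto intro!: mult_nonneg_nonneg divide_nonneg_nonneg add_nonneg_nonneg)
  show ?thesis
  proof (intro exI[of _ C] conjI allI impI ballI; (elim conjE)?)
    show "0 \<le> C" unfolding C_def using C_parts by simp
    fix \<delta> g a0 b0 a R b \<mu> t
    assume \<delta>: "0 < \<delta>" "\<delta> \<le> 1" and data': "emac_reg_data \<Omega> \<T> k \<alpha> T g a0 b0"
      and sol': "emac_reg_solution \<Omega> \<T> k \<nu> \<alpha> T g a0 b0 a R b \<mu>"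
      and a0: "H1_norm \<Omega> (a0 - u0) < \<delta>" and gf: "\<forall>t\<in>{0..T}. L2_norm \<Omega> (g t - f t) < \<delta>"
      and t: "t \<in> {0<..T}"
    have abX: "\<And>t. t \<in> {0..T} \<Longrightarrow> a t \<in> X \<and> b t \<in> X" and RQ: "\<And>t. t \<in> {0<..T} \<Longrightarrow> R t \<in> Q \<and> \<mu> t \<in> Q"
      and acont: "L2_continuous_on \<Omega> {0..T} a" and a_init: "AE x in M. a 0 x = a0 x"
      using sol' unfolding emac_reg_solution_def by auto
    have fL2: "f s \<in> L2_space \<Omega>" "g s \<in> L2_space \<Omega>" if "s \<in> {0..T}" for s
      using data data' that by (auto simp: emac_reg_data_def)
    define eu where "eu s = a s - u s" for s
    define ew where "ew s = b s - w s" for s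
    have euX: "eu s \<in> X" and ewX: "ew s \<in> X" if "s \<in> {0..T}" for s
      unfolding eu_def ew_def using abX[OF that] uwX[OF that] by (auto intro: subspace_diff[OF subspace_X])
    have euV: "eu s \<in> V" and ewV: "ew s \<in> V" if "s \<in> {0<..T}" for s
      unfolding eu_def ew_def using solution_V[OF sol that] solution_V[OF sol' that]
      by (auto intro: subspace_diff[OF subspace_V])
    have filterX: "L2_inner \<Omega> (\<mu> s - lam s) (div_field \<Omega> v) + ?m (ew s) v = L2_inner \<Omega> (eu s) v"
      if s: "s \<in> {0<..T}" and v: "v \<in> X" for s v
    proof -
      have s': "s \<in> {0..T}" using s by auto
      have "L2_inner \<Omega> (lam s) (div_field \<Omega> v) + ?m (w s) v = L2_inner \<Omega> (u s) v"
        using sol s v unfolding emac_reg_solution_def filter_eq_iff by blast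
      moreover have "L2_inner \<Omega> (\<mu> s) (div_field \<Omega> v) + ?m (b s) v = L2_inner \<Omega> (a s) v"
        using sol' s v unfolding emac_reg_solution_def filter_eq_iff by blast
      moreover have "?m (ew s) v = ?m (b s) v - ?m (w s) v"
        unfolding ew_def using abX[OF s'] uwX[OF s']
        by (intro lin_on_diff[OF psd_on_lin_left[OF psd_filter_form subspace_X v] subspace_X]) auto
      moreover have "L2_inner \<Omega> (eu s) v = L2_inner \<Omega> (a s) v - L2_inner \<Omega> (u s) v"
        unfolding eu_def using abX[OF s'] uwX[OF s'] v by (intro L2_inner_diff_left X_L2) auto
      moreover have "L2_inner \<Omega> (\<mu> s - lam s) (div_field \<Omega> v) = L2_inner \<Omega> (\<mu> s) (div_field \<Omega> v) - L2_inner \<Omega> (lam s) (div_field \<Omega> v)"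
        using PQ[OF s] RQ[OF s] v by (intro L2_inner_diff_left Q_L2 X_div_L2) auto
      ultimately show ?thesis by simp
    qed
    have filterV: "L2_inner \<Omega> (eu s) v = ?m (ew s) v" if s: "s \<in> {0<..T}" and v: "v \<in> V" for s v
      using filterX[OF s V_X[OF v]] V_div[OF v, of "\<mu> s - lam s"] PQ[OF s] RQ[OF s]
        subspace_diff[OF subspace_Q, of "\<mu> s" "lam s"] by simp
    \<comment> \<open>\<open>d\<close> will be the time derivative of \<open>eu\<close>. Its
      membership in \<open>V\<close> is recorded because it is later used as a test function that
      removes the pressure.\<close>
    have "\<exists>d. d \<in> V \<and>
        (\<forall>v\<in>X. ((\<lambda>r. L2_inner \<Omega> (eu r) v) has_real_derivative L2_inner \<Omega> d v) (at s within {0..T})) \<and>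
        (\<forall>v\<in>X. L2_inner \<Omega> d v + (emac_form \<Omega> (b s) (b s) v - emac_form \<Omega> (w s) (w s) v)
          - L2_inner \<Omega> (R s - P s) (div_field \<Omega> v) + \<nu> * stiff (eu s) v = L2_inner \<Omega> (g s - f s) v)"
      if s: "s \<in> {0<..T}" for s
    proof -
      have s': "s \<in> {0..T}" using s by auto
      obtain u' where u': "u' \<in> X" "has_L2_derivative \<Omega> u u' s {0..T}" "momentum_eq \<Omega> \<T> k \<nu> (f s) (u s) u' (P s) (w s)"
        using sol s unfolding emac_reg_solution_def by blast
      obtain a' where a': "a' \<in> X" "has_L2_derivative \<Omega> a a' s {0..T}" "momentum_eq \<Omega> \<T> k \<nu> (g s) (a s) a' (R s) (b s)"
        using sol' s unfolding emac_reg_solution_def by blast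
      have u'V: "u' \<in> V" by (rule derivative_in_V[OF u'(2) solution_V(1)[OF sol] s u'(1)])
      have a'V: "a' \<in> V" by (rule derivative_in_V[OF a'(2) solution_V(1)[OF sol'] s a'(1)])
      have inner_d: "L2_inner \<Omega> (a' - u') v = L2_inner \<Omega> a' v - L2_inner \<Omega> u' v" if "v \<in> X" for v
        using that by (intro L2_inner_diff_left X_L2 a' u')
      have "((\<lambda>r. L2_inner \<Omega> (eu r) v) has_real_derivative L2_inner \<Omega> (a' - u') v) (at s within {0..T})" if v: "v \<in> X" for v
      proof -
        have "((\<lambda>r. L2_inner \<Omega> (a r) v - L2_inner \<Omega> (u r) v) has_real_derivative L2_inner \<Omega> a' v - L2_inner \<Omega> u' v) (at s within {0..T})"
          using abX uwX by (intro DERIV_diff L2_derivative_inner[OF a'(2)] L2_derivative_inner[OF u'(2)] X_L2 a' u' v s') auto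
        then have "((\<lambda>r. L2_inner \<Omega> (a r) v - L2_inner \<Omega> (u r) v) has_real_derivative L2_inner \<Omega> (a' - u') v) (at s within {0..T})"
          by (simp add: inner_d[OF v])
        then show ?thesis
          by (rule has_field_derivative_transform_within[OF _ zero_less_one s'])
             (use abX uwX v in \<open>auto simp: eu_def intro!: L2_inner_diff_left[symmetric] X_L2\<close>)
      qed
      moreover have "L2_inner \<Omega> (a' - u') v + (emac_form \<Omega> (b s) (b s) v - emac_form \<Omega> (w s) (w s) v)
          - L2_inner \<Omega> (R s - P s) (div_field \<Omega> v) + \<nu> * stiff (eu s) v = L2_inner \<Omega> (g s - f s) v" if v: "v \<in> X" for v
      proof -
        have "stiff (eu s) v = stiff (a s) v - stiff (u s) v"
          unfolding eu_def using abX[OF s'] uwX[OF s']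
          by (intro lin_on_diff[OF psd_on_lin_left[OF psd_stiff subspace_X v] subspace_X]) auto
        moreover have "L2_inner \<Omega> (R s - P s) (div_field \<Omega> v) = L2_inner \<Omega> (R s) (div_field \<Omega> v) - L2_inner \<Omega> (P s) (div_field \<Omega> v)"
          using PQ[OF s] RQ[OF s] v by (intro L2_inner_diff_left Q_L2 X_div_L2) auto
        moreover have "L2_inner \<Omega> (g s - f s) v = L2_inner \<Omega> (g s) v - L2_inner \<Omega> (f s) v"
          using fL2[OF s'] X_L2[OF v] by (intro L2_inner_diff_left)
        moreover have "L2_inner \<Omega> u' v + emac_form \<Omega> (w s) (w s) v - L2_inner \<Omega> (P s) (div_field \<Omega> v) + \<nu> * stiff (u s) v = L2_inner \<Omega> (f s) v"
          using u'(3) v by (simp add: momentum_eq_iff)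
        moreover have "L2_inner \<Omega> a' v + emac_form \<Omega> (b s) (b s) v - L2_inner \<Omega> (R s) (div_field \<Omega> v) + \<nu> * stiff (a s) v = L2_inner \<Omega> (g s) v"
          using a'(3) v by (simp add: momentum_eq_iff)
        ultimately show ?thesis using inner_d[OF v] by (simp add: right_diff_distrib)
      qed
      ultimately show ?thesis using subspace_diff[OF subspace_V a'V u'V] by blast
    qed
    then obtain d where dV: "\<And>s. s \<in> {0<..T} \<Longrightarrow> d s \<in> V"
      and deriv: "\<And>s v. s \<in> {0<..T} \<Longrightarrow> v \<in> X \<Longrightarrow>
        ((\<lambda>r. L2_inner \<Omega> (eu r) v) has_real_derivative L2_inner \<Omega> (d s) v) (at s within {0..T})"
      and mom: "\<And>s v. s \<in> {0<..T} \<Longrightarrow> v \<in> X \<Longrightarrow> L2_inner \<Omega> (d s) v + (emac_form \<Omega> (b s) (b s) v - emac_form \<Omega> (w s) (w s) v)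
          - L2_inner \<Omega> (R s - P s) (div_field \<Omega> v) + \<nu> * stiff (eu s) v = L2_inner \<Omega> (g s - f s) v"
      by metis
    have gf_le: "\<bar>L2_inner \<Omega> (g s - f s) v\<bar> \<le> \<delta> * L2_norm \<Omega> v" if s: "s \<in> {0..T}" and v: "v \<in> X" for s v
    proof -
      have "\<bar>L2_inner \<Omega> (g s - f s) v\<bar> \<le> L2_norm \<Omega> (g s - f s) * L2_norm \<Omega> v"
        using fL2[OF s] by (intro L2_cauchy_schwarz X_L2[OF v] subspace_diff[OF subspace_L2])
      also have "\<dots> \<le> \<delta> * L2_norm \<Omega> v" using gf s by (intro mult_right_mono) (auto intro: less_imp_le)
      finally show ?thesis .
    qed
    \<comment> \<open>For \<open>s > 0\<close> these are the coordinates of \<open>ew\<close>,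
      expressed through \<open>eu\<close>, which has a time derivative.\<close>
    define z where "z i s = L2_inner \<Omega> (eu s) (e i)" for i s
    define E where "E s = (\<Sum>i<N. (z i s)\<^sup>2)" for s
    define E' where "E' s = (\<Sum>i<N. 2 * (z i s * L2_inner \<Omega> (d s) (e i)))" for s
    have zm: "z i s = ?m (ew s) (e i)" if "s \<in> {0<..T}" "i < N" for i s
      unfolding z_def by (rule filterV[OF that(1) eV[OF that(2)]])
    have E_m: "E s = ?m (ew s) (ew s)" if s: "s \<in> {0<..T}" for s
    proof -
      have "?m (ew s) (ew s) = (\<Sum>i<N. ?m (ew s) (e i) * ?m (ew s) (e i))"
        by (rule onb_on_expand[OF onb subspace_V psd_on_lin[OF psd ewV[OF s]] ewV[OF s]])
           (rule psd_on_null(1)[OF psd subspace_V ewV[OF s]])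
      then show ?thesis using zm[OF s] by (simp add: E_def power2_eq_square)
    qed
    have ew_le: "(L2_norm \<Omega> (ew s))\<^sup>2 \<le> E s" if s: "s \<in> {0<..T}" for s
      using L2_le_filter_form[OF V_X[OF ewV[OF s]]] E_m[OF s] by simp
    have E'_eq: "E' s = 2 * L2_inner \<Omega> (d s) (ew s)" if s: "s \<in> {0<..T}" for s
    proof -
      have "L2_inner \<Omega> (d s) (ew s) = (\<Sum>i<N. ?m (ew s) (e i) * L2_inner \<Omega> (d s) (e i))"
      proof (rule onb_on_expand[OF onb subspace_V _ ewV[OF s]])
        show "lin_on V (L2_inner \<Omega> (d s))"
          by (rule lin_on_subset[OF psd_on_lin[OF psd_X V_X[OF dV[OF s]]] V_subset_X])
        show "L2_inner \<Omega> (d s) v = 0" if "v \<in> V" "?m v v = 0" for v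
          by (rule op_lin_inner_null(2)[OF op_lin_X(1) V_X[OF that(1)] filter_form_definite[OF V_X[OF that(1)] that(2)]])
      qed
      then show ?thesis using zm[OF s] by (simp add: E'_def sum_distrib_left)
    qed
    have emac_le: "\<bar>emac_form \<Omega> (ew s) (w s) v + emac_form \<Omega> (w s) (ew s) v\<bar> \<le> 2 * Ce * W * L2_norm \<Omega> (ew s) * L2_norm \<Omega> v"
      if s: "s \<in> {0<..T}" and v: "v \<in> X" for s v
    proof -
      have s': "s \<in> {0..T}" using s by auto
      have wX: "w s \<in> X" and eX: "ew s \<in> X" using uwX[OF s'] ewX[OF s'] by auto
      have "\<bar>emac_form \<Omega> (ew s) (w s) v\<bar> \<le> Ce * L2_norm \<Omega> (ew s) * L2_norm \<Omega> (w s) * L2_norm \<Omega> v"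
        by (rule Ce(2)[OF eX wX v])
      also have "\<dots> \<le> Ce * L2_norm \<Omega> (ew s) * W * L2_norm \<Omega> v"
        using Ce(1) W(2)[OF s'] by (intro mult_right_mono mult_left_mono mult_nonneg_nonneg) auto
      finally have 1: "\<bar>emac_form \<Omega> (ew s) (w s) v\<bar> \<le> Ce * L2_norm \<Omega> (ew s) * W * L2_norm \<Omega> v" .
      have "\<bar>emac_form \<Omega> (w s) (ew s) v\<bar> \<le> Ce * L2_norm \<Omega> (w s) * L2_norm \<Omega> (ew s) * L2_norm \<Omega> v"
        by (rule Ce(2)[OF wX eX v])
      also have "\<dots> \<le> Ce * W * L2_norm \<Omega> (ew s) * L2_norm \<Omega> v"
        using Ce(1) W(2)[OF s'] by (intro mult_right_mono mult_left_mono) auto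
      finally show ?thesis using 1 by (simp add: mult_ac)
    qed
    have E'_le: "E' s \<le> L * E s + \<delta>\<^sup>2" if s: "s \<in> {0<..T}" for s
    proof -
      have s': "s \<in> {0..T}" using s by auto
      note eV = ewV[OF s] and eX = ewX[OF s']
      let ?e = "L2_norm \<Omega> (ew s)"
      \<comment> \<open>Since \<open>ew s\<close> lies in \<open>V\<close> the pressure drops out,
        and \<open>emac_self\<close> removes the term that is cubic in the error.\<close>
      have "L2_inner \<Omega> (d s) (ew s) = L2_inner \<Omega> (g s - f s) (ew s)
          - (emac_form \<Omega> (ew s) (w s) (ew s) + emac_form \<Omega> (w s) (ew s) (ew s)) - \<nu> * stiff (eu s) (ew s)"
        using mom[OF s eX] emac_diff[of "b s" "w s" "ew s"] abX[OF s'] uwX[OF s'] eX emac_self[OF eX]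
          V_div[OF eV, of "R s - P s"] subspace_diff[OF subspace_Q, of "R s" "P s"] PQ[OF s] RQ[OF s]
        by (simp add: ew_def)
      moreover have "0 \<le> \<nu> * stiff (eu s) (ew s)"
        using filtered_stiff_nonneg[OF euV[OF s] eV \<alpha> filterV[OF s]] \<nu> by simp
      ultimately have "L2_inner \<Omega> (d s) (ew s) \<le> \<delta> * ?e + 2 * Ce * W * ?e * ?e"
        using gf_le[OF s' eX] emac_le[OF s eX] by linarith
      then have "E' s \<le> 2 * \<delta> * ?e + 4 * Ce * W * ?e\<^sup>2"
        unfolding E'_eq[OF s] by (simp add: power2_eq_square algebra_simps)
      also have "2 * \<delta> * ?e \<le> \<delta>\<^sup>2 + ?e\<^sup>2" by (rule sum_squares_bound)
      finally have "E' s \<le> \<delta>\<^sup>2 + L * ?e\<^sup>2" by (simp add: L_def algebra_simps)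
      also have "L * ?e\<^sup>2 \<le> L * E s" using ew_le[OF s] L0 by (rule mult_left_mono)
      finally show ?thesis by simp
    qed
    \<comment> \<open>At time 0 the coordinates are bounded directly from the initial difference of
      \<open>u\<close>, without the filter equation.\<close>
    have E0: "E 0 \<le> S * \<delta>\<^sup>2"
    proof -
      have 0: "0 \<in> {0..T}" using T by simp
      have a0X: "a0 - u0 \<in> X"
        using data data' by (auto simp: emac_reg_data_def intro: subspace_diff[OF subspace_X] V_X)
      have "AE x in M. (eu 0) x = (a0 - u0) x" using a_init u_init by eventually_elim (simp add: eu_def)
      then have "L2_norm \<Omega> (eu 0) = L2_norm \<Omega> (a0 - u0)"
        by (intro L2_norm_cong X_L2 euX[OF 0] a0X)
      then have eu0: "L2_norm \<Omega> (eu 0) \<le> \<delta>" using L2_norm_le_H1_norm(1)[of "a0 - u0"] a0 by linarith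
      have "(z i 0)\<^sup>2 \<le> (L2_norm \<Omega> (e i))\<^sup>2 * \<delta>\<^sup>2" if i: "i < N" for i
      proof -
        have "\<bar>z i 0\<bar> \<le> L2_norm \<Omega> (eu 0) * L2_norm \<Omega> (e i)"
          unfolding z_def by (intro L2_cauchy_schwarz X_L2 euX[OF 0] eX[OF i])
        also have "\<dots> \<le> \<delta> * L2_norm \<Omega> (e i)" using eu0 by (intro mult_right_mono) auto
        finally have "\<bar>z i 0\<bar>\<^sup>2 \<le> (\<delta> * L2_norm \<Omega> (e i))\<^sup>2" by (intro power_mono) auto
        then show ?thesis by (simp add: power_mult_distrib mult.commute)
      qed
      then show ?thesis unfolding E_def S_def sum_distrib_right by (intro sum_mono) auto
    qed
    have E_le: "E s \<le> (K * \<delta>)\<^sup>2" if s: "s \<in> {0<..T}" for s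
    proof -
      have s': "s \<in> {0..T}" using s by auto
      have "E s \<le> (E 0 + \<delta>\<^sup>2 * s) * exp (L * s)"
      proof (rule gronwall[where E' = E' and T = T and C = L and D = "\<delta>\<^sup>2", OF _ _ _ L0 _ s'])
        have "continuous_on {0..T} (\<lambda>s. L2_inner \<Omega> (a s) (e i) - L2_inner \<Omega> (u s) (e i))" if "i < N" for i
          using abX uwX eX[OF that] by (intro continuous_on_diff L2_continuous_inner acont ucont X_L2) auto
        moreover have "z i s = L2_inner \<Omega> (a s) (e i) - L2_inner \<Omega> (u s) (e i)" if "i < N" "s \<in> {0..T}" for i s
          unfolding z_def eu_def using abX[OF that(2)] uwX[OF that(2)] eX[OF that(1)]
          by (intro L2_inner_diff_left X_L2) auto
        ultimately have "continuous_on {0..T} (z i)" if "i < N" for i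
          using that by (subst continuous_on_cong[OF refl]) auto
        then show "continuous_on {0..T} E" unfolding E_def by (intro continuous_intros) auto
        fix r assume r: "0 < r" "r \<le> T"
        then have rT: "r \<in> {0<..T}" by simp
        have "(z i has_real_derivative L2_inner \<Omega> (d r) (e i)) (at r within {0..T})" if "i < N" for i
          unfolding z_def[abs_def] by (rule deriv[OF rT eX[OF that]])
        then show "(E has_real_derivative E' r) (at r within {0..T})"
          unfolding E_def E'_def by (auto intro!: derivative_eq_intros sum.cong simp: mult_ac)
        show "E' r \<le> L * E r + \<delta>\<^sup>2" by (rule E'_le[OF rT])
      qed simp
      also have "\<dots> \<le> (S * \<delta>\<^sup>2 + \<delta>\<^sup>2 * T) * exp (L * T)"
        using E0 s L0 S0 by (intro mult_mono add_mono) (auto intro: mult_left_mono add_nonneg_nonneg)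
      also have "\<dots> = (K * \<delta>)\<^sup>2"
        using S0 T by (simp add: K_def power_mult_distrib algebra_simps)
      finally show ?thesis .
    qed
    have t': "t \<in> {0..T}" using t by auto
    note euV = euV[OF t] and ewV = ewV[OF t] and euX = euX[OF t'] and ewX = ewX[OF t'] and dX = V_X[OF dV[OF t]]
    have ew: "L2_norm \<Omega> (ew t) \<le> K * \<delta>"
    proof (rule power2_le_imp_le)
      show "(L2_norm \<Omega> (ew t))\<^sup>2 \<le> (K * \<delta>)\<^sup>2" using ew_le[OF t] E_le[OF t] by (rule order_trans)
      show "0 \<le> K * \<delta>" using K0 \<delta> by simp
    qed
    have eu: "L2_norm \<Omega> (eu t) \<le> Ku * \<delta>"
    proof -
      \<comment> \<open>The filter equation is tested with \<open>eu\<close> itself, and one factor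
        is then cancelled.\<close>
      have "L2_norm \<Omega> (eu t) * L2_norm \<Omega> (eu t) = ?m (ew t) (eu t)"
        using filterV[OF t euV] by (simp add: L2_norm_power2[symmetric] power2_eq_square)
      also have "\<dots> \<le> Cm * L2_norm \<Omega> (ew t) * L2_norm \<Omega> (eu t)" using m_le[OF ewX euX] by linarith
      finally have "L2_norm \<Omega> (eu t) \<le> Cm * L2_norm \<Omega> (ew t)"
        using Cm0 by (cases "L2_norm \<Omega> (eu t) = 0") (auto dest: mult_right_le_imp_le simp: less_le)
      also have "\<dots> \<le> Cm * (K * \<delta>)" using ew Cm0 by (rule mult_left_mono)
      finally show ?thesis by (simp add: Ku_def mult.assoc)
    qed
    have rest: "\<bar>L2_inner \<Omega> (g t - f t) v\<bar> + \<bar>emac_form \<Omega> (b t) (b t) v - emac_form \<Omega> (w t) (w t) v\<bar> + \<bar>\<nu> * stiff (eu t) v\<bar>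
        \<le> Kr * \<delta> * L2_norm \<Omega> v" if v: "v \<in> X" for v
    proof -
      let ?e = "L2_norm \<Omega> (ew t)" and ?v = "L2_norm \<Omega> v"
      have 1: "\<bar>emac_form \<Omega> (b t) (b t) v - emac_form \<Omega> (w t) (w t) v\<bar> \<le> Kc * \<delta> * ?v"
      proof -
        have "\<bar>emac_form \<Omega> (b t) (b t) v - emac_form \<Omega> (w t) (w t) v\<bar> \<le>
            \<bar>emac_form \<Omega> (ew t) (w t) v + emac_form \<Omega> (w t) (ew t) v\<bar> + \<bar>emac_form \<Omega> (ew t) (ew t) v\<bar>"
          using emac_diff[of "b t" "w t" v] abX[OF t'] uwX[OF t'] v unfolding ew_def[symmetric] by linarith
        also have "\<dots> \<le> 2 * Ce * W * ?e * ?v + Ce * ?e * ?e * ?v"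
          by (intro add_mono emac_le t v Ce(2) ewX)
        also have "\<dots> = Ce * (2 * W + ?e) * ?v * ?e" by (simp add: algebra_simps)
        also have "\<dots> \<le> Ce * (2 * W + K) * ?v * (K * \<delta>)"
        proof -
          \<comment> \<open>Of the two error factors in the quadratic term, one is bounded by the
            constant \<open>K\<close> and the other keeps its \<delta>.\<close>
          have "K * \<delta> \<le> K * 1" using \<delta> K0 by (intro mult_left_mono) auto
          then have "?e \<le> K" using ew by simp
          then show ?thesis using ew Ce(1) W(1) K0
            by (intro mult_mono mult_nonneg_nonneg add_nonneg_nonneg) auto
        qed
        also have "\<dots> = Kc * \<delta> * ?v" by (simp add: Kc_def power2_eq_square algebra_simps)
        finally show ?thesis .
      qed
      have 2: "\<bar>\<nu> * stiff (eu t) v\<bar> \<le> \<nu> * Ci\<^sup>2 * Ku * \<delta> * ?v"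
      proof -
        have "\<bar>\<nu> * stiff (eu t) v\<bar> \<le> \<nu> * (Ci\<^sup>2 * L2_norm \<Omega> (eu t) * ?v)"
          using stiff_le[OF euX v] \<nu> by (simp add: abs_mult)
        also have "\<dots> \<le> \<nu> * (Ci\<^sup>2 * (Ku * \<delta>) * ?v)"
          using eu \<nu> by (intro mult_left_mono mult_right_mono) auto
        finally show ?thesis by (simp add: mult_ac)
      qed
      show ?thesis using 1 2 gf_le[OF t' v] by (simp add: Kr_def algebra_simps)
    qed
    have d_le: "L2_norm \<Omega> (d t) \<le> Kr * \<delta>"
    proof -
      \<comment> \<open>Testing the momentum equation with the time derivative, which lies in
        \<open>V\<close>, removes the pressure.\<close>
      have "L2_norm \<Omega> (d t) * L2_norm \<Omega> (d t) = L2_inner \<Omega> (d t) (d t)"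
        by (simp add: L2_norm_power2[symmetric] power2_eq_square)
      also have "\<dots> \<le> Kr * \<delta> * L2_norm \<Omega> (d t)"
        using mom[OF t dX] rest[OF dX] V_div[OF dV[OF t], of "R t - P t"]
          subspace_diff[OF subspace_Q, of "R t" "P t"] PQ[OF t] RQ[OF t] by (simp add: abs_le_iff)
      finally show ?thesis
        using Kr0 \<delta> by (cases "L2_norm \<Omega> (d t) = 0") (auto dest: mult_right_le_imp_le simp: less_le)
    qed
    have pressure: "L2_norm \<Omega> (R t - P t) \<le> 2 * Kr * Cp / \<beta> * \<delta>"
    proof -
      \<comment> \<open>The factor 2 collects the time derivative and the rest of the momentum
        equation, each at most \<open>Kr * \<delta>\<close> times the norm of \<open>v\<close>;
        \<open>Cp\<close> passes to the gradient norm of the inf-sup condition.\<close>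
      have "\<beta> * L2_norm \<Omega> (R t - P t) \<le> 2 * Kr * \<delta> * Cp"
      proof (rule \<beta>(2))
        show "R t - P t \<in> Q" using PQ[OF t] RQ[OF t] by (auto intro: subspace_diff[OF subspace_Q])
        show "0 \<le> 2 * Kr * \<delta> * Cp" using Kr0 \<delta> Cp by simp
        fix v assume v: "v \<in> X"
        have "\<bar>L2_inner \<Omega> (d t) v\<bar> \<le> L2_norm \<Omega> (d t) * L2_norm \<Omega> v"
          by (rule L2_cauchy_schwarz[OF X_L2[OF dX] X_L2[OF v]])
        also have "\<dots> \<le> Kr * \<delta> * L2_norm \<Omega> v" using d_le by (intro mult_right_mono) auto
        finally have "L2_inner \<Omega> (R t - P t) (div_field \<Omega> v) \<le> 2 * Kr * \<delta> * L2_norm \<Omega> v"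
          using mom[OF t v] rest[OF v] by linarith
        also have "\<dots> \<le> 2 * Kr * \<delta> * (Cp * L2_norm \<Omega> (grad \<Omega> v))"
          using Cp(2)[OF v] Kr0 \<delta> by (intro mult_left_mono) auto
        finally show "L2_inner \<Omega> (R t - P t) (div_field \<Omega> v) \<le> 2 * Kr * \<delta> * Cp * L2_norm \<Omega> (grad \<Omega> v)"
          by (simp add: mult_ac)
      qed
      then show ?thesis using \<beta>(1) by (simp add: field_simps)
    qed
    have multiplier: "L2_norm \<Omega> (\<mu> t - lam t) \<le> (Ku + Cm * K) * Cp / \<beta> * \<delta>"
    proof -
      have "\<beta> * L2_norm \<Omega> (\<mu> t - lam t) \<le> (Ku + Cm * K) * \<delta> * Cp"
      proof (rule \<beta>(2))
        show "\<mu> t - lam t \<in> Q" using PQ[OF t] RQ[OF t] by (auto intro: subspace_diff[OF subspace_Q])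
        show "0 \<le> (Ku + Cm * K) * \<delta> * Cp" using Ku0 Cm0 K0 \<delta> Cp by simp
        fix v assume v: "v \<in> X"
        have "L2_inner \<Omega> (eu t) v \<le> L2_norm \<Omega> (eu t) * L2_norm \<Omega> v"
          using L2_cauchy_schwarz[OF X_L2[OF euX] X_L2[OF v]] by linarith
        also have "\<dots> \<le> Ku * \<delta> * L2_norm \<Omega> v" using eu by (intro mult_right_mono) auto
        finally have 1: "L2_inner \<Omega> (eu t) v \<le> Ku * \<delta> * L2_norm \<Omega> v" .
        have "- ?m (ew t) v \<le> Cm * L2_norm \<Omega> (ew t) * L2_norm \<Omega> v" using m_le[OF ewX v] by linarith
        also have "\<dots> \<le> Cm * (K * \<delta>) * L2_norm \<Omega> v" using ew Cm0 by (intro mult_right_mono mult_left_mono) auto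
        finally have "L2_inner \<Omega> (\<mu> t - lam t) (div_field \<Omega> v) \<le> (Ku + Cm * K) * \<delta> * L2_norm \<Omega> v"
          using filterX[OF t v] 1 by (simp add: algebra_simps)
        also have "\<dots> \<le> (Ku + Cm * K) * \<delta> * (Cp * L2_norm \<Omega> (grad \<Omega> v))"
          using Cp(2)[OF v] Ku0 Cm0 K0 \<delta> by (intro mult_left_mono) auto
        finally show "L2_inner \<Omega> (\<mu> t - lam t) (div_field \<Omega> v) \<le> (Ku + Cm * K) * \<delta> * Cp * L2_norm \<Omega> (grad \<Omega> v)"
          by (simp add: mult_ac)
      qed
      then show ?thesis using \<beta>(1) by (simp add: field_simps)
    qed
    have C_ge: "Ci * Ku \<le> C" "Ci * K \<le> C" "2 * Kr * Cp / \<beta> \<le> C" "(Ku + Cm * K) * Cp / \<beta> \<le> C"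
      unfolding C_def using C_parts by linarith+
    have up: "c * \<delta> \<le> C * \<delta>" if "c \<le> C" for c using that \<delta> by (intro mult_right_mono) auto
    show "H1_norm \<Omega> (a t - u t) \<le> C * \<delta>"
    proof -
      have "H1_norm \<Omega> (eu t) \<le> Ci * (Ku * \<delta>)"
        using Ci(2)[OF euX] mult_left_mono[OF eu Ci(1)] by linarith
      then show ?thesis using up[OF C_ge(1)] by (simp add: eu_def mult.assoc)
    qed
    show "H1_norm \<Omega> (b t - w t) \<le> C * \<delta>"
    proof -
      have "H1_norm \<Omega> (ew t) \<le> Ci * (K * \<delta>)"
        using Ci(2)[OF ewX] mult_left_mono[OF ew Ci(1)] by linarith
      then show ?thesis using up[OF C_ge(2)] by (simp add: ew_def mult.assoc)
    qed
    show "L2_norm \<Omega> (R t - P t) \<le> C * \<delta>" using pressure up[OF C_ge(3)] by linarith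
    show "L2_norm \<Omega> (\<mu> t - lam t) \<le> C * \<delta>" using multiplier up[OF C_ge(4)] by linarith
  qed
qed

section \<open>Continuous dependence and uniqueness\<close>

lemma norm_0 [simp]: "L2_norm \<Omega> (0 :: real^'n \<Rightarrow> 'b::euclidean_space) = 0" "H1_norm \<Omega> 0 = 0"
  using L2_norm_scaleR[OF subspace_0[OF subspace_L2], of 0] H1_norm_scaleR[OF subspace_0[OF subspace_H1], of 0]
  by simp_all

text \<open>At positive times this is the Lipschitz bound of \<open>stability\<close>. At time 0
  solutions agree with their initial data up to null sets, so the bound on the data applies
  directly.\<close>

lemma continuous_dependence:
  assumes infsup: "inf_sup_condition \<Omega> \<T> k" and \<alpha>: "\<alpha> > 0" and \<nu>: "\<nu> > 0" and T: "T > 0"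
    and data: "emac_reg_data \<Omega> \<T> k \<alpha> T f u0 w0"
    and sol: "emac_reg_solution \<Omega> \<T> k \<nu> \<alpha> T f u0 w0 u P w lam" and \<epsilon>: "\<epsilon> > 0"
  shows "\<exists>\<delta>>0. \<forall>g a0 b0 a R b \<mu>.
      emac_reg_data \<Omega> \<T> k \<alpha> T g a0 b0 \<and> emac_reg_solution \<Omega> \<T> k \<nu> \<alpha> T g a0 b0 a R b \<mu> \<and>
      H1_norm \<Omega> (a0 - u0) < \<delta> \<and> H1_norm \<Omega> (b0 - w0) < \<delta> \<and> (\<forall>t\<in>{0..T}. L2_norm \<Omega> (g t - f t) < \<delta>) \<longrightarrow>
      (\<forall>t\<in>{0..T}. H1_norm \<Omega> (a t - u t) < \<epsilon> \<and> H1_norm \<Omega> (b t - w t) < \<epsilon>) \<and>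
      (\<forall>t\<in>{0<..T}. L2_norm \<Omega> (R t - P t) < \<epsilon> \<and> L2_norm \<Omega> (\<mu> t - lam t) < \<epsilon>)"
proof -
  obtain C where C: "C \<ge> 0" "\<And>\<delta> g a0 b0 a R b \<mu> t. 0 < \<delta> \<Longrightarrow> \<delta> \<le> 1 \<Longrightarrow>
      emac_reg_data \<Omega> \<T> k \<alpha> T g a0 b0 \<Longrightarrow> emac_reg_solution \<Omega> \<T> k \<nu> \<alpha> T g a0 b0 a R b \<mu> \<Longrightarrow>
      H1_norm \<Omega> (a0 - u0) < \<delta> \<Longrightarrow> (\<forall>t\<in>{0..T}. L2_norm \<Omega> (g t - f t) < \<delta>) \<Longrightarrow> t \<in> {0<..T} \<Longrightarrow>
      H1_norm \<Omega> (a t - u t) \<le> C * \<delta> \<and> H1_norm \<Omega> (b t - w t) \<le> C * \<delta> \<and>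
        L2_norm \<Omega> (R t - P t) \<le> C * \<delta> \<and> L2_norm \<Omega> (\<mu> t - lam t) \<le> C * \<delta>"
    using stability[OF infsup \<alpha> \<nu> T data sol] by blast
  \<comment> \<open>The bound 1 is required by \<open>stability\<close>, \<epsilon> serves time 0,
    and the denominator \<open>C + 1\<close> makes \<open>C * \<delta>\<close> strictly smaller than
    \<epsilon> even if \<open>C = 0\<close>.\<close>
  define \<delta> where "\<delta> = min 1 (min \<epsilon> (\<epsilon> / (C + 1)))"
  have \<delta>: "0 < \<delta>" "\<delta> \<le> 1" "\<delta> \<le> \<epsilon>" using \<epsilon> C(1) by (auto simp: \<delta>_def)
  have "(C + 1) * \<delta> \<le> (C + 1) * (\<epsilon> / (C + 1))" using C(1) by (intro mult_left_mono) (auto simp: \<delta>_def)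
  also have "\<dots> = \<epsilon>" using C(1) by simp
  finally have C\<delta>: "C * \<delta> < \<epsilon>" using \<delta>(1) by (simp add: distrib_right)
  show ?thesis
  proof (intro exI[of _ \<delta>] conjI allI impI ballI; (elim conjE)?)
    fix g a0 b0 a R b \<mu> t
    assume data': "emac_reg_data \<Omega> \<T> k \<alpha> T g a0 b0"
      and sol': "emac_reg_solution \<Omega> \<T> k \<nu> \<alpha> T g a0 b0 a R b \<mu>"
      and init: "H1_norm \<Omega> (a0 - u0) < \<delta>" "H1_norm \<Omega> (b0 - w0) < \<delta>"
      and gf: "\<forall>t\<in>{0..T}. L2_norm \<Omega> (g t - f t) < \<delta>"
    note bound = C(2)[OF \<delta>(1,2) data' sol' init(1) gf]
    show "L2_norm \<Omega> (R t - P t) < \<epsilon>" "L2_norm \<Omega> (\<mu> t - lam t) < \<epsilon>" if "t \<in> {0<..T}"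
      using bound[OF that] C\<delta> by auto
    have V0: "u0 \<in> V" "w0 \<in> V" "a0 \<in> V" "b0 \<in> V"
      using data data' by (auto simp: emac_reg_data_def)
    have X0: "u 0 \<in> X" "w 0 \<in> X" "a 0 \<in> X" "b 0 \<in> X"
      and AE0: "AE x in M. u 0 x = u0 x" "AE x in M. w 0 x = w0 x" "AE x in M. a 0 x = a0 x" "AE x in M. b 0 x = b0 x"
      using sol sol' T by (auto simp: emac_reg_solution_def)
    have "AE x in M. (a 0 - u 0) x = (a0 - u0) x" using AE0(1,3) by eventually_elim simp
    then have "H1_norm \<Omega> (a 0 - u 0) = H1_norm \<Omega> (a0 - u0)"
      by (intro H1_norm_cong X_H1 subspace_diff[OF subspace_X] X0 V0[THEN V_X])
    then have 1: "H1_norm \<Omega> (a 0 - u 0) < \<epsilon>" using init \<delta> by simp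
    have "AE x in M. (b 0 - w 0) x = (b0 - w0) x" using AE0(2,4) by eventually_elim simp
    then have "H1_norm \<Omega> (b 0 - w 0) = H1_norm \<Omega> (b0 - w0)"
      by (intro H1_norm_cong X_H1 subspace_diff[OF subspace_X] X0 V0[THEN V_X])
    then have 2: "H1_norm \<Omega> (b 0 - w 0) < \<epsilon>" using init \<delta> by simp
    show "H1_norm \<Omega> (a t - u t) < \<epsilon>" "H1_norm \<Omega> (b t - w t) < \<epsilon>" if "t \<in> {0..T}"
      using that 1 2 bound[of t] C\<delta> by (cases "t = 0"; fastforce)+
  qed (rule \<delta>(1))
qed

lemma AE_eq_if_L2_norm_diff_small:
  assumes "u \<in> L2_space \<Omega>" "v \<in> L2_space \<Omega>" "\<And>\<epsilon>. \<epsilon> > 0 \<Longrightarrow> L2_norm \<Omega> (v - u) < \<epsilon>"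
  shows "AE x in M. u x = v x"
proof -
  have "L2_norm \<Omega> (v - u) = 0"
    using assms(3)[of "L2_norm \<Omega> (v - u)"] L2_norm_nonneg[of "v - u"] by linarith
  then have "AE x in M. (v - u) x = 0"
    using L2_norm_eq_0_iff[OF subspace_diff[OF subspace_L2 assms(2,1)]] by simp
  then show ?thesis by eventually_elim simp
qed

text \<open>A second solution is a perturbation with unchanged data, so its distance from the first
  is below every positive \<epsilon>.\<close>

lemma uniqueness:
  assumes infsup: "inf_sup_condition \<Omega> \<T> k" and \<alpha>: "\<alpha> > 0" and \<nu>: "\<nu> > 0" and T: "T > 0"
    and data: "emac_reg_data \<Omega> \<T> k \<alpha> T f u0 w0"
    and sol1: "emac_reg_solution \<Omega> \<T> k \<nu> \<alpha> T f u0 w0 u1 P1 w1 lam1"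
    and sol2: "emac_reg_solution \<Omega> \<T> k \<nu> \<alpha> T f u0 w0 u2 P2 w2 lam2"
  shows "t \<in> {0..T} \<Longrightarrow> (AE x in M. u1 t x = u2 t x) \<and> (AE x in M. w1 t x = w2 t x)"
    and "t \<in> {0<..T} \<Longrightarrow> (AE x in M. P1 t x = P2 t x) \<and> (AE x in M. lam1 t x = lam2 t x)"
proof -
  have close: "(\<forall>t\<in>{0..T}. H1_norm \<Omega> (u2 t - u1 t) < \<epsilon> \<and> H1_norm \<Omega> (w2 t - w1 t) < \<epsilon>) \<and>
      (\<forall>t\<in>{0<..T}. L2_norm \<Omega> (P2 t - P1 t) < \<epsilon> \<and> L2_norm \<Omega> (lam2 t - lam1 t) < \<epsilon>)" if \<epsilon>: "\<epsilon> > 0" for \<epsilon>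
  proof -
    obtain \<delta> where \<delta>: "\<delta> > 0" "\<And>g a0 b0 a R b \<mu>.
      emac_reg_data \<Omega> \<T> k \<alpha> T g a0 b0 \<and> emac_reg_solution \<Omega> \<T> k \<nu> \<alpha> T g a0 b0 a R b \<mu> \<and>
      H1_norm \<Omega> (a0 - u0) < \<delta> \<and> H1_norm \<Omega> (b0 - w0) < \<delta> \<and> (\<forall>t\<in>{0..T}. L2_norm \<Omega> (g t - f t) < \<delta>) \<Longrightarrow>
      (\<forall>t\<in>{0..T}. H1_norm \<Omega> (a t - u1 t) < \<epsilon> \<and> H1_norm \<Omega> (b t - w1 t) < \<epsilon>) \<and>
      (\<forall>t\<in>{0<..T}. L2_norm \<Omega> (R t - P1 t) < \<epsilon> \<and> L2_norm \<Omega> (\<mu> t - lam1 t) < \<epsilon>)"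
      using continuous_dependence[OF infsup \<alpha> \<nu> T data sol1 \<epsilon>] by blast
    show ?thesis using data sol2 \<delta>(1) by (intro \<delta>(2)[of f u0 w0]) simp
  qed
  show "(AE x in M. u1 t x = u2 t x) \<and> (AE x in M. w1 t x = w2 t x)" if t: "t \<in> {0..T}"
  proof -
    have X: "u1 t \<in> X" "u2 t \<in> X" "w1 t \<in> X" "w2 t \<in> X"
      using sol1 sol2 t by (auto simp: emac_reg_solution_def)
    have "L2_norm \<Omega> (u2 t - u1 t) < \<epsilon>" "L2_norm \<Omega> (w2 t - w1 t) < \<epsilon>" if "\<epsilon> > 0" for \<epsilon>
      using close[OF that] t L2_norm_le_H1_norm(1) by (meson order.strict_trans1)+
    then show ?thesis using X[THEN X_L2] by (simp add: AE_eq_if_L2_norm_diff_small)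
  qed
  show "(AE x in M. P1 t x = P2 t x) \<and> (AE x in M. lam1 t x = lam2 t x)" if t: "t \<in> {0<..T}"
  proof -
    have "P1 t \<in> Q" "P2 t \<in> Q" "lam1 t \<in> Q" "lam2 t \<in> Q"
      using sol1 sol2 t by (auto simp: emac_reg_solution_def)
    then show ?thesis using close t by (simp add: AE_eq_if_L2_norm_diff_small Q_L2)
  qed
qed

end

theorem theorem3p2:
  fixes \<Omega> :: "(real^'n) set" and \<T> :: "(real^'n) set set" and k :: nat and \<nu> \<alpha> T :: real
  assumes "CARD('n) = 2 \<or> CARD('n) = 3"
    and "convex_polygonal_domain \<Omega>"
    and "conforming_triangulation \<Omega> \<T>"
    and "k \<ge> 1"
    and "inf_sup_condition \<Omega> \<T> k"
    and "\<nu> > 0" and "\<alpha> > 0" and "T > 0"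
  shows
    \<comment> \<open>existence\<close>
    "(\<forall>f u0 w0. emac_reg_data \<Omega> \<T> k \<alpha> T f u0 w0 \<longrightarrow>
        (\<exists>u P w lam. emac_reg_solution \<Omega> \<T> k \<nu> \<alpha> T f u0 w0 u P w lam)) \<and>
     \<comment> \<open>uniqueness\<close>
     (\<forall>f u0 w0 u1 P1 w1 lam1 u2 P2 w2 lam2.
        emac_reg_data \<Omega> \<T> k \<alpha> T f u0 w0 \<and>
        emac_reg_solution \<Omega> \<T> k \<nu> \<alpha> T f u0 w0 u1 P1 w1 lam1 \<and>
        emac_reg_solution \<Omega> \<T> k \<nu> \<alpha> T f u0 w0 u2 P2 w2 lam2 \<longrightarrow>
        (\<forall>t\<in>{0..T}. (AE x in lebesgue_on \<Omega>. u1 t x = u2 t x) \<and>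
                    (AE x in lebesgue_on \<Omega>. w1 t x = w2 t x)) \<and>
        (\<forall>t\<in>{0<..T}. (AE x in lebesgue_on \<Omega>. P1 t x = P2 t x) \<and>
                     (AE x in lebesgue_on \<Omega>. lam1 t x = lam2 t x))) \<and>
     \<comment> \<open>continuous dependence on the data\<close>
     (\<forall>f u0 w0 u P w lam.
        emac_reg_data \<Omega> \<T> k \<alpha> T f u0 w0 \<and>
        emac_reg_solution \<Omega> \<T> k \<nu> \<alpha> T f u0 w0 u P w lam \<longrightarrow>
        (\<forall>\<epsilon>>0. \<exists>\<delta>>0. \<forall>g a0 b0 a R b \<mu>.
           emac_reg_data \<Omega> \<T> k \<alpha> T g a0 b0 \<and>
           emac_reg_solution \<Omega> \<T> k \<nu> \<alpha> T g a0 b0 a R b \<mu> \<and>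
           H1_norm \<Omega> (\<lambda>x. a0 x - u0 x) < \<delta> \<and> H1_norm \<Omega> (\<lambda>x. b0 x - w0 x) < \<delta> \<and>
           (\<forall>t\<in>{0..T}. L2_norm \<Omega> (\<lambda>x. g t x - f t x) < \<delta>) \<longrightarrow>
           (\<forall>t\<in>{0..T}. H1_norm \<Omega> (\<lambda>x. a t x - u t x) < \<epsilon> \<and>
                       H1_norm \<Omega> (\<lambda>x. b t x - w t x) < \<epsilon>) \<and>
           (\<forall>t\<in>{0<..T}. L2_norm \<Omega> (\<lambda>x. R t x - P t x) < \<epsilon> \<and>
                        L2_norm \<Omega> (\<lambda>x. \<mu> t x - lam t x) < \<epsilon>)))"
proof -
  interpret fe_space \<Omega> \<T> k
    using assms(2,3) polytope_imp_bounded bounded_subset[OF _ closure_subset]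
    by unfold_locales (auto simp: convex_polygonal_domain_def)
  \<comment> \<open>The statement writes differences of functions pointwise, the locale as
    subtraction of functions.\<close>
  note stab = continuous_dependence[OF assms(5,7,6,8), unfolded fun_diff_def]
  show ?thesis
  proof (intro conjI allI impI, goal_cases)
    case 1
    then show ?case by (rule existence[OF assms(7,6,8)])
  next
    case 2
    then show ?case by (elim conjE) (intro ballI uniqueness(1)[OF assms(5,7,6,8)])
  next
    case 3
    then show ?case by (elim conjE) (intro ballI uniqueness(2)[OF assms(5,7,6,8)])
  next
    case 4
    then show ?case by (elim conjE) (rule stab)
  qed
qed

end
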